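(* In the DSGD-SW setting described in the context (no regularizers, i.e. $\psi_i=0$ for all $i\in\mathcal V$), let the noise assumption, the network assumption and the subgradient boundedness assumption hold, with tail parameter $\theta\ge\frac12$. For $\ell\in\mathcal V$ let $\widetilde x_\ell^T=\frac1T\sum_{t=1}^T x_{\ell,t}$, where the iterates are generated by DSGD-SW, and let $f=\sum_{i=1}^m f_i$. (i) If $\alpha_t=1/\sqrt{t+1}$, then for any $\ell\in\mathcal V$ and any $0<\delta<1$, with probability at least $1-\delta$, $$f(\widetilde x_{\ell}^T)-f(x^* )\leq \mathcal O\left(\Big(\log\frac{T}{\delta}\Big)^{2\theta}\frac{(\log T)^2}{\sqrt{T}}+\Big(\log\frac{1}{\delta}\Big)^2\Big(\log\frac{T}{\delta}\Big)^{2\max\{0,\theta-1\}}\frac{1}{\sqrt{T}}\right).$$ (ii) If $\alpha_t=1/\sqrt T$ for $t=1,2,\dots,T$, then for any $\ell\in\mathcal V$ and any $0<\delta<1$, with probability at least $1-\delta$, $$f(\widetilde x_{\ell}^T)-f(x^* )\leq \begin{cases}\mathcal O\left(\Big[\big(\log\frac{T}{\delta}\big)^{2\theta}+\big(\log\frac{1}{\delta}\big)^{2}\Big]\frac{1}{\sqrt{T}}\right), & \frac12\le\theta<1,\\[2mm] \mathcal O\left(\big(\log\frac{T}{\delta}\big)^{2\theta}\frac{1}{\sqrt{T}}\right), & \theta\ge1.\end{cases}$$ Here $\mathcal O(\cdot)$ hides a positive constant factor independent of $T$ and $\delta$ (it may depend on the problem, network, noise and initialization data).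
   Context: Setting. $n,m$ are positive integers, $\mathcal V=\{1,\dots,m\}$, $\|\cdot\|$ is a norm on $\mathbb R^n$, $\langle\cdot,\cdot\rangle$ the Euclidean inner product, $\|\cdot\|_2$ the Euclidean norm, and $\|z\|_*=\sup_{\|u\|\le1}|\langle z,u\rangle|$ the dual norm of $\|\cdot\|$. $\mathcal X\subset\mathbb R^n$ is closed and convex (possibly unbounded); $f_i:\mathcal X\to\mathbb R$, $i\in\mathcal V$, are convex and possibly nonsmooth. A point $x^*\in\mathcal X$ with $f(x)\ge f(x^* )$ for all $x\in\mathcal X$ exists and is fixed. Algorithm (DSGD-SW). Given $m\times m$ communication matrices $W_t$ with nonnegative entries, edge sets $\mathcal E_t=\{(j,i):[W_t]_{ij}>0\}$, stepsizes $\alpha_t>0$ and deterministic initial points $x_{i,1}\in\mathcal X$ (not depending on $T$), for $t\ge1$ and $i\in\mathcal V$: $$x_{i,t+1}=P_{\mathcal X}\Big(\sum_{j=1}^m[W_t]_{ij}x_{j,t}-\alpha_t\widehat g_{i,t}^{SW}\Big),\qquad P_{\mathcal X}(z)=\arg\min_{x\in\mathcal X}\|z-x\|_2,$$ where $\widehat g_{i,t}^{SW}=g_{i,t}-\xi_{i,t}$, $g_{i,t}\in\partial f_i(x_{i,t})$, $\mathbb E[\xi_{i,t}|\mathcal F_{t-1}]=0$, and $\mathcal F_t$ is the $\sigma$-field generated by the entire history of the randomness up to step $t$ (so $x_{i,t},g_{i,t}$ are $\mathcal F_{t-1}$-measurable). Noise assumption: for some $\theta\ge\frac12$ there is $\kappa>0$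 such that $\mathbb E[\exp\{(\|\xi_{i,t}\|_*/\kappa)^{1/\theta}\}\,|\,\mathcal F_{t-1}]\le2$ for all $t\ge1$, $i\in\mathcal V$. Network assumption: (a) each $W_t$ is doubly stochastic; (b) there is an integer $B\ge1$ such that the graph $(\mathcal V,\mathcal E_{kB+1}\cup\dots\cup\mathcal E_{(k+1)B})$ is strongly connected for every $k\ge0$; (c) there is $0<\eta<1$ with $[W_t]_{ii}\ge\eta$ for all $i,t$ and $[W_t]_{ij}\ge\eta$ whenever $(j,i)\in\mathcal E_t$. Subgradient boundedness assumption: there is $G>0$ with $\|g\|_*\le G$ for all $x\in\mathcal X$, $g\in\partial f_i(x)$, $i\in\mathcal V$. Convention: the horizon $T$ is an integer with $T\ge10$. *)

theory Defs
  imports "HOL-Probability.Probability"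
begin

definition is_norm :: "('a::real_vector \<Rightarrow> real) \<Rightarrow> bool" where
  "is_norm N \<longleftrightarrow>
     (\<forall>x. 0 \<le> N x) \<and> (\<forall>x. N x = 0 \<longleftrightarrow> x = 0) \<and>
     (\<forall>c x. N (c *\<^sub>R x) = \<bar>c\<bar> * N x) \<and> (\<forall>x y. N (x + y) \<le> N x + N y)"

definition dual_norm :: "('a::real_inner \<Rightarrow> real) \<Rightarrow> 'a \<Rightarrow> real" where
  "dual_norm N z = (SUP u\<in>{u. N u \<le> 1}. \<bar>z \<bullet> u\<bar>)"

text \<open>Subdifferential of a function with effective domain \<open>D\<close>; values of \<open>h\<close> outside \<open>D\<close>
  are irrelevant. If \<open>D\<close> is closed and not the whole space, then at a boundary point of \<open>D\<close>
  this set is empty or, because it absorbs the normal cone of \<open>D\<close>, unbounded.\<close>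

definition subdifferential :: "'a::real_inner set \<Rightarrow> ('a \<Rightarrow> real) \<Rightarrow> 'a \<Rightarrow> 'a set" where
  "subdifferential D h x = {g. \<forall>y\<in>D. h y \<ge> h x + g \<bullet> (y - x)}"

definition doubly_stochastic :: "nat \<Rightarrow> (nat \<Rightarrow> nat \<Rightarrow> real) \<Rightarrow> bool" where
  "doubly_stochastic m A \<longleftrightarrow>
     (\<forall>i\<in>{1..m}. \<forall>j\<in>{1..m}. 0 \<le> A i j) \<and>
     (\<forall>i\<in>{1..m}. (\<Sum>j=1..m. A i j) = 1) \<and>
     (\<forall>j\<in>{1..m}. (\<Sum>i=1..m. A i j) = 1)"

text \<open>Node \<open>j\<close> sends to node \<open>i\<close> iff entry \<open>(i, j)\<close> is positive.\<close>

definition comm_edges :: "nat \<Rightarrow> (nat \<Rightarrow> nat \<Rightarrow> real) \<Rightarrow> (nat \<times> nat) set" where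
  "comm_edges m A = {(j, i). j \<in> {1..m} \<and> i \<in> {1..m} \<and> 0 < A i j}"

definition strongly_connected_on :: "'v set \<Rightarrow> ('v \<times> 'v) set \<Rightarrow> bool" where
  "strongly_connected_on V E \<longleftrightarrow> (\<forall>u\<in>V. \<forall>v\<in>V. (u, v) \<in> E\<^sup>*)"

definition network_assumption ::
  "nat \<Rightarrow> (nat \<Rightarrow> nat \<Rightarrow> nat \<Rightarrow> real) \<Rightarrow> nat \<Rightarrow> real \<Rightarrow> bool" where
  "network_assumption m W B \<eta> \<longleftrightarrow>
     (\<forall>t\<ge>1. doubly_stochastic m (W t)) \<and>
     1 \<le> B \<and>
     (\<forall>k. strongly_connected_on {1..m} (\<Union>t\<in>{k * B + 1..(k + 1) * B}. comm_edges m (W t))) \<and>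
     0 < \<eta> \<and> \<eta> < 1 \<and>
     (\<forall>t\<ge>1. \<forall>i\<in>{1..m}. \<eta> \<le> W t i i) \<and>
     (\<forall>t\<ge>1. \<forall>i\<in>{1..m}. \<forall>j\<in>{1..m}. (j, i) \<in> comm_edges m (W t) \<longrightarrow> \<eta> \<le> W t i j)"

definition subgradients_bounded ::
  "nat \<Rightarrow> ('a::real_inner \<Rightarrow> real) \<Rightarrow> 'a set \<Rightarrow> 'a set \<Rightarrow> (nat \<Rightarrow> 'a \<Rightarrow> real) \<Rightarrow> real \<Rightarrow> bool" where
  "subgradients_bounded m N D X f G \<longleftrightarrow>
     0 < G \<and> (\<forall>i\<in>{1..m}. \<forall>x\<in>X. \<forall>g\<in>subdifferential D (f i) x. dual_norm N g \<le> G)"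

text \<open>A run of the algorithm on the probability space \<open>M\<close>. The filtration \<open>F\<close> is any filtration
  to which the noise is adapted and for which iterates and subgradients are predictable; this
  leaves open what else (such as the choice of the subgradients) is random. Vector-valued
  conditional expectations are taken coordinatewise.\<close>

definition dsgd_sw_run ::
  "nat \<Rightarrow> (real^'n) set \<Rightarrow> (real^'n) set \<Rightarrow> (nat \<Rightarrow> real^'n \<Rightarrow> real) \<Rightarrow>
   (nat \<Rightarrow> nat \<Rightarrow> nat \<Rightarrow> real) \<Rightarrow> (nat \<Rightarrow> real^'n) \<Rightarrow> (nat \<Rightarrow> real) \<Rightarrow>
   'w measure \<Rightarrow> (nat \<Rightarrow> 'w measure) \<Rightarrow>
   (nat \<Rightarrow> nat \<Rightarrow> 'w \<Rightarrow> real^'n) \<Rightarrow> (nat \<Rightarrow> nat \<Rightarrow> 'w \<Rightarrow> real^'n) \<Rightarrow> (nat \<Rightarrow> nat \<Rightarrow> 'w \<Rightarrow> real^'n) \<Rightarrow>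
   bool" where
  "dsgd_sw_run m D X f W x1 \<alpha> M F x g \<xi> \<longleftrightarrow>
     prob_space M \<and> filtration (space M) F \<and> (\<forall>t. subalgebra M (F t)) \<and>
     (\<forall>t\<ge>1. 0 < \<alpha> t) \<and>
     (\<forall>i\<in>{1..m}. \<forall>\<omega>\<in>space M. x i 1 \<omega> = x1 i) \<and>
     (\<forall>t\<ge>1. \<forall>i\<in>{1..m}.
        x i t \<in> borel_measurable (F (t - 1)) \<and>
        g i t \<in> borel_measurable (F (t - 1)) \<and>
        \<xi> i t \<in> borel_measurable (F t) \<and>
        (\<forall>\<omega>\<in>space M. g i t \<omega> \<in> subdifferential D (f i) (x i t \<omega>)) \<and>
        integrable M (\<xi> i t) \<and>
        (\<forall>k. AE \<omega> in M. real_cond_exp M (F (t - 1)) (\<lambda>\<omega>'. \<xi> i t \<omega>' $ k) \<omega> = 0) \<and>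
        (\<forall>\<omega>\<in>space M. x i (t + 1) \<omega> =
           closest_point X
             ((\<Sum>j=1..m. W t i j *\<^sub>R x j t \<omega>) - \<alpha> t *\<^sub>R (g i t \<omega> - \<xi> i t \<omega>))))"

definition noise_assumption ::
  "nat \<Rightarrow> (real^'n \<Rightarrow> real) \<Rightarrow> real \<Rightarrow> real \<Rightarrow> 'w measure \<Rightarrow> (nat \<Rightarrow> 'w measure) \<Rightarrow>
   (nat \<Rightarrow> nat \<Rightarrow> 'w \<Rightarrow> real^'n) \<Rightarrow> bool" where
  "noise_assumption m N \<theta> \<kappa> M F \<xi> \<longleftrightarrow>
     (\<forall>t\<ge>1. \<forall>i\<in>{1..m}. AE \<omega> in M.
        nn_cond_exp M (F (t - 1))
          (\<lambda>\<omega>'. ennreal (exp ((dual_norm N (\<xi> i t \<omega>') / \<kappa>) powr (1 / \<theta>)))) \<omega> \<le> 2)"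

definition time_average :: "(nat \<Rightarrow> 'w \<Rightarrow> 'a::real_vector) \<Rightarrow> nat \<Rightarrow> 'w \<Rightarrow> 'a" where
  "time_average y T \<omega> = (1 / real T) *\<^sub>R (\<Sum>t=1..T. y t \<omega>)"

end

theory Submission
  imports Defs
begin

text \<open>
The quantity that drives the proof is the energy \<open>V t\<close>, the sum over the agents of the squared
Euclidean distance of \<open>x i t\<close> to the minimiser. Nonexpansiveness of the projection, double
stochasticity and the subgradient inequality give (\<open>descent_step\<close>), for every agent \<open>l\<close>, that
\<open>V (t + 1)\<close> plus \<open>2 \<alpha> t\<close> times the gap of the objective at \<open>x l t\<close> is at most \<open>V t\<close> plus three
errors: a multiple of \<open>\<alpha> t\<close> times the disagreement of the agents, a term of order
\<open>(\<alpha> t)\<^sup>2\<close> containing the squared norms of subgradients and noise, and a martingale increment,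
the inner product of the noise with the vector from the minimiser to the mixed iterate. Summing over
\<open>t\<close> bounds the weighted sum of the gaps, and convexity turns this into a bound at the time average.

Disagreement. Over a window of \<open>(m + 1) B\<close> steps every agent influences every other one with a weight
bounded below, so the diameter of the configuration contracts by a fixed factor
(\<open>spread_contraction\<close>) up to the lengths of the steps taken. Its sum weighted by the step sizes is
therefore of the order of the sum of squared step sizes (\<open>weighted_spread_sum_le\<close>).

Size of the noise. A union bound keeps all noise vectors up to time \<open>T\<close> below a multiple of
\<open>ln (T / \<delta>) powr \<theta>\<close>. The square of this produces the main term of both rates.

Martingale. There are two obstacles. The noise may lack exponential moments, and the vector it is
paired with may be unbounded, because \<open>X\<close> may be. The first is met by truncating the noise at the
level that it respects with high probability anyway: the truncated noise has a conditional moment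
generating function of sub-Gaussian form for all arguments up to the order of
\<open>ln (T / \<delta>) powr (- max 0 (\<theta> - 1))\<close> (\<open>exp_truncated_inner_le\<close>, \<open>truncated_noise_mgf_step\<close>),
and this restriction is the source of the exponent \<open>2 * max 0 (\<theta> - 1)\<close>. The second is met by a
predictable cut-off: the vector is replaced by zero when the energy exceeds a deterministic level
\<open>d\<close>, and divided by the root of \<open>d\<close>. The deviation bound for this bounded martingale gives
back, through the descent inequality, that the energy is below \<open>d\<close>, provided that \<open>d\<close> exceeds a
multiple of the initial energy, the other errors and the squared deviation. For such a \<open>d\<close> an
induction over time shows that the cut-off never acts (\<open>pathwise_descent\<close>). The deviation bound is
needed at all times up to \<open>T\<close>; a plain union bound suffices, since the extra \<open>ln T\<close> can be absorbed
by the rates (\<open>decreasing_step_rate\<close>, \<open>constant_step_rate\<close>).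

Comparing \<open>f i\<close> at the iterates of two agents needs a subgradient at an iterate that does not belong
to agent \<open>i\<close>. It exists because a boundary point of \<open>D\<close> cannot have a bounded nonempty
subdifferential, so that all iterates lie in the interior of \<open>D\<close>
(\<open>bounded_subdifferential_imp_interior\<close>). For the same reason the objective at the averages is
measurable.
\<close>

section \<open>Norms on Euclidean space\<close>

lemma is_norm_equiv:
  fixes N :: "'a::euclidean_space \<Rightarrow> real"
  assumes "is_norm N"
  obtains c C where "0 < c" "0 < C" "\<And>u. c * norm u \<le> N u" "\<And>u. N u \<le> C * norm u"
proof -
  have nn: "0 \<le> N x" and z: "N x = 0 \<longleftrightarrow> x = 0" and sc: "N (k *\<^sub>R x) = \<bar>k\<bar> * N x"
    and tri: "N (x + y) \<le> N x + N y" for x y k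
    using assms unfolding is_norm_def by auto
  define C where "C = (\<Sum>b\<in>Basis. N b) + 1"
  have C0: "C > 0" unfolding C_def using sum_nonneg[of Basis N] nn by (simp add: add_nonneg_pos)
  have sumN: "N (\<Sum>b\<in>A. h b) \<le> (\<Sum>b\<in>A. N (h b))" if "finite A" for h :: "'a \<Rightarrow> 'a" and A
    using that
  proof (induction A rule: finite_induct)
    case empty
    then show ?case using z[of 0] by simp
  next
    case (insert a A)
    then show ?case using tri[of "h a" "sum h A"] by simp
  qed
  have upper: "N u \<le> C * norm u" for u
  proof -
    have "N u = N (\<Sum>b\<in>Basis. (u \<bullet> b) *\<^sub>R b)" by (simp add: euclidean_representation)
    also have "\<dots> \<le> (\<Sum>b\<in>Basis. N ((u \<bullet> b) *\<^sub>R b))" by (rule sumN) simp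
    also have "\<dots> \<le> (\<Sum>b\<in>Basis. norm u * N b)"
      by (rule sum_mono) (simp add: sc mult_right_mono nn Basis_le_norm)
    also have "\<dots> \<le> C * norm u"
      unfolding C_def using sum_distrib_left[of "norm u" N Basis] by (simp add: algebra_simps)
    finally show ?thesis .
  qed
  have diff: "\<bar>N x - N y\<bar> \<le> C * norm (x - y)" for x y
  proof -
    have "N x \<le> N y + N (x - y)" using tri[of y "x - y"] by simp
    moreover have "N y \<le> N x + N (y - x)" using tri[of x "y - x"] by simp
    moreover have "N (y - x) = N (x - y)" using sc[of "-1" "x - y"] by simp
    ultimately show ?thesis using upper[of "x - y"] by linarith
  qed
  have "C-lipschitz_on UNIV N"
    by (rule lipschitz_onI) (use diff C0 in \<open>auto simp: dist_norm\<close>)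
  then have cont: "continuous_on (sphere 0 1) N"
    using lipschitz_on_continuous_on continuous_on_subset by blast
  obtain e :: 'a where e: "e \<in> Basis" using nonempty_Basis by blast
  have "sphere (0::'a) 1 \<noteq> {}" using e norm_Basis[OF e] by (metis dist_0_norm empty_iff mem_sphere)
  then obtain v where v: "v \<in> sphere 0 1" "\<And>u. u \<in> sphere 0 1 \<Longrightarrow> N v \<le> N u"
    using continuous_attains_inf[OF compact_sphere _ cont] by blast
  have "N v > 0" using v(1) z[of v] nn[of v] by (cases "v = 0") (auto simp: less_le)
  moreover have "N v * norm u \<le> N u" for u
  proof (cases "u = 0")
    case True then show ?thesis using nn by simp
  next
    case False
    have "N v \<le> N ((1 / norm u) *\<^sub>R u)" by (rule v(2)) (use False in simp)
    also have "\<dots> = N u / norm u" by (simp add: sc)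
    finally show ?thesis using False by (simp add: field_simps)
  qed
  ultimately show ?thesis using that C0 upper by blast
qed

text \<open>The bound by a multiple of the dual norm lets every later estimate use the Euclidean norm.
Continuity makes the dual norm of the noise a random variable. The supremum defining the dual
norm is finite because the unit ball of \<open>N\<close> is bounded.\<close>

lemma dual_norm_equiv:
  fixes N :: "'a::euclidean_space \<Rightarrow> real"
  assumes "is_norm N"
  obtains c where "0 < c" "\<And>z. norm z \<le> c * dual_norm N z" "continuous_on UNIV (dual_norm N)"
proof -
  obtain c C where c: "0 < c" "0 < C" "\<And>u. c * norm u \<le> N u" "\<And>u. N u \<le> C * norm u"
    using is_norm_equiv[OF assms] by metis
  have sc: "N (k *\<^sub>R x) = \<bar>k\<bar> * N x" for x k using assms unfolding is_norm_def by auto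
  have N0: "N 0 = 0" using assms unfolding is_norm_def by auto
  have ne: "{u. N u \<le> 1} \<noteq> {}" using N0 by (intro ex_in_conv[THEN iffD1] exI[of _ 0]) simp
  have bound: "\<bar>z \<bullet> u\<bar> \<le> norm z * (1 / c)" if "N u \<le> 1" for z u
  proof -
    have "norm u \<le> 1 / c" using c(1) c(3)[of u] that by (simp add: field_simps)
    then show ?thesis
      using Cauchy_Schwarz_ineq2[of z u] mult_left_mono[of "norm u" "1 / c" "norm z"] by simp
  qed
  have bdd: "bdd_above ((\<lambda>u. \<bar>z \<bullet> u\<bar>) ` {u. N u \<le> 1})" for z
    using bound by (intro bdd_aboveI2[where M = "norm z * (1 / c)"]) simp
  have le: "norm z \<le> C * dual_norm N z" for z
  proof (cases "z = 0")
    case True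
    have "\<bar>z \<bullet> 0\<bar> \<le> dual_norm N z"
      unfolding dual_norm_def by (rule cSUP_upper[OF _ bdd]) (simp add: N0)
    then show ?thesis using True c by simp
  next
    case False
    define u where "u = (1 / (C * norm z)) *\<^sub>R z"
    have "N u \<le> 1" using c(2) c(4)[of z] False by (simp add: u_def sc field_simps)
    then have "\<bar>z \<bullet> u\<bar> \<le> dual_norm N z"
      unfolding dual_norm_def by (intro cSUP_upper[OF _ bdd]) simp
    moreover have "\<bar>z \<bullet> u\<bar> = norm z / C"
      using False c(2) by (simp add: u_def dot_square_norm power2_eq_square abs_mult)
    ultimately show ?thesis using c(2) by (simp add: field_simps)
  qed
  have one: "dual_norm N x \<le> dual_norm N y + (1 / c) * dist x y" for x y
    unfolding dual_norm_def[of N x]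
  proof (rule cSUP_least[OF ne])
    fix u assume u: "u \<in> {u. N u \<le> 1}"
    have "\<bar>x \<bullet> u\<bar> \<le> \<bar>y \<bullet> u\<bar> + \<bar>(x - y) \<bullet> u\<bar>" by (simp add: inner_diff_left)
    moreover have "\<bar>y \<bullet> u\<bar> \<le> dual_norm N y"
      unfolding dual_norm_def by (rule cSUP_upper[OF u bdd])
    ultimately show "\<bar>x \<bullet> u\<bar> \<le> dual_norm N y + (1 / c) * dist x y"
      using bound[of u "x - y"] u by (simp add: dist_norm)
  qed
  have "(1 / c)-lipschitz_on UNIV (dual_norm N)"
  proof (rule lipschitz_onI)
    fix x y show "dist (dual_norm N x) (dual_norm N y) \<le> 1 / c * dist x y"
      using one[of x y] one[of y x] by (simp add: dist_real_def abs_le_iff dist_commute)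
  qed (use c in simp)
  then show ?thesis using that[OF c(2) le] lipschitz_on_continuous_on by blast
qed

section \<open>Subgradients of convex functions\<close>

lemma supporting_functional_nonneg_imp_zero:
  fixes a :: "'a::real_inner"
  assumes "x \<in> interior D" "\<And>y. y \<in> D \<Longrightarrow> 0 \<le> a \<bullet> (y - x)"
  shows "a = 0"
proof (rule ccontr)
  assume a: "a \<noteq> 0"
  obtain e where e: "e > 0" "ball x e \<subseteq> D" using assms(1) mem_interior by blast
  define y where "y = x - (e / 2 / norm a) *\<^sub>R a"
  have "y \<in> ball x e" using e a by (simp add: y_def dist_norm)
  then have "0 \<le> a \<bullet> (y - x)" using assms(2) e by blast
  moreover have "a \<bullet> (y - x) = - (e / 2 * norm a)"
    using a by (simp add: y_def dot_square_norm power2_eq_square)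
  moreover have "0 < e / 2 * norm a" using e a by simp
  ultimately show False by linarith
qed

text \<open>A hyperplane separating the point \<open>(x, h x)\<close> from the strict epigraph cannot be vertical when
\<open>x\<close> is interior, so its slope is a subgradient.\<close>

lemma subdifferential_nonempty_interior:
  fixes h :: "'a::euclidean_space \<Rightarrow> real"
  assumes cv: "convex_on D h" and x: "x \<in> interior D"
  shows "subdifferential D h x \<noteq> {}"
proof -
  define E where "E = {(y, s). y \<in> D \<and> h y < s}"
  have xD: "x \<in> D" using x interior_subset by blast
  have "convex E"
  proof (rule convexI)
    fix p q :: "'a \<times> real" and u v :: real
    assume p: "p \<in> E" and q: "q \<in> E" and uv: "0 \<le> u" "0 \<le> v" "u + v = 1"
    obtain y s where ps: "p = (y, s)" "y \<in> D" "h y < s" using p E_def by auto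
    obtain z t where qt: "q = (z, t)" "z \<in> D" "h z < t" using q E_def by auto
    have "h (u *\<^sub>R y + v *\<^sub>R z) \<le> u * h y + v * h z"
      using cv ps qt uv unfolding convex_on_def by blast
    also have "\<dots> < u * s + v * t"
    proof (cases "u = 0")
      case True then show ?thesis using uv qt by simp
    next
      case False
      then have "u * h y < u * s" using ps uv by simp
      moreover have "v * h z \<le> v * t" using qt uv by (simp add: mult_left_mono)
      ultimately show ?thesis by linarith
    qed
    finally have "h (u *\<^sub>R y + v *\<^sub>R z) < u * s + v * t" .
    moreover have "u *\<^sub>R y + v *\<^sub>R z \<in> D"
      using cv ps qt uv unfolding convex_on_def convex_def by blast
    ultimately show "u *\<^sub>R p + v *\<^sub>R q \<in> E" using ps qt by (simp add: E_def)
  qed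
  moreover have "(x, h x + 1) \<in> E" using xD by (simp add: E_def)
  moreover have "{(x, h x)} \<inter> E = {}" by (auto simp: E_def)
  ultimately obtain p k where p: "p \<noteq> 0" "\<And>q. q \<in> {(x, h x)} \<Longrightarrow> inner p q \<le> k" "\<And>q. q \<in> E \<Longrightarrow> k \<le> inner p q"
    using separating_hyperplane_sets[of "{(x, h x)}" E] by (metis convex_singleton empty_iff insert_not_empty)
  obtain a b where ab: "p = (a, b)" by (cases p)
  have sep: "a \<bullet> x + b * h x \<le> a \<bullet> y + b * s" if "y \<in> D" "h y < s" for y s
    using p(2)[of "(x, h x)"] p(3)[of "(y, s)"] that by (simp add: ab E_def)
  have b0: "0 \<le> b" using sep[OF xD, of "h x + 1"] by (simp add: algebra_simps)
  have "b \<noteq> 0"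
  proof
    assume "b = 0"
    then have "0 \<le> a \<bullet> (y - x)" if "y \<in> D" for y
      using sep[OF that, of "h y + 1"] by (simp add: inner_diff_right)
    then have "a = 0" using supporting_functional_nonneg_imp_zero[OF x] by blast
    then show False using p(1) ab \<open>b = 0\<close> by (simp add: zero_prod_def)
  qed
  with b0 have b: "b > 0" by simp
  have "- (1 / b) *\<^sub>R a \<in> subdifferential D h x"
    unfolding subdifferential_def
  proof (clarify)
    fix y assume y: "y \<in> D"
    have "h x + (- (1 / b) *\<^sub>R a) \<bullet> (y - x) \<le> h y + e" if "e > 0" for e
      using sep[OF y, of "h y + e"] that b by (simp add: inner_diff_right field_simps)
    then show "h x + (- (1 / b) *\<^sub>R a) \<bullet> (y - x) \<le> h y" by (rule field_le_epsilon)
  qed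
  then show ?thesis by blast
qed

text \<open>At a boundary point the domain has a nonzero outer normal, and adding any positive multiple of it
to a subgradient gives another one. A bounded nonempty subdifferential therefore forces the point
into the interior. For a run this places every iterate in the interior of \<open>D\<close>, where all the
functions, and not only the one whose subgradient is evaluated, have subgradients.\<close>

lemma bounded_subdifferential_imp_interior:
  fixes h :: "'a::euclidean_space \<Rightarrow> real"
  assumes cD: "convex D" and x: "x \<in> D" and g: "g \<in> subdifferential D h x"
    and bd: "\<And>g. g \<in> subdifferential D h x \<Longrightarrow> norm g \<le> G"
  shows "x \<in> interior D"
proof (rule ccontr)
  assume nx: "x \<notin> interior D"
  have "\<exists>a. a \<noteq> 0 \<and> (\<forall>y\<in>D. a \<bullet> (y - x) \<le> 0)"
  proof (cases "interior D = {}")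
    case True
    then obtain a b where a: "a \<noteq> 0" "D \<subseteq> {x. a \<bullet> x = b}"
      using empty_interior_subset_hyperplane[OF cD] by metis
    then have "a \<bullet> (y - x) \<le> 0" if "y \<in> D" for y using that x subsetD[OF a(2)] by (simp add: inner_diff_right)
    then show ?thesis using a by blast
  next
    case False
    obtain a b where a: "a \<noteq> 0" "\<And>y. y \<in> interior D \<Longrightarrow> inner a y \<le> b" "\<And>y. y \<in> {x} \<Longrightarrow> b \<le> inner a y"
      using separating_hyperplane_sets[of "interior D" "{x}"] False nx cD convex_interior
      by (metis Int_insert_right_if0 convex_singleton inf_bot_right insert_not_empty)
    have "closure (interior D) \<subseteq> {y. a \<bullet> y \<le> b}"
      by (rule closure_minimal) (use a closed_halfspace_le in auto)
    then have "D \<subseteq> {y. a \<bullet> y \<le> b}"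
      using convex_closure_interior[OF cD False] closure_subset by blast
    then have "a \<bullet> (y - x) \<le> 0" if "y \<in> D" for y using that a(3)[of x] by (auto simp: inner_diff_right)
    then show ?thesis using a by blast
  qed
  then obtain a where a: "a \<noteq> 0" "\<And>y. y \<in> D \<Longrightarrow> a \<bullet> (y - x) \<le> 0" by blast
  define s where "s = (\<bar>G\<bar> + norm g + 1) / norm a"
  have s0: "0 \<le> s" unfolding s_def by simp
  have "g + s *\<^sub>R a \<in> subdifferential D h x"
  proof -
    have "h x + (g + s *\<^sub>R a) \<bullet> (y - x) \<le> h y" if "y \<in> D" for y
    proof -
      have "h x + g \<bullet> (y - x) \<le> h y" using g that unfolding subdifferential_def by blast
      moreover have "s * (a \<bullet> (y - x)) \<le> 0" using s0 a(2)[OF that] by (rule mult_nonneg_nonpos)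
      ultimately show ?thesis by (simp add: inner_add_left)
    qed
    then show ?thesis unfolding subdifferential_def by blast
  qed
  then have "norm (g + s *\<^sub>R a) \<le> G" by (rule bd)
  moreover have "norm (s *\<^sub>R a) = \<bar>G\<bar> + norm g + 1" using a(1) s0 by (simp add: s_def)
  moreover have "norm (s *\<^sub>R a) \<le> norm (g + s *\<^sub>R a) + norm g"
    using norm_triangle_ineq4[of "g + s *\<^sub>R a" g] by simp
  ultimately show False by linarith
qed

section \<open>Products of doubly stochastic matrices\<close>

text \<open>Two weight vectors of equal mass \<open>c\<close> can be coupled by their product divided by \<open>c\<close>, which writes
the difference of the two combinations as an average of differences \<open>y i - y j\<close>. Subtracting a
common part from two averages thus shrinks their distance by the factor \<open>c\<close>.\<close>

lemma norm_weighted_diff_le: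
  fixes y :: "'i \<Rightarrow> 'a::real_normed_vector"
  assumes "finite I" "\<And>i. i \<in> I \<Longrightarrow> 0 \<le> p i" "\<And>i. i \<in> I \<Longrightarrow> 0 \<le> q i"
    and "sum p I = c" "sum q I = c"
    and d: "\<And>i j. i \<in> I \<Longrightarrow> j \<in> I \<Longrightarrow> norm (y i - y j) \<le> d"
  shows "norm ((\<Sum>i\<in>I. p i *\<^sub>R y i) - (\<Sum>i\<in>I. q i *\<^sub>R y i)) \<le> c * d"
proof (cases "c = 0")
  case True
  then have "\<And>i. i \<in> I \<Longrightarrow> p i = 0" "\<And>i. i \<in> I \<Longrightarrow> q i = 0"
    using assms sum_nonneg_eq_0_iff[of I p] sum_nonneg_eq_0_iff[of I q] by auto
  then show ?thesis using True by simp
next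
  case False
  then have c: "c > 0" using assms(2,4) sum_nonneg[of I p] by force
  have "c *\<^sub>R ((\<Sum>i\<in>I. p i *\<^sub>R y i) - (\<Sum>i\<in>I. q i *\<^sub>R y i))
      = (\<Sum>i\<in>I. \<Sum>j\<in>I. (p i * q j) *\<^sub>R (y i - y j))"
  proof -
    have "(\<Sum>j\<in>I. (p i * q j) *\<^sub>R y i) = c *\<^sub>R (p i *\<^sub>R y i)" for i
      using assms(5) by (simp only: scaleR_left.sum[symmetric] sum_distrib_left[symmetric] scaleR_scaleR mult.commute)
    then have "(\<Sum>i\<in>I. \<Sum>j\<in>I. (p i * q j) *\<^sub>R y i) = c *\<^sub>R (\<Sum>i\<in>I. p i *\<^sub>R y i)"
      by (simp only: scaleR_right.sum)
    moreover have "(\<Sum>i\<in>I. (p i * q j) *\<^sub>R y j) = c *\<^sub>R (q j *\<^sub>R y j)" for j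
      using assms(4) by (simp only: scaleR_left.sum[symmetric] sum_distrib_right[symmetric] scaleR_scaleR)
    then have "(\<Sum>i\<in>I. \<Sum>j\<in>I. (p i * q j) *\<^sub>R y j) = c *\<^sub>R (\<Sum>j\<in>I. q j *\<^sub>R y j)"
      by (subst sum.swap) (simp only: scaleR_right.sum)
    ultimately show ?thesis by (simp add: scaleR_diff_right sum_subtractf)
  qed
  then have "norm (c *\<^sub>R ((\<Sum>i\<in>I. p i *\<^sub>R y i) - (\<Sum>i\<in>I. q i *\<^sub>R y i)))
      = norm (\<Sum>i\<in>I. \<Sum>j\<in>I. (p i * q j) *\<^sub>R (y i - y j))"
    by (rule arg_cong)
  then have "c * norm ((\<Sum>i\<in>I. p i *\<^sub>R y i) - (\<Sum>i\<in>I. q i *\<^sub>R y i))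
      = norm (\<Sum>i\<in>I. \<Sum>j\<in>I. (p i * q j) *\<^sub>R (y i - y j))"
    unfolding norm_scaleR using c by (simp only: abs_of_pos)
  also have "\<dots> \<le> (\<Sum>i\<in>I. norm (\<Sum>j\<in>I. (p i * q j) *\<^sub>R (y i - y j)))" by (rule norm_sum)
  also have "\<dots> \<le> (\<Sum>i\<in>I. \<Sum>j\<in>I. norm ((p i * q j) *\<^sub>R (y i - y j)))"
    by (intro sum_mono norm_sum)
  also have "\<dots> \<le> (\<Sum>i\<in>I. \<Sum>j\<in>I. p i * q j * d)"
    by (intro sum_mono) (simp add: assms mult_left_mono)
  also have "\<dots> = c * (c * d)"
    by (simp add: sum_distrib_left[symmetric] sum_distrib_right[symmetric] assms(4,5) mult.assoc)
  finally show ?thesis using c by simp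
qed

text \<open>The entries of the product \<open>W (t + k - 1) \<dots> W t\<close>, the influence of agent \<open>j\<close> at time \<open>t\<close>
on agent \<open>i\<close> at time \<open>t + k\<close>.\<close>

primrec mix_weights ::
  "nat \<Rightarrow> (nat \<Rightarrow> nat \<Rightarrow> nat \<Rightarrow> real) \<Rightarrow> nat \<Rightarrow> nat \<Rightarrow> nat \<Rightarrow> nat \<Rightarrow> real" where
  "mix_weights m W t 0 = (\<lambda>i j. if i = j then 1 else 0)"
| "mix_weights m W t (Suc k) = (\<lambda>i j. \<Sum>l=1..m. W (t + k) i l * mix_weights m W t k l j)"

context
  fixes m :: nat and W :: "nat \<Rightarrow> nat \<Rightarrow> nat \<Rightarrow> real" and B :: nat and \<eta> :: real
  assumes m: "1 \<le> m" and net: "network_assumption m W B \<eta>"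
begin

lemma weights_nonneg: "1 \<le> t \<Longrightarrow> i \<in> {1..m} \<Longrightarrow> j \<in> {1..m} \<Longrightarrow> 0 \<le> W t i j"
  and weights_row_sum: "1 \<le> t \<Longrightarrow> i \<in> {1..m} \<Longrightarrow> (\<Sum>j=1..m. W t i j) = 1"
  using net unfolding network_assumption_def doubly_stochastic_def by blast+

lemma mix_weights_nonneg:
  "1 \<le> t \<Longrightarrow> i \<in> {1..m} \<Longrightarrow> j \<in> {1..m} \<Longrightarrow> 0 \<le> mix_weights m W t k i j"
  by (induction k arbitrary: i) (auto intro!: sum_nonneg mult_nonneg_nonneg weights_nonneg)

lemma mix_weights_row_sum:
  assumes "1 \<le> t" "i \<in> {1..m}"
  shows "(\<Sum>j=1..m. mix_weights m W t k i j) = 1"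
  using assms(2)
proof (induction k arbitrary: i)
  case 0
  then show ?case by simp
next
  case (Suc k)
  have "(\<Sum>j=1..m. mix_weights m W t (Suc k) i j)
      = (\<Sum>l=1..m. W (t + k) i l * (\<Sum>j=1..m. mix_weights m W t k l j))"
    by (simp add: sum_distrib_left) (rule sum.swap)
  also have "\<dots> = (\<Sum>l=1..m. W (t + k) i l)"
    by (rule sum.cong) (simp_all add: Suc.IH del: One_nat_def)
  finally show ?case using weights_row_sum[of "t + k" i] assms Suc.prems by simp
qed

lemma mix_weights_step_ge:
  assumes "1 \<le> t" "i \<in> {1..m}" "j \<in> {1..m}" "l \<in> {1..m}"
  shows "W (t + k) i l * mix_weights m W t k l j \<le> mix_weights m W t (Suc k) i j"
  using assms by (auto intro!: member_le_sum mult_nonneg_nonneg weights_nonneg mix_weights_nonneg)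

text \<open>A positive entry comes from at least one path, and every weight along it is at least \<open>\<eta>\<close>.\<close>

lemma mix_weights_pos_imp_ge:
  assumes "1 \<le> t" "i \<in> {1..m}" "j \<in> {1..m}" "0 < mix_weights m W t k i j"
  shows "\<eta> ^ k \<le> mix_weights m W t k i j"
  using assms(2,4)
proof (induction k arbitrary: i)
  case 0
  then show ?case by (simp split: if_splits)
next
  case (Suc k)
  have "\<exists>l\<in>{1..m}. W (t + k) i l * mix_weights m W t k l j > 0"
  proof (rule ccontr)
    assume "\<not> ?thesis"
    then have "mix_weights m W t (Suc k) i j \<le> 0" by (auto intro!: sum_nonpos simp: not_less)
    then show False using Suc.prems by simp
  qed
  then obtain l where l: "l \<in> {1..m}" "W (t + k) i l * mix_weights m W t k l j > 0" by blast
  have nn: "0 \<le> W (t + k) i l" "0 \<le> mix_weights m W t k l j"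
    using weights_nonneg[of "t + k" i l] mix_weights_nonneg[of t l j k] assms Suc.prems l by auto
  then have pos: "0 < W (t + k) i l" "0 < mix_weights m W t k l j"
    using l by (auto simp: zero_less_mult_iff)
  have "(l, i) \<in> comm_edges m (W (t + k))"
    using pos l Suc.prems unfolding comm_edges_def by auto
  then have "\<eta> \<le> W (t + k) i l"
    using net assms(1) Suc.prems l unfolding network_assumption_def by auto
  moreover have "0 \<le> \<eta>" using net unfolding network_assumption_def by simp
  ultimately have "\<eta> * \<eta> ^ k \<le> W (t + k) i l * mix_weights m W t k l j"
    using Suc.IH[OF l(1) pos(2)] nn by (intro mult_mono) auto
  also have "\<dots> \<le> mix_weights m W t (Suc k) i j"
    by (rule mix_weights_step_ge) (use assms Suc.prems l in auto)
  finally show ?case by simp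
qed

definition reach :: "nat \<Rightarrow> nat \<Rightarrow> nat \<Rightarrow> nat set" where
  "reach t j k = {i \<in> {1..m}. 0 < mix_weights m W t k i j}"

lemma reach_step:
  assumes "1 \<le> t" "j \<in> {1..m}" "l \<in> reach t j k" "i \<in> {1..m}" "0 < W (t + k) i l"
  shows "i \<in> reach t j (Suc k)"
proof -
  have "0 < W (t + k) i l * mix_weights m W t k l j" using assms unfolding reach_def by simp
  also have "\<dots> \<le> mix_weights m W t (Suc k) i j"
    by (rule mix_weights_step_ge) (use assms reach_def in auto)
  finally show ?thesis using assms unfolding reach_def by blast
qed

text \<open>Diagonal weights are positive, so an agent once influenced stays influenced.\<close>

lemma reach_mono:
  assumes "1 \<le> t" "j \<in> {1..m}" "k \<le> k'"
  shows "reach t j k \<subseteq> reach t j k'"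
  using assms(3)
proof (induction rule: dec_induct)
  case base
  then show ?case by simp
next
  case (step n)
  have "reach t j n \<subseteq> reach t j (Suc n)"
  proof
    fix i assume i: "i \<in> reach t j n"
    then have "i \<in> {1..m}" unfolding reach_def by simp
    moreover have "0 < W (t + n) i i"
      using net \<open>i \<in> {1..m}\<close> assms(1) unfolding network_assumption_def
      by (meson order_less_le_trans trans_le_add1)
    ultimately show "i \<in> reach t j (Suc n)" using reach_step[OF assms(1,2) i] by blast
  qed
  then show ?case using step.IH by blast
qed

text \<open>If the influenced set did not grow during a block of length \<open>B\<close>, it would be closed under all
edges of the block, contradicting strong connectivity of their union.\<close>

lemma reach_block_grows:
  assumes t: "1 \<le> t" and j: "j \<in> {1..m}" and k: "t + k = q * B + 1"
    and ne: "reach t j k \<noteq> {1..m}"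
  shows "reach t j k \<subset> reach t j (k + B)"
proof (rule ccontr)
  assume "\<not> ?thesis"
  with reach_mono[OF t j, of k "k + B"] have eq: "reach t j (k + B) = reach t j k" by auto
  let ?E = "\<Union>s\<in>{q * B + 1..(q + 1) * B}. comm_edges m (W s)"
  have same: "reach t j n = reach t j k" if "k \<le> n" "n \<le> k + B" for n
    using reach_mono[OF t j that(1)] reach_mono[OF t j that(2)] eq by blast
  have closed: "b \<in> reach t j k" if a: "a \<in> reach t j k" and ab: "(a, b) \<in> ?E" for a b
  proof -
    obtain s where s: "s \<in> {q * B + 1..(q + 1) * B}" "(a, b) \<in> comm_edges m (W s)" using ab by blast
    define n where "n = s - t"
    have n: "s = t + n" "k \<le> n" "Suc n \<le> k + B" using s k by (auto simp: n_def algebra_simps)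
    have "b \<in> {1..m}" "0 < W (t + n) b a" using s n unfolding comm_edges_def by auto
    then have "b \<in> reach t j (Suc n)" using reach_step[OF t j, of a n b] same[of n] a n by auto
    then show ?thesis using same[of "Suc n"] n by auto
  qed
  have "reach t j 0 \<subseteq> reach t j k" by (rule reach_mono[OF t j]) simp
  then have jk: "j \<in> reach t j k" using j by (auto simp: reach_def)
  have "v \<in> reach t j k" if v: "v \<in> {1..m}" for v
  proof -
    have "(j, v) \<in> ?E\<^sup>*"
      using net j v unfolding network_assumption_def strongly_connected_on_def by blast
    then show ?thesis by (induction rule: rtrancl_induct) (use jk closed in auto)
  qed
  then show False using ne unfolding reach_def by blast
qed

text \<open>Any window of length \<open>(m + 1) * B\<close> contains \<open>m\<close> complete blocks, and each of them adds an agent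
to the influenced set until it is everything.\<close>

lemma reach_full:
  assumes t: "1 \<le> t" and j: "j \<in> {1..m}"
  shows "reach t j ((m + 1) * B) = {1..m}"
proof -
  have B: "1 \<le> B" using net unfolding network_assumption_def by simp
  \<comment> \<open>The first complete block starting at or after \<open>t\<close> starts at \<open>q * B + 1\<close>.\<close>
  define q where "q = (t + B - 2) div B"
  have q: "t \<le> q * B + 1" "q * B + 1 < t + B"
  proof -
    have e: "q * B + (t + B - 2) mod B = t + B - 2" unfolding q_def by (simp add: div_mult_mod_eq)
    have r: "(t + B - 2) mod B < B" using B by simp
    show "t \<le> q * B + 1" "q * B + 1 < t + B" using e r B t by linarith+
  qed
  define k where "k = q * B + 1 - t"
  have k: "t + k = q * B + 1" "k < B" using q by (auto simp: k_def)
  have fin: "finite (reach t j n)" "card (reach t j n) \<le> m" for n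
  proof -
    have "reach t j n \<subseteq> {1..m}" unfolding reach_def by blast
    then show "finite (reach t j n)" "card (reach t j n) \<le> m"
      using finite_subset card_mono[of "{1..m}"] by auto
  qed
  have card: "n \<le> card (reach t j (k + n * B)) \<or> reach t j (k + n * B) = {1..m}" for n
  proof (induction n)
    case 0
    then show ?case by simp
  next
    case (Suc n)
    have eq: "k + Suc n * B = k + n * B + B" by simp
    show ?case
    proof (cases "reach t j (k + n * B) = {1..m}")
      case True
      then have "{1..m} \<subseteq> reach t j (k + Suc n * B)"
        using reach_mono[OF t j, of "k + n * B" "k + Suc n * B"] by simp
      then show ?thesis unfolding reach_def by blast
    next
      case False
      have "t + (k + n * B) = (q + n) * B + 1" using k by (simp add: algebra_simps)
      then have "reach t j (k + n * B) \<subset> reach t j (k + Suc n * B)"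
        unfolding eq by (rule reach_block_grows[OF t j _ False])
      then have "card (reach t j (k + n * B)) < card (reach t j (k + Suc n * B))"
        by (rule psubset_card_mono[OF fin(1)])
      then show ?thesis using Suc.IH False by linarith
    qed
  qed
  have "reach t j (k + m * B) = {1..m}"
  proof -
    have "reach t j (k + m * B) = {1..m}" if "m \<le> card (reach t j (k + m * B))"
    proof (rule card_subset_eq)
      show "card (reach t j (k + m * B)) = card {1..m}" using fin(2)[of "k + m * B"] that by simp
    qed (auto simp: reach_def)
    then show ?thesis using card[of m] by blast
  qed
  moreover have "k + m * B \<le> (m + 1) * B" using k by (simp add: algebra_simps)
  ultimately have "{1..m} \<subseteq> reach t j ((m + 1) * B)" using reach_mono[OF t j] by metis
  then show ?thesis unfolding reach_def by blast
qed

lemma mix_weights_window_ge: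
  assumes "1 \<le> t" "i \<in> {1..m}" "j \<in> {1..m}"
  shows "\<eta> ^ ((m + 1) * B) \<le> mix_weights m W t ((m + 1) * B) i j"
proof -
  have "i \<in> reach t j ((m + 1) * B)" using reach_full[OF assms(1,3)] assms(2) by blast
  then have "0 < mix_weights m W t ((m + 1) * B) i j" unfolding reach_def by blast
  then show ?thesis by (rule mix_weights_pos_imp_ge[OF assms])
qed

end

definition spread :: "nat \<Rightarrow> (nat \<Rightarrow> 'a::real_normed_vector) \<Rightarrow> real" where
  "spread m y = Max ((\<lambda>(i, j). norm (y i - y j)) ` ({1..m} \<times> {1..m}))"

lemma spread_ge: "i \<in> {1..m} \<Longrightarrow> j \<in> {1..m} \<Longrightarrow> norm (y i - y j) \<le> spread m y"
  unfolding spread_def by (rule Max_ge) (auto intro!: image_eqI[where x = "(i, j)"])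

lemma spread_leI:
  assumes "1 \<le> m" "\<And>i j. i \<in> {1..m} \<Longrightarrow> j \<in> {1..m} \<Longrightarrow> norm (y i - y j) \<le> d"
  shows "spread m y \<le> d"
  unfolding spread_def using assms by (subst Max_le_iff) auto

lemma spread_nonneg: "1 \<le> m \<Longrightarrow> 0 \<le> spread m y"
  using spread_ge[of 1 m 1 y] by simp

section \<open>Consensus of perturbed averaging\<close>

lemma norm_diff_three_le:
  fixes a b c d :: "'a::real_normed_vector"
  shows "norm (a - b) \<le> norm (a - c) + norm (c - d) + norm (b - d)"
  using norm_triangle_ineq[of "a - c" "c - d"] norm_triangle_ineq4[of "a - d" "b - d"]
  by simp

context
  fixes m :: nat and W :: "nat \<Rightarrow> nat \<Rightarrow> nat \<Rightarrow> real" and B :: nat and \<eta> :: real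
    and x :: "nat \<Rightarrow> nat \<Rightarrow> 'a::real_normed_vector" and \<epsilon> :: "nat \<Rightarrow> real" and T :: nat
  assumes m: "1 \<le> m" and net: "network_assumption m W B \<eta>"
    and pert: "\<And>t i. 1 \<le> t \<Longrightarrow> t \<le> T \<Longrightarrow> i \<in> {1..m} \<Longrightarrow>
      norm (x i (t + 1) - (\<Sum>j=1..m. W t i j *\<^sub>R x j t)) \<le> \<epsilon> t"
begin

text \<open>The mixing matrices do not expand distances, so the perturbations of single steps just add up.\<close>

lemma perturbed_mixing:
  assumes t: "1 \<le> t" and "t + k \<le> T + 1" and "i \<in> {1..m}"
  shows "norm (x i (t + k) - (\<Sum>j=1..m. mix_weights m W t k i j *\<^sub>R x j t)) \<le> (\<Sum>s=t..<t+k. \<epsilon> s)"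
  using assms(2,3)
proof (induction k arbitrary: i)
  case 0
  have "(\<Sum>j=1..m. mix_weights m W t 0 i j *\<^sub>R x j t) = (\<Sum>j=1..m. if i = j then x j t else 0)"
    by (rule sum.cong) auto
  then show ?case using 0 by simp
next
  case (Suc k)
  let ?z = "\<lambda>l. \<Sum>j=1..m. mix_weights m W t k l j *\<^sub>R x j t"
  let ?w = "\<lambda>l. W (t + k) i l"
  have eq: "(\<Sum>j=1..m. mix_weights m W t (Suc k) i j *\<^sub>R x j t) = (\<Sum>l=1..m. ?w l *\<^sub>R ?z l)"
    by (simp add: scaleR_left.sum scaleR_right.sum) (rule sum.swap)
  have split: "x i (t + Suc k) - (\<Sum>l=1..m. ?w l *\<^sub>R ?z l)
      = (x i (t + k + 1) - (\<Sum>l=1..m. ?w l *\<^sub>R x l (t + k)))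
        + (\<Sum>l=1..m. ?w l *\<^sub>R (x l (t + k) - ?z l))"
    by (simp add: scaleR_diff_right sum_subtractf)
  have "norm (x i (t + Suc k) - (\<Sum>l=1..m. ?w l *\<^sub>R ?z l))
      \<le> norm (x i (t + k + 1) - (\<Sum>l=1..m. ?w l *\<^sub>R x l (t + k)))
        + norm (\<Sum>l=1..m. ?w l *\<^sub>R (x l (t + k) - ?z l))"
    unfolding split by (rule norm_triangle_ineq)
  also have "\<dots> \<le> \<epsilon> (t + k) + (\<Sum>s=t..<t+k. \<epsilon> s)"
  proof (rule add_mono)
    show "norm (x i (t + k + 1) - (\<Sum>l=1..m. ?w l *\<^sub>R x l (t + k))) \<le> \<epsilon> (t + k)"
      using pert[of "t + k" i] t Suc.prems by simp
    have w0: "0 \<le> ?w l" if "l \<in> {1..m}" for l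
      using weights_nonneg[OF m net, of "t + k" i l] t Suc.prems that by simp
    have "norm (\<Sum>l=1..m. ?w l *\<^sub>R (x l (t + k) - ?z l)) \<le> (\<Sum>l=1..m. ?w l * (\<Sum>s=t..<t+k. \<epsilon> s))"
      by (rule sum_norm_le) (use w0 Suc in \<open>auto intro!: mult_left_mono\<close>)
    also have "\<dots> = (\<Sum>s=t..<t+k. \<epsilon> s)"
      using weights_row_sum[OF m net, of "t + k" i] t Suc.prems by (simp add: sum_distrib_right[symmetric])
    finally show "norm (\<Sum>l=1..m. ?w l *\<^sub>R (x l (t + k) - ?z l)) \<le> (\<Sum>s=t..<t+k. \<epsilon> s)" .
  qed
  also have "\<dots> = (\<Sum>s=t..<t + Suc k. \<epsilon> s)" by simp
  finally show ?case unfolding eq .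
qed

lemma spread_growth:
  assumes t: "1 \<le> t" and tk: "t + k \<le> T + 1"
  shows "spread m (\<lambda>i. x i (t + k)) \<le> spread m (\<lambda>i. x i t) + 2 * (\<Sum>s=t..<t+k. \<epsilon> s)"
proof (rule spread_leI[OF m])
  fix i j assume ij: "i \<in> {1..m}" "j \<in> {1..m}"
  let ?z = "\<lambda>l. \<Sum>j=1..m. mix_weights m W t k l j *\<^sub>R x j t"
  have "norm (?z i - ?z j) \<le> 1 * spread m (\<lambda>i. x i t)"
    by (rule norm_weighted_diff_le)
      (use ij t mix_weights_nonneg[OF m net] mix_weights_row_sum[OF m net] spread_ge[where y = "\<lambda>i. x i t"] in auto)
  moreover have "norm (x i (t + k) - x j (t + k))
      \<le> norm (x i (t + k) - ?z i) + norm (?z i - ?z j) + norm (x j (t + k) - ?z j)"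
    by (rule norm_diff_three_le)
  ultimately show "norm (x i (t + k) - x j (t + k)) \<le> spread m (\<lambda>i. x i t) + 2 * (\<Sum>s=t..<t+k. \<epsilon> s)"
    using perturbed_mixing[OF t tk ij(1)] perturbed_mixing[OF t tk ij(2)] by linarith
qed

text \<open>Over a full window all entries of the product are at least \<open>\<eta> ^ K\<close>. All agents thus share at
least the mass \<open>\<eta> ^ K\<close> placed on agent \<open>1\<close>, and only the rest contributes to the spread.\<close>

lemma spread_contraction:
  assumes t: "1 \<le> t" and K: "K = (m + 1) * B" and tk: "t + K \<le> T + 1"
  shows "spread m (\<lambda>i. x i (t + K)) \<le> (1 - \<eta> ^ K) * spread m (\<lambda>i. x i t) + 2 * (\<Sum>s=t..<t+K. \<epsilon> s)"
proof (rule spread_leI[OF m])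
  fix i j assume ij: "i \<in> {1..m}" "j \<in> {1..m}"
  let ?z = "\<lambda>l. \<Sum>j=1..m. mix_weights m W t K l j *\<^sub>R x j t"
  let ?p = "\<lambda>i l. mix_weights m W t K i l - (if l = 1 then \<eta> ^ K else 0)"
  have z: "?z i = (\<Sum>l=1..m. ?p i l *\<^sub>R x l t) + \<eta> ^ K *\<^sub>R x 1 t" for i
  proof -
    have "(\<Sum>l=1..m. (if l = 1 then \<eta> ^ K else 0) *\<^sub>R x l t) = (\<Sum>l=1..m. if l = 1 then \<eta> ^ K *\<^sub>R x l t else 0)"
      by (rule sum.cong) auto
    also have "\<dots> = \<eta> ^ K *\<^sub>R x 1 t" using m by simp
    finally show ?thesis by (simp add: scaleR_diff_left sum_subtractf)
  qed
  have p: "0 \<le> ?p i l" if "i \<in> {1..m}" "l \<in> {1..m}" for i l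
    using mix_weights_window_ge[OF m net t that] mix_weights_nonneg[OF m net t that] K by auto
  have ps: "(\<Sum>l=1..m. ?p i l) = 1 - \<eta> ^ K" if "i \<in> {1..m}" for i
    using mix_weights_row_sum[OF m net t that] m by (simp add: sum_subtractf)
  have "norm (?z i - ?z j) = norm ((\<Sum>l=1..m. ?p i l *\<^sub>R x l t) - (\<Sum>l=1..m. ?p j l *\<^sub>R x l t))"
    unfolding z by simp
  also have "\<dots> \<le> (1 - \<eta> ^ K) * spread m (\<lambda>i. x i t)"
    by (rule norm_weighted_diff_le) (use ij p ps spread_ge[where y = "\<lambda>i. x i t"] in auto)
  finally have "norm (?z i - ?z j) \<le> (1 - \<eta> ^ K) * spread m (\<lambda>i. x i t)" .
  moreover have "norm (x i (t + K) - x j (t + K))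
      \<le> norm (x i (t + K) - ?z i) + norm (?z i - ?z j) + norm (x j (t + K) - ?z j)"
    by (rule norm_diff_three_le)
  ultimately show "norm (x i (t + K) - x j (t + K)) \<le> (1 - \<eta> ^ K) * spread m (\<lambda>i. x i t) + 2 * (\<Sum>s=t..<t+K. \<epsilon> s)"
    using perturbed_mixing[OF t tk ij(1)] perturbed_mixing[OF t tk ij(2)] by linarith
qed

lemma window_sum_le:
  fixes \<alpha> :: "nat \<Rightarrow> real"
  assumes dec: "\<And>s t. 1 \<le> s \<Longrightarrow> s \<le> t \<Longrightarrow> t \<le> T \<Longrightarrow> \<alpha> t \<le> \<alpha> s"
    and pos: "\<And>t. 1 \<le> t \<Longrightarrow> t \<le> T \<Longrightarrow> 0 \<le> \<alpha> t" and eps: "\<And>t. 1 \<le> t \<Longrightarrow> t \<le> T \<Longrightarrow> 0 \<le> \<epsilon> t"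
    and t: "1 \<le> t" "t + k \<le> T"
  shows "\<alpha> (t + k) * (\<Sum>s=t..<t+k. \<epsilon> s) \<le> (\<Sum>s=t..<t+k. \<alpha> s * \<epsilon> s)"
  unfolding sum_distrib_left
proof (rule sum_mono)
  fix s assume "s \<in> {t..<t+k}"
  then have s: "1 \<le> s" "s \<le> t + k" "s \<le> T" using t by auto
  show "\<alpha> (t + k) * \<epsilon> s \<le> \<alpha> s * \<epsilon> s"
    by (rule mult_right_mono[OF dec[OF s(1,2) t(2)] eps[OF s(1,3)]])
qed

text \<open>Comparing the weighted spread at \<open>t + K\<close> with that at \<open>t\<close> bounds the sum by \<open>1 - \<eta> ^ K\<close>
times itself plus the first window and the perturbations, each of which is counted of the order of
\<open>K\<close> times. Nonincreasing weights allow \<open>\<alpha> (t + K)\<close> to be replaced by the weight at the time of the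
perturbation.\<close>

lemma weighted_spread_sum_le:
  fixes \<alpha> :: "nat \<Rightarrow> real"
  assumes dec: "\<And>s t. 1 \<le> s \<Longrightarrow> s \<le> t \<Longrightarrow> t \<le> T \<Longrightarrow> \<alpha> t \<le> \<alpha> s"
    and pos: "\<And>t. 1 \<le> t \<Longrightarrow> t \<le> T \<Longrightarrow> 0 \<le> \<alpha> t" and eps: "\<And>t. 1 \<le> t \<Longrightarrow> t \<le> T \<Longrightarrow> 0 \<le> \<epsilon> t"
    and T: "1 \<le> T" and K: "K = (m + 1) * B"
  shows "\<eta> ^ K * (\<Sum>t=1..T. \<alpha> t * spread m (\<lambda>i. x i t))
    \<le> K * (\<alpha> 1 * spread m (\<lambda>i. x i 1) + 4 * (\<Sum>t=1..T. \<alpha> t * \<epsilon> t))"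
proof -
  let ?E = "\<lambda>t. spread m (\<lambda>i. x i t)"
  let ?S = "\<Sum>t=1..T. \<alpha> t * \<epsilon> t"
  have eta: "0 < \<eta>" "\<eta> < 1" using net unfolding network_assumption_def by simp_all
  have ae: "0 \<le> \<alpha> s * \<epsilon> s" if "s \<in> {1..T}" for s using pos eps that by simp
  have aE: "0 \<le> \<alpha> s * ?E s" if "s \<in> {1..T}" for s using pos[of s] that spread_nonneg[OF m] by (intro mult_nonneg_nonneg) auto
  have S0: "0 \<le> ?S" using ae by (rule sum_nonneg)
  have win: "(\<Sum>s=t..<t+k. \<alpha> s * \<epsilon> s) \<le> ?S" if "1 \<le> t" "t + k \<le> T" for t k
    by (rule sum_mono2) (use that ae in auto)
  have head: "\<alpha> t * ?E t \<le> \<alpha> 1 * ?E 1 + 2 * ?S" if t: "t \<in> {1..T}" for t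
  proof -
    obtain k where k: "t = 1 + k" using t by (metis atLeastAtMost_iff le_Suc_ex)
    let ?P = "\<Sum>s=1..<1+k. \<epsilon> s"
    have "?E t \<le> ?E 1 + 2 * ?P"
      unfolding k by (rule spread_growth) (use t k in auto)
    then have "\<alpha> t * ?E t \<le> \<alpha> t * (?E 1 + 2 * ?P)"
      by (rule mult_left_mono) (use t pos[of t] in auto)
    also have "\<dots> = \<alpha> t * ?E 1 + 2 * (\<alpha> (1 + k) * ?P)"
      unfolding k by (simp only: distrib_left mult.left_commute)
    also have "\<dots> \<le> \<alpha> 1 * ?E 1 + 2 * ?S"
    proof (intro add_mono mult_left_mono mult_right_mono)
      show "\<alpha> t \<le> \<alpha> 1" using dec[of 1 t] t by auto
      have "\<alpha> (1 + k) * ?P \<le> (\<Sum>s=1..<1+k. \<alpha> s * \<epsilon> s)"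
        by (rule window_sum_le[OF dec pos eps]) (use t k in auto)
      also have "\<dots> \<le> ?S" by (rule win) (use t k in auto)
      finally show "\<alpha> (1 + k) * ?P \<le> ?S" .
    qed (use spread_nonneg[OF m] in auto)
    finally show ?thesis .
  qed
  have shift: "\<alpha> (t + K) * ?E (t + K) \<le> (1 - \<eta> ^ K) * (\<alpha> t * ?E t) + 2 * (\<Sum>s=t..<t+K. \<alpha> s * \<epsilon> s)"
    if t: "1 \<le> t" "t + K \<le> T" for t
  proof -
    have "?E (t + K) \<le> (1 - \<eta> ^ K) * ?E t + 2 * (\<Sum>s=t..<t+K. \<epsilon> s)"
      by (rule spread_contraction) (use t K in auto)
    then have "\<alpha> (t + K) * ?E (t + K) \<le> \<alpha> (t + K) * ((1 - \<eta> ^ K) * ?E t + 2 * (\<Sum>s=t..<t+K. \<epsilon> s))"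
      using t pos[of "t + K"] by (intro mult_left_mono) auto
    also have "\<dots> = (1 - \<eta> ^ K) * (\<alpha> (t + K) * ?E t) + 2 * (\<alpha> (t + K) * (\<Sum>s=t..<t+K. \<epsilon> s))"
      by (simp add: algebra_simps)
    also have "\<dots> \<le> (1 - \<eta> ^ K) * (\<alpha> t * ?E t) + 2 * (\<Sum>s=t..<t+K. \<alpha> s * \<epsilon> s)"
      by (intro add_mono mult_left_mono mult_right_mono window_sum_le[OF dec pos eps])
        (use t dec[of t "t + K"] spread_nonneg[OF m] eta power_le_one[of \<eta> K] in auto)
    finally show ?thesis .
  qed
  have double: "(\<Sum>t=1..T-K. \<Sum>s=t..<t+K. \<alpha> s * \<epsilon> s) \<le> K * ?S"
  proof -
    have "(\<Sum>t=1..T-K. \<Sum>s=t..<t+K. \<alpha> s * \<epsilon> s) = (\<Sum>t=1..T-K. \<Sum>d<K. \<alpha> (t + d) * \<epsilon> (t + d))"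
    proof (rule sum.cong[OF refl])
      fix t
      show "(\<Sum>s=t..<t+K. \<alpha> s * \<epsilon> s) = (\<Sum>d<K. \<alpha> (t + d) * \<epsilon> (t + d))"
        using sum.shift_bounds_nat_ivl[of "\<lambda>s. \<alpha> s * \<epsilon> s" 0 t K]
        by (simp add: atLeast0LessThan add.commute)
    qed
    also have "\<dots> = (\<Sum>d<K. \<Sum>t=1..T-K. \<alpha> (t + d) * \<epsilon> (t + d))" by (rule sum.swap)
    also have "\<dots> \<le> (\<Sum>d<K. ?S)"
    proof (rule sum_mono)
      fix d assume d: "d \<in> {..<K}"
      have "(\<Sum>t=1..T-K. \<alpha> (t + d) * \<epsilon> (t + d)) = (\<Sum>s=1+d..T-K+d. \<alpha> s * \<epsilon> s)"
        by (rule sum.shift_bounds_cl_nat_ivl[symmetric])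
      also have "\<dots> \<le> ?S" by (cases "K \<le> T") (use d ae in \<open>auto intro!: sum_mono2 sum_nonneg\<close>)
      finally show "(\<Sum>t=1..T-K. \<alpha> (t + d) * \<epsilon> (t + d)) \<le> ?S" .
    qed
    finally show ?thesis by simp
  qed
  let ?A = "\<Sum>t=1..T. \<alpha> t * ?E t"
  have "?A \<le> (\<Sum>t=1..min K T. \<alpha> t * ?E t) + (\<Sum>t=1..T-K. \<alpha> (t + K) * ?E (t + K))"
  proof (cases "K \<le> T")
    case True
    have "?A = (\<Sum>t=1..K. \<alpha> t * ?E t) + (\<Sum>t=1+K..T-K+K. \<alpha> t * ?E t)"
      using True sum.ub_add_nat[of 1 K "\<lambda>t. \<alpha> t * ?E t" "T - K"] by simp
    also have "(\<Sum>t=1+K..T-K+K. \<alpha> t * ?E t) = (\<Sum>t=1..T-K. \<alpha> (t + K) * ?E (t + K))"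
      by (rule sum.shift_bounds_cl_nat_ivl)
    finally show ?thesis using True by (simp add: min_def)
  next
    case False
    then show ?thesis by (simp add: min_def)
  qed
  also have "\<dots> \<le> K * (\<alpha> 1 * ?E 1 + 2 * ?S) + ((1 - \<eta> ^ K) * ?A + 2 * (K * ?S))"
  proof (rule add_mono)
    have "(\<Sum>t=1..min K T. \<alpha> t * ?E t) \<le> (\<Sum>t=1..min K T. \<alpha> 1 * ?E 1 + 2 * ?S)"
      by (rule sum_mono) (use head in auto)
    also have "\<dots> = real (min K T) * (\<alpha> 1 * ?E 1 + 2 * ?S)" by simp
    also have "\<dots> \<le> K * (\<alpha> 1 * ?E 1 + 2 * ?S)"
      by (rule mult_right_mono) (use S0 aE[of 1] T in auto)
    finally show "(\<Sum>t=1..min K T. \<alpha> t * ?E t) \<le> K * (\<alpha> 1 * ?E 1 + 2 * ?S)" .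
    have "(\<Sum>t=1..T-K. \<alpha> (t + K) * ?E (t + K))
        \<le> (\<Sum>t=1..T-K. (1 - \<eta> ^ K) * (\<alpha> t * ?E t) + 2 * (\<Sum>s=t..<t+K. \<alpha> s * \<epsilon> s))"
      by (rule sum_mono) (use shift in auto)
    also have "\<dots> = (1 - \<eta> ^ K) * (\<Sum>t=1..T-K. \<alpha> t * ?E t) + 2 * (\<Sum>t=1..T-K. \<Sum>s=t..<t+K. \<alpha> s * \<epsilon> s)"
      by (simp add: sum.distrib sum_distrib_left)
    also have "\<dots> \<le> (1 - \<eta> ^ K) * ?A + 2 * (K * ?S)"
    proof (intro add_mono mult_left_mono double)
      show "(\<Sum>t=1..T-K. \<alpha> t * ?E t) \<le> ?A" by (rule sum_mono2) (use aE in auto)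
    qed (use eta power_le_one[of \<eta> K] in auto)
    finally show "(\<Sum>t=1..T-K. \<alpha> (t + K) * ?E (t + K)) \<le> (1 - \<eta> ^ K) * ?A + 2 * (K * ?S)" .
  qed
  finally show ?thesis by (simp add: algebra_simps)
qed

end

section \<open>Exponential moments of truncated noise\<close>

lemma exp_le_one_plus_quadratic:
  fixes z :: real
  shows "exp z \<le> 1 + z + z\<^sup>2 * exp \<bar>z\<bar>"
proof -
  obtain t where t: "\<bar>t\<bar> \<le> \<bar>z\<bar>" "exp z = (\<Sum>m<2. z ^ m / fact m) + exp t / fact 2 * z ^ 2"
    using Maclaurin_exp_le by blast
  have "exp t / 2 \<le> exp \<bar>z\<bar>"
    using t(1) exp_le_cancel_iff[of t "\<bar>z\<bar>"] exp_gt_zero[of t] by linarith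
  then have "exp t / 2 * z\<^sup>2 \<le> exp \<bar>z\<bar> * z\<^sup>2" by (rule mult_right_mono) simp
  then show ?thesis using t(2) by (simp add: numeral_2_eq_2 mult.commute)
qed

lemma powr_le_exp_quarter:
  fixes a \<theta> :: real
  assumes "0 < \<theta>" "0 \<le> a"
  shows "a powr \<theta> \<le> (4 * \<theta>) powr \<theta> * exp (a / 4)"
proof -
  have "a / (4 * \<theta>) \<le> exp (a / (4 * \<theta>))" using exp_ge_add_one_self[of "a / (4 * \<theta>)"] by linarith
  then have "(a / (4 * \<theta>)) powr \<theta> \<le> exp (a / (4 * \<theta>)) powr \<theta>"
    using assms by (intro powr_mono2) auto
  also have "\<dots> = exp (a / 4)" using assms by (simp add: powr_def)
  finally have "(4 * \<theta>) powr \<theta> * (a / (4 * \<theta>)) powr \<theta> \<le> (4 * \<theta>) powr \<theta> * exp (a / 4)"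
    by (rule mult_left_mono) simp
  then show ?thesis using assms by (simp add: powr_mult[symmetric])
qed

text \<open>Here \<open>a\<close> stands for \<open>(\<parallel>\<xi>\<parallel> / \<kappa>) powr (1 / \<theta>)\<close> with the dual norm of the noise,
whose exponential has bounded conditional expectation.
When \<open>a \<le> r\<close>, the size of the inner product is at most \<open>\<mu> b (1 + a) (1 + r)\<close> with the last
factor raised to \<open>max 0 (\<theta> - 1)\<close>; the condition on \<open>\<mu>\<close> makes this at most \<open>(1 + a) / 2\<close>, so
the quadratic remainder of the exponential is dominated by \<open>exp a\<close>. For \<open>\<theta> > 1\<close> the condition
depends on \<open>r\<close>, because the untruncated noise may have no exponential moment.
When \<open>a > r\<close> the left side is \<open>1\<close>, and the linear term on the right is compensated by the
exponentially small second summand.\<close>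

lemma exp_truncated_inner_le:
  fixes \<xi> w :: "'a::real_inner"
  assumes \<theta>: "0 < \<theta>" and a: "0 \<le> a" and b: "0 \<le> b" and r: "0 \<le> r"
    and xi: "norm \<xi> \<le> b * a powr \<theta>" and w: "norm w \<le> \<mu>"
    and small: "\<mu> * b * (1 + r) powr max 0 (\<theta> - 1) \<le> 1 / 2"
    and h: "h = b * (4 * \<theta>) powr \<theta>"
  shows "exp ((if a \<le> r then \<xi> else 0) \<bullet> w)
    \<le> 1 + \<xi> \<bullet> w + (2 * h\<^sup>2 * \<mu>\<^sup>2 + h * \<mu> * exp (- r / 2)) * exp a"
proof -
  have mu: "0 \<le> \<mu>" using w norm_ge_zero order_trans by blast
  have h0: "0 \<le> h" using h b by simp
  have abs_z: "\<bar>\<xi> \<bullet> w\<bar> \<le> b * a powr \<theta> * \<mu>"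
    using Cauchy_Schwarz_ineq2[of \<xi> w] mult_mono[OF xi w] b by simp
  have z_le: "\<bar>\<xi> \<bullet> w\<bar> \<le> h * \<mu> * exp (a / 4)"
  proof -
    have "b * a powr \<theta> * \<mu> \<le> b * ((4 * \<theta>) powr \<theta> * exp (a / 4)) * \<mu>"
      using powr_le_exp_quarter[OF \<theta> a] b mu by (intro mult_right_mono mult_left_mono)
    then show ?thesis using abs_z by (simp add: h mult_ac)
  qed
  show ?thesis
  proof (cases "a \<le> r")
    case True
    let ?z = "\<xi> \<bullet> w"
    have "a powr \<theta> \<le> (1 + a) powr \<theta>" using a \<theta> by (intro powr_mono2) auto
    also have "\<dots> = (1 + a) * (1 + a) powr (\<theta> - 1)" using a powr_add[of "1 + a" 1 "\<theta> - 1"] by simp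
    also have "\<dots> \<le> (1 + a) * (1 + r) powr max 0 (\<theta> - 1)"
    proof (rule mult_left_mono)
      have "(1 + a) powr (\<theta> - 1) \<le> (1 + a) powr max 0 (\<theta> - 1)" using a by (intro powr_mono) auto
      also have "\<dots> \<le> (1 + r) powr max 0 (\<theta> - 1)" using a True by (intro powr_mono2) auto
      finally show "(1 + a) powr (\<theta> - 1) \<le> (1 + r) powr max 0 (\<theta> - 1)" .
    qed (use a in simp)
    finally have "b * a powr \<theta> * \<mu> \<le> b * ((1 + a) * (1 + r) powr max 0 (\<theta> - 1)) * \<mu>"
      using b mu by (intro mult_right_mono mult_left_mono)
    also have "\<dots> = (1 + a) * (\<mu> * b * (1 + r) powr max 0 (\<theta> - 1))" by simp
    also have "\<dots> \<le> (1 + a) * (1 / 2)" by (rule mult_left_mono[OF small]) (use a in simp)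
    finally have "\<bar>?z\<bar> \<le> 1 / 2 + a / 2" using abs_z by simp
    then have "exp \<bar>?z\<bar> \<le> exp (1 / 2 + a / 2)" by simp
    also have "\<dots> \<le> 2 * exp (a / 2)" using exp_half_le2 by (simp add: exp_add)
    finally have e: "exp \<bar>?z\<bar> \<le> 2 * exp (a / 2)" .
    have "\<bar>?z\<bar>\<^sup>2 \<le> (h * \<mu> * exp (a / 4))\<^sup>2" by (rule power_mono[OF z_le]) simp
    also have "\<dots> = h\<^sup>2 * \<mu>\<^sup>2 * exp (a / 2)" by (simp add: power_mult_distrib exp_double[symmetric])
    finally have "?z\<^sup>2 * exp \<bar>?z\<bar> \<le> h\<^sup>2 * \<mu>\<^sup>2 * exp (a / 2) * (2 * exp (a / 2))"
      using e by (intro mult_mono) auto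
    also have "\<dots> = 2 * h\<^sup>2 * \<mu>\<^sup>2 * exp a" by (simp add: exp_add[symmetric])
    finally have "exp ?z \<le> 1 + ?z + 2 * h\<^sup>2 * \<mu>\<^sup>2 * exp a"
      using exp_le_one_plus_quadratic[of ?z] by linarith
    moreover have "0 \<le> h * \<mu> * exp (- r / 2) * exp a" using h0 mu by simp
    ultimately show ?thesis using True by (simp add: distrib_right)
  next
    case False
    have "exp (a / 4) \<le> exp (- r / 2) * exp a"
      using False a r by (simp add: exp_add[symmetric])
    then have "h * \<mu> * exp (a / 4) \<le> h * \<mu> * (exp (- r / 2) * exp a)"
      using h0 mu by (intro mult_left_mono) auto
    moreover have "0 \<le> 2 * h\<^sup>2 * \<mu>\<^sup>2 * exp a" by simp
    moreover have "(2 * h\<^sup>2 * \<mu>\<^sup>2 + h * \<mu> * exp (- r / 2)) * exp a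
        = 2 * h\<^sup>2 * \<mu>\<^sup>2 * exp a + h * \<mu> * (exp (- r / 2) * exp a)"
      by (simp add: distrib_right)
    ultimately have "1 \<le> 1 + \<xi> \<bullet> w + (2 * h\<^sup>2 * \<mu>\<^sup>2 + h * \<mu> * exp (- r / 2)) * exp a"
      using z_le by linarith
    then show ?thesis using False by simp
  qed
qed

lemma borel_measurable_vec_component [measurable]:
  fixes f :: "'w \<Rightarrow> real^'n"
  assumes [measurable]: "f \<in> borel_measurable A"
  shows "(\<lambda>\<omega>. f \<omega> $ k) \<in> borel_measurable A"
  unfolding cart_eq_inner_axis by measurable

text \<open>The factor \<open>Y\<close> plays the part of the exponential of the earlier noise terms. Integrating the
pointwise bound against \<open>Y\<close> removes the linear term, because the untruncated noise has conditional
mean zero; the bias caused by truncation is the summand with \<open>exp (- r / 2)\<close>.\<close>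

lemma truncated_noise_mgf_step:
  fixes \<xi> w :: "'w \<Rightarrow> real^'n" and a Y :: "'w \<Rightarrow> real"
  assumes M: "prob_space M" and F: "subalgebra M F"
    and xi: "integrable M \<xi>" "\<And>k. AE \<omega> in M. real_cond_exp M F (\<lambda>\<omega>. \<xi> \<omega> $ k) \<omega> = 0"
    and a: "a \<in> borel_measurable M" "\<And>\<omega>. \<omega> \<in> space M \<Longrightarrow> 0 \<le> a \<omega>"
    and tail: "AE \<omega> in M. nn_cond_exp M F (\<lambda>\<omega>. ennreal (exp (a \<omega>))) \<omega> \<le> 2"
    and xi_a: "\<And>\<omega>. \<omega> \<in> space M \<Longrightarrow> norm (\<xi> \<omega>) \<le> b * a \<omega> powr \<theta>"
    and w: "w \<in> borel_measurable F" "\<And>\<omega>. \<omega> \<in> space M \<Longrightarrow> norm (w \<omega>) \<le> \<mu>"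
    and Y: "Y \<in> borel_measurable F" "\<And>\<omega>. \<omega> \<in> space M \<Longrightarrow> 0 \<le> Y \<omega>" "\<And>\<omega>. \<omega> \<in> space M \<Longrightarrow> Y \<omega> \<le> y"
    and \<theta>: "0 < \<theta>" and b: "0 \<le> b" and r: "0 \<le> r" and mu: "0 \<le> \<mu>"
    and small: "\<mu> * b * (1 + r) powr max 0 (\<theta> - 1) \<le> 1 / 2"
    and h: "h = b * (4 * \<theta>) powr \<theta>"
  shows "(\<integral>\<omega>. Y \<omega> * exp ((if a \<omega> \<le> r then \<xi> \<omega> else 0) \<bullet> w \<omega>) \<partial>M)
    \<le> exp (4 * h\<^sup>2 * \<mu>\<^sup>2 + 2 * h * \<mu> * exp (- r / 2)) * (\<integral>\<omega>. Y \<omega> \<partial>M)"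
proof -
  interpret prob_space M by fact
  interpret S: sigma_finite_subalgebra M F
    by (intro finite_measure_subalgebra_is_sigma_finite finite_measure_subalgebra.intro
        finite_measure_subalgebra_axioms.intro finite_measure_axioms F)
  note [measurable] = a(1)
  have [measurable]: "Y \<in> borel_measurable M" "w \<in> borel_measurable M" "\<xi> \<in> borel_measurable M"
    by (rule measurable_from_subalg[OF F Y(1)], rule measurable_from_subalg[OF F w(1)],
        rule borel_measurable_integrable[OF xi(1)])
  have h0: "0 \<le> h" using h b by simp
  have intY: "integrable M Y"
    by (rule integrable_const_bound[where B = y]) (use Y in auto)
  have nnY: "(\<integral>\<^sup>+\<omega>. ennreal (Y \<omega> * exp (a \<omega>)) \<partial>M) \<le> ennreal (2 * (\<integral>\<omega>. Y \<omega> \<partial>M))"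
  proof -
    have "(\<integral>\<^sup>+\<omega>. ennreal (Y \<omega> * exp (a \<omega>)) \<partial>M) = (\<integral>\<^sup>+\<omega>. ennreal (Y \<omega>) * ennreal (exp (a \<omega>)) \<partial>M)"
      by (rule nn_integral_cong) (simp add: ennreal_mult Y)
    also have "\<dots> = (\<integral>\<^sup>+\<omega>. ennreal (Y \<omega>) * nn_cond_exp M F (\<lambda>\<omega>. ennreal (exp (a \<omega>))) \<omega> \<partial>M)"
      by (rule S.nn_cond_exp_intg[symmetric]) (use Y(1) in measurable)
    also have "\<dots> \<le> (\<integral>\<^sup>+\<omega>. ennreal (Y \<omega>) * 2 \<partial>M)"
      by (rule nn_integral_mono_AE, rule AE_mp[OF tail], rule AE_I2) (simp add: mult_left_mono)
    also have "\<dots> = ennreal (\<integral>\<omega>. Y \<omega> \<partial>M) * 2"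
      using nn_integral_eq_integral[OF intY] Y by (subst nn_integral_multc) auto
    finally show ?thesis using ennreal_mult'[of 2 "\<integral>\<omega>. Y \<omega> \<partial>M"] by (simp add: mult.commute)
  qed
  have intYa: "integrable M (\<lambda>\<omega>. Y \<omega> * exp (a \<omega>))"
    by (rule integrableI_nonneg) (use Y nnY in \<open>auto intro: order_le_less_trans\<close>)
  have expYa: "(\<integral>\<omega>. Y \<omega> * exp (a \<omega>) \<partial>M) \<le> 2 * (\<integral>\<omega>. Y \<omega> \<partial>M)"
  proof -
    have "0 \<le> (\<integral>\<omega>. Y \<omega> \<partial>M)" by (rule integral_nonneg_AE) (use Y in auto)
    moreover have "ennreal (\<integral>\<omega>. Y \<omega> * exp (a \<omega>) \<partial>M) \<le> ennreal (2 * (\<integral>\<omega>. Y \<omega> \<partial>M))"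
      using nnY nn_integral_eq_integral[OF intYa] Y by simp
    ultimately show ?thesis by simp
  qed
  have y0: "0 \<le> y"
  proof -
    obtain \<omega> where "\<omega> \<in> space M" using not_empty by blast
    then show ?thesis using Y order_trans by blast
  qed
  have comp: "\<bar>w \<omega> $ k\<bar> \<le> \<mu>" if "\<omega> \<in> space M" for \<omega> k
    using component_le_norm_cart[of "w \<omega>" k] w(2)[OF that] by linarith
  have int_k: "integrable M (\<lambda>\<omega>. (Y \<omega> * w \<omega> $ k) * \<xi> \<omega> $ k)" for k
  proof (rule Bochner_Integration.integrable_bound)
    show "integrable M (\<lambda>\<omega>. y * \<mu> * norm (\<xi> \<omega>))" using xi(1) by simp
    show "AE \<omega> in M. norm (Y \<omega> * w \<omega> $ k * \<xi> \<omega> $ k) \<le> norm (y * \<mu> * norm (\<xi> \<omega>))"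
    proof (rule AE_I2)
      fix \<omega> assume o: "\<omega> \<in> space M"
      have "\<bar>Y \<omega>\<bar> * \<bar>w \<omega> $ k\<bar> * \<bar>\<xi> \<omega> $ k\<bar> \<le> y * \<mu> * norm (\<xi> \<omega>)"
        using Y(2,3)[OF o] comp[OF o] component_le_norm_cart[of "\<xi> \<omega>" k] y0 mu
        by (intro mult_mono) auto
      then show "norm (Y \<omega> * w \<omega> $ k * \<xi> \<omega> $ k) \<le> norm (y * \<mu> * norm (\<xi> \<omega>))"
        using y0 mu by (simp add: abs_mult)
    qed
  qed measurable
  have zero_k: "(\<integral>\<omega>. (Y \<omega> * w \<omega> $ k) * \<xi> \<omega> $ k \<partial>M) = 0" for k
  proof -
    have "(\<integral>\<omega>. (Y \<omega> * w \<omega> $ k) * \<xi> \<omega> $ k \<partial>M)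
        = (\<integral>\<omega>. (Y \<omega> * w \<omega> $ k) * real_cond_exp M F (\<lambda>\<omega>. \<xi> \<omega> $ k) \<omega> \<partial>M)"
    proof (rule S.real_cond_exp_intg(2)[symmetric, OF int_k])
      note [measurable] = Y(1) w(1)
      show "(\<lambda>\<omega>. Y \<omega> * w \<omega> $ k) \<in> borel_measurable F" by measurable
    qed measurable
    also have "\<dots> = (\<integral>\<omega>. 0 \<partial>M)"
      by (rule integral_cong_AE) (use xi(2)[of k] in auto)
    finally show ?thesis by simp
  qed
  have inner_eq: "Y \<omega> * (\<xi> \<omega> \<bullet> w \<omega>) = (\<Sum>k\<in>UNIV. (Y \<omega> * w \<omega> $ k) * \<xi> \<omega> $ k)" for \<omega>
    by (simp add: inner_vec_def sum_distrib_left mult_ac)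
  have int_in: "integrable M (\<lambda>\<omega>. Y \<omega> * (\<xi> \<omega> \<bullet> w \<omega>))"
    unfolding inner_eq using int_k by simp
  have zero: "(\<integral>\<omega>. Y \<omega> * (\<xi> \<omega> \<bullet> w \<omega>) \<partial>M) = 0"
    unfolding inner_eq by (subst Bochner_Integration.integral_sum) (use int_k zero_k in auto)
  define q where "q = 2 * h\<^sup>2 * \<mu>\<^sup>2 + h * \<mu> * exp (- r / 2)"
  have q0: "0 \<le> q" using h0 mu by (simp add: q_def)
  let ?E = "\<lambda>\<omega>. Y \<omega> * exp ((if a \<omega> \<le> r then \<xi> \<omega> else 0) \<bullet> w \<omega>)"
  let ?R = "\<lambda>\<omega>. Y \<omega> + Y \<omega> * (\<xi> \<omega> \<bullet> w \<omega>) + q * (Y \<omega> * exp (a \<omega>))"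
  have le: "?E \<omega> \<le> ?R \<omega>" if o: "\<omega> \<in> space M" for \<omega>
  proof -
    have "?E \<omega> \<le> Y \<omega> * (1 + \<xi> \<omega> \<bullet> w \<omega> + q * exp (a \<omega>))"
      unfolding q_def
      by (intro mult_left_mono exp_truncated_inner_le[OF \<theta> a(2)[OF o] b r xi_a[OF o] w(2)[OF o] small h] Y(2)[OF o])
    then show ?thesis by (simp add: algebra_simps)
  qed
  have intR: "integrable M ?R" using intY int_in intYa by simp
  have intE: "integrable M ?E"
  proof (rule Bochner_Integration.integrable_bound[OF intR])
    show "AE \<omega> in M. norm (?E \<omega>) \<le> norm (?R \<omega>)"
    proof (rule AE_I2)
      fix \<omega> assume o: "\<omega> \<in> space M"
      have "0 \<le> ?E \<omega>" using Y(2)[OF o] by simp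
      then show "norm (?E \<omega>) \<le> norm (?R \<omega>)" using le[OF o] by simp
    qed
  qed measurable
  have "integral\<^sup>L M ?E \<le> integral\<^sup>L M ?R" by (rule integral_mono[OF intE intR le])
  also have "\<dots> = (\<integral>\<omega>. Y \<omega> \<partial>M) + q * (\<integral>\<omega>. Y \<omega> * exp (a \<omega>) \<partial>M)"
    using intY int_in intYa zero by simp
  also have "\<dots> \<le> (\<integral>\<omega>. Y \<omega> \<partial>M) + q * (2 * (\<integral>\<omega>. Y \<omega> \<partial>M))"
    using expYa q0 by (intro add_left_mono mult_left_mono)
  also have "\<dots> = (1 + 2 * q) * (\<integral>\<omega>. Y \<omega> \<partial>M)" by (simp add: algebra_simps)
  also have "\<dots> \<le> exp (2 * q) * (\<integral>\<omega>. Y \<omega> \<partial>M)"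
    by (intro mult_right_mono exp_ge_add_one_self integral_nonneg_AE) (use Y in auto)
  finally show ?thesis by (simp add: q_def algebra_simps)
qed

lemma measurable_filtration_mono:
  assumes "filtration \<Omega> F" "s \<le> t" "f \<in> measurable (F s) N"
  shows "f \<in> measurable (F t) N"
  by (rule measurable_from_subalg[OF _ assms(3)])
    (use assms in \<open>auto simp: subalgebra_def filtration.space_F filtration.sets_F_mono\<close>)

lemma (in prob_space) exponential_markov:
  assumes int: "integrable M (\<lambda>\<omega>. exp (f \<omega> :: real))"
  shows "prob {\<omega> \<in> space M. u \<le> f \<omega>} \<le> exp (- u) * expectation (\<lambda>\<omega>. exp (f \<omega>))"
proof -
  have "set_integrable M (space M) (\<lambda>\<omega>. exp (1 * f \<omega>))"
    unfolding set_integrable_def by (rule Bochner_Integration.integrable_cong[THEN iffD1, OF refl _ int]) simp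
  then have "prob {\<omega> \<in> space M. u \<le> f \<omega>} \<le> exp (- 1 * u) * (\<integral>\<omega>\<in>space M. exp (1 * f \<omega>) \<partial>M)"
    by (rule Chernoff_ineq_ge[rotated]) auto
  then show ?thesis using set_integral_space[OF int] by simp
qed

text \<open>The martingale part of the descent inequality with large noise vectors replaced by zero. Outside
an event of small probability it agrees with the original sum, and unlike that sum it has
exponential moments for every \<open>\<theta>\<close>.\<close>

definition truncated_sum ::
  "real \<Rightarrow> (nat \<Rightarrow> 'w \<Rightarrow> real) \<Rightarrow> (nat \<Rightarrow> 'w \<Rightarrow> 'a::real_inner) \<Rightarrow> (nat \<Rightarrow> 'w \<Rightarrow> 'a) \<Rightarrow> nat \<Rightarrow> 'w \<Rightarrow> real" where
  "truncated_sum r a \<xi> w n \<omega> = (\<Sum>t=1..n. (if a t \<omega> \<le> r then \<xi> t \<omega> else 0) \<bullet> w t \<omega>)"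

context
  fixes M :: "'w measure" and F :: "nat \<Rightarrow> 'w measure" and \<xi> w :: "nat \<Rightarrow> 'w \<Rightarrow> real^'n"
    and a :: "nat \<Rightarrow> 'w \<Rightarrow> real" and \<mu> :: "nat \<Rightarrow> real" and b \<theta> r h :: real and T :: nat
  assumes M: "prob_space M" and filt: "filtration (space M) F" and F: "\<And>t. subalgebra M (F t)"
    and xi: "\<And>t. t \<in> {1..T} \<Longrightarrow> integrable M (\<xi> t)"
      "\<And>t k. t \<in> {1..T} \<Longrightarrow> AE \<omega> in M. real_cond_exp M (F (t - 1)) (\<lambda>\<omega>. \<xi> t \<omega> $ k) \<omega> = 0"
      "\<And>t. t \<in> {1..T} \<Longrightarrow> \<xi> t \<in> borel_measurable (F t)"
    and a: "\<And>t. t \<in> {1..T} \<Longrightarrow> a t \<in> borel_measurable (F t)"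
      "\<And>t \<omega>. t \<in> {1..T} \<Longrightarrow> \<omega> \<in> space M \<Longrightarrow> 0 \<le> a t \<omega>"
    and tail: "\<And>t. t \<in> {1..T} \<Longrightarrow>
      AE \<omega> in M. nn_cond_exp M (F (t - 1)) (\<lambda>\<omega>. ennreal (exp (a t \<omega>))) \<omega> \<le> 2"
    and xi_a: "\<And>t \<omega>. t \<in> {1..T} \<Longrightarrow> \<omega> \<in> space M \<Longrightarrow> norm (\<xi> t \<omega>) \<le> b * a t \<omega> powr \<theta>"
    and w: "\<And>t. t \<in> {1..T} \<Longrightarrow> w t \<in> borel_measurable (F (t - 1))"
      "\<And>t \<omega>. t \<in> {1..T} \<Longrightarrow> \<omega> \<in> space M \<Longrightarrow> norm (w t \<omega>) \<le> \<mu> t"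
    and \<theta>: "0 < \<theta>" and b: "0 \<le> b" and r: "0 \<le> r"
    and mu: "\<And>t. t \<in> {1..T} \<Longrightarrow> 0 \<le> \<mu> t"
    and small: "\<And>t. t \<in> {1..T} \<Longrightarrow> \<mu> t * b * (1 + r) powr max 0 (\<theta> - 1) \<le> 1 / 2"
    and h: "h = b * (4 * \<theta>) powr \<theta>"
begin

lemma truncated_sum_measurable:
  assumes "n \<le> T"
  shows "truncated_sum r a \<xi> w n \<in> borel_measurable (F n)"
proof -
  have "(\<lambda>\<omega>. (if a t \<omega> \<le> r then \<xi> t \<omega> else 0) \<bullet> w t \<omega>) \<in> borel_measurable (F n)"
    if t: "t \<in> {1..n}" for t
  proof -
    have tT: "t \<in> {1..T}" using t assms by simp
    have [measurable]: "a t \<in> borel_measurable (F n)" "\<xi> t \<in> borel_measurable (F n)"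
      "w t \<in> borel_measurable (F n)"
      by (rule measurable_filtration_mono[OF filt _ a(1)[OF tT]], use t in simp,
          rule measurable_filtration_mono[OF filt _ xi(3)[OF tT]], use t in simp,
          rule measurable_filtration_mono[OF filt _ w(1)[OF tT]], use t in auto)
    show ?thesis by measurable
  qed
  then show ?thesis unfolding truncated_sum_def[abs_def] by (rule borel_measurable_sum)
qed

lemma truncated_sum_bound:
  assumes "n \<le> T" "\<omega> \<in> space M"
  shows "\<bar>truncated_sum r a \<xi> w n \<omega>\<bar> \<le> (\<Sum>t=1..n. b * r powr \<theta> * \<mu> t)"
  unfolding truncated_sum_def
proof (rule order_trans[OF sum_abs], rule sum_mono)
  fix t assume t: "t \<in> {1..n}"
  then have tT: "t \<in> {1..T}" using assms by auto
  show "\<bar>(if a t \<omega> \<le> r then \<xi> t \<omega> else 0) \<bullet> w t \<omega>\<bar> \<le> b * r powr \<theta> * \<mu> t"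
  proof (cases "a t \<omega> \<le> r")
    case True
    have "norm (\<xi> t \<omega>) \<le> b * r powr \<theta>"
      using xi_a[OF tT assms(2)] mult_left_mono[OF powr_mono2[OF _ a(2)[OF tT assms(2)] True, of \<theta>] b] \<theta>
      by linarith
    then have "norm (\<xi> t \<omega>) * norm (w t \<omega>) \<le> b * r powr \<theta> * \<mu> t"
      using w(2)[OF tT assms(2)] b by (intro mult_mono) auto
    then show ?thesis using True Cauchy_Schwarz_ineq2[of "\<xi> t \<omega>" "w t \<omega>"] by simp
  next
    case False
    then show ?thesis using b mu[OF tT] by simp
  qed
qed

lemma truncated_sum_mgf:
  assumes "n \<le> T"
  shows "(\<integral>\<omega>. exp (truncated_sum r a \<xi> w n \<omega>) \<partial>M) \<le> exp (\<Sum>t=1..n. 4 * h\<^sup>2 * (\<mu> t)\<^sup>2 + 2 * h * \<mu> t * exp (- r / 2))"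
  using assms
proof (induction n)
  case 0
  interpret prob_space M by (rule M)
  show ?case by (simp add: truncated_sum_def prob_space)
next
  case (Suc n)
  let ?c = "\<lambda>t. 4 * h\<^sup>2 * (\<mu> t)\<^sup>2 + 2 * h * \<mu> t * exp (- r / 2)"
  have S: "Suc n \<in> {1..T}" using Suc.prems by simp
  have [measurable]: "truncated_sum r a \<xi> w n \<in> borel_measurable (F n)"
    by (rule truncated_sum_measurable) (use Suc.prems in simp)
  have aM: "a (Suc n) \<in> borel_measurable M" by (rule measurable_from_subalg[OF F a(1)[OF S]])
  have "(\<integral>\<omega>. exp (truncated_sum r a \<xi> w (Suc n) \<omega>) \<partial>M)
      = (\<integral>\<omega>. exp (truncated_sum r a \<xi> w n \<omega>) * exp ((if a (Suc n) \<omega> \<le> r then \<xi> (Suc n) \<omega> else 0) \<bullet> w (Suc n) \<omega>) \<partial>M)"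
    by (rule Bochner_Integration.integral_cong) (simp_all add: truncated_sum_def exp_add)
  also have "\<dots> \<le> exp (?c (Suc n)) * (\<integral>\<omega>. exp (truncated_sum r a \<xi> w n \<omega>) \<partial>M)"
  proof (rule truncated_noise_mgf_step[OF M F[of n] xi(1)[OF S] _ aM a(2)[OF S] _ xi_a[OF S] _ w(2)[OF S] _ _ _ \<theta> b r mu[OF S] small[OF S] h])
    show "AE \<omega> in M. real_cond_exp M (F n) (\<lambda>\<omega>. \<xi> (Suc n) \<omega> $ k) \<omega> = 0" for k
      using xi(2)[OF S, of k] by simp
    show "AE \<omega> in M. nn_cond_exp M (F n) (\<lambda>\<omega>. ennreal (exp (a (Suc n) \<omega>))) \<omega> \<le> 2"
      using tail[OF S] by simp
    show "w (Suc n) \<in> borel_measurable (F n)" using w(1)[OF S] by simp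
    show "(\<lambda>\<omega>. exp (truncated_sum r a \<xi> w n \<omega>)) \<in> borel_measurable (F n)" by measurable
    show "exp (truncated_sum r a \<xi> w n \<omega>) \<le> exp (\<Sum>t=1..n. b * r powr \<theta> * \<mu> t)" if "\<omega> \<in> space M" for \<omega>
      using truncated_sum_bound[OF _ that, of n] Suc.prems by simp
  qed auto
  also have "\<dots> \<le> exp (?c (Suc n)) * exp (\<Sum>t=1..n. ?c t)"
    using Suc by (intro mult_left_mono) auto
  also have "\<dots> = exp (\<Sum>t=1..Suc n. ?c t)" by (simp add: exp_add)
  finally show ?case .
qed

lemma truncated_sum_tail:
  assumes n: "n \<le> T"
  shows "measure M {\<omega> \<in> space M. u \<le> truncated_sum r a \<xi> w n \<omega>}
    \<le> exp ((\<Sum>t=1..n. 4 * h\<^sup>2 * (\<mu> t)\<^sup>2 + 2 * h * \<mu> t * exp (- r / 2)) - u)"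
proof -
  interpret prob_space M by (rule M)
  have [measurable]: "truncated_sum r a \<xi> w n \<in> borel_measurable M"
    by (rule measurable_from_subalg[OF F truncated_sum_measurable[OF n]])
  have "integrable M (\<lambda>\<omega>. exp (truncated_sum r a \<xi> w n \<omega>))"
    by (rule integrable_const_bound[where B = "exp (\<Sum>t=1..n. b * r powr \<theta> * \<mu> t)"])
      (use truncated_sum_bound[OF n] in \<open>auto simp: abs_le_iff\<close>)
  then have "measure M {\<omega> \<in> space M. u \<le> truncated_sum r a \<xi> w n \<omega>}
      \<le> exp (- u) * (\<integral>\<omega>. exp (truncated_sum r a \<xi> w n \<omega>) \<partial>M)"
    by (rule exponential_markov)
  also have "\<dots> \<le> exp (- u) * exp (\<Sum>t=1..n. 4 * h\<^sup>2 * (\<mu> t)\<^sup>2 + 2 * h * \<mu> t * exp (- r / 2))"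
    by (intro mult_left_mono truncated_sum_mgf n) simp
  finally show ?thesis by (simp add: exp_add[symmetric] algebra_simps)
qed

lemma noise_tail:
  assumes t: "t \<in> {1..T}"
  shows "measure M {\<omega> \<in> space M. r \<le> a t \<omega>} \<le> 2 * exp (- r)"
proof -
  interpret prob_space M by (rule M)
  interpret S: sigma_finite_subalgebra M "F (t - 1)"
    by (intro finite_measure_subalgebra_is_sigma_finite finite_measure_subalgebra.intro
        finite_measure_subalgebra_axioms.intro finite_measure_axioms F)
  have [measurable]: "a t \<in> borel_measurable M" by (rule measurable_from_subalg[OF F a(1)[OF t]])
  have "(\<integral>\<^sup>+\<omega>. ennreal (exp (a t \<omega>)) \<partial>M)
      = (\<integral>\<^sup>+\<omega>. 1 * nn_cond_exp M (F (t - 1)) (\<lambda>\<omega>. ennreal (exp (a t \<omega>))) \<omega> \<partial>M)"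
    by (subst S.nn_cond_exp_intg) auto
  also have "\<dots> \<le> (\<integral>\<^sup>+\<omega>. 2 \<partial>M)" by (rule nn_integral_mono_AE) (use tail[OF t] in simp)
  finally have nn: "(\<integral>\<^sup>+\<omega>. ennreal (exp (a t \<omega>)) \<partial>M) \<le> 2" by (simp add: emeasure_space_1)
  then have int: "integrable M (\<lambda>\<omega>. exp (a t \<omega>))"
    by (intro integrableI_nonneg) (auto intro: order_le_less_trans)
  have le2: "(\<integral>\<omega>. exp (a t \<omega>) \<partial>M) \<le> 2"
  proof -
    have "ennreal (\<integral>\<omega>. exp (a t \<omega>) \<partial>M) \<le> ennreal 2"
      using nn nn_integral_eq_integral[OF int] by simp
    then show ?thesis by (subst (asm) ennreal_le_iff) simp_all
  qed
  have "measure M {\<omega> \<in> space M. r \<le> a t \<omega>} \<le> exp (- r) * (\<integral>\<omega>. exp (a t \<omega>) \<partial>M)"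
    by (rule exponential_markov[OF int])
  also have "\<dots> \<le> exp (- r) * 2" using le2 by (intro mult_left_mono) auto
  finally show ?thesis by (simp add: mult.commute)
qed

end

section \<open>Energy descent along a sample path\<close>

lemma norm_weighted_mean_square_le:
  fixes v :: "'i \<Rightarrow> 'a::real_inner"
  assumes p: "\<And>i. i \<in> I \<Longrightarrow> 0 \<le> p i" and one: "sum p I = 1"
  shows "(norm (\<Sum>i\<in>I. p i *\<^sub>R v i))\<^sup>2 \<le> (\<Sum>i\<in>I. p i * (norm (v i))\<^sup>2)"
proof -
  define c where "c = (\<Sum>i\<in>I. p i *\<^sub>R v i)"
  have "0 \<le> (\<Sum>i\<in>I. p i * (norm (v i - c))\<^sup>2)" by (intro sum_nonneg mult_nonneg_nonneg p) auto
  also have "\<dots> = (\<Sum>i\<in>I. p i * (norm (v i))\<^sup>2 - 2 * ((p i *\<^sub>R v i) \<bullet> c) + p i * (c \<bullet> c))"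
    by (rule sum.cong) (simp_all add: power2_norm_eq_inner inner_diff inner_commute algebra_simps)
  also have "\<dots> = (\<Sum>i\<in>I. p i * (norm (v i))\<^sup>2) - 2 * (\<Sum>i\<in>I. (p i *\<^sub>R v i) \<bullet> c) + sum p I * (c \<bullet> c)"
    by (simp add: sum.distrib sum_subtractf sum_distrib_left sum_distrib_right)
  also have "(\<Sum>i\<in>I. (p i *\<^sub>R v i) \<bullet> c) = c \<bullet> c"
    unfolding inner_sum_left[symmetric] c_def[symmetric] ..
  finally have "c \<bullet> c \<le> (\<Sum>i\<in>I. p i * (norm (v i))\<^sup>2)" using one by simp
  then show ?thesis by (simp add: c_def power2_norm_eq_inner)
qed

lemma norm_closest_point_diff_le:
  fixes X :: "'a::euclidean_space set"
  assumes "closed X" "convex X" "p \<in> X"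
  shows "norm (closest_point X z - p) \<le> norm (z - p)"
  using closest_point_lipschitz[of X z p] closest_point_self[of p X] assms
  by (auto simp: dist_norm)

context
  fixes m :: nat and D X :: "'a::euclidean_space set" and f :: "nat \<Rightarrow> 'a \<Rightarrow> real"
    and A :: "nat \<Rightarrow> nat \<Rightarrow> real" and \<alpha> G R :: real and p :: 'a
    and x x' g \<xi> :: "nat \<Rightarrow> 'a"
  assumes m: "1 \<le> m" and X: "closed X" "convex X" "X \<subseteq> D" and pX: "p \<in> X"
    and A: "doubly_stochastic m A" and \<alpha>: "0 < \<alpha>"
    and xX: "\<And>i. i \<in> {1..m} \<Longrightarrow> x i \<in> X"
    and g: "\<And>i. i \<in> {1..m} \<Longrightarrow> g i \<in> subdifferential D (f i) (x i)"
      "\<And>i. i \<in> {1..m} \<Longrightarrow> norm (g i) \<le> G"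
    and \<xi>: "\<And>i. i \<in> {1..m} \<Longrightarrow> norm (\<xi> i) \<le> R"
    and step: "\<And>i. i \<in> {1..m} \<Longrightarrow>
      x' i = closest_point X ((\<Sum>j=1..m. A i j *\<^sub>R x j) - \<alpha> *\<^sub>R (g i - \<xi> i))"
begin

lemma stochastic_rows: "i \<in> {1..m} \<Longrightarrow> j \<in> {1..m} \<Longrightarrow> 0 \<le> A i j" "i \<in> {1..m} \<Longrightarrow> (\<Sum>j=1..m. A i j) = 1"
  "j \<in> {1..m} \<Longrightarrow> (\<Sum>i=1..m. A i j) = 1"
  using A unfolding doubly_stochastic_def by blast+

lemma mixed_point_in: "i \<in> {1..m} \<Longrightarrow> (\<Sum>j=1..m. A i j *\<^sub>R x j) \<in> X"
  by (rule convex_sum) (use X stochastic_rows xX in auto)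

lemma mixed_point_diff:
  assumes i: "i \<in> {1..m}"
  shows "(\<Sum>j=1..m. A i j *\<^sub>R x j) - c = (\<Sum>j=1..m. A i j *\<^sub>R (x j - c))"
proof -
  have "(\<Sum>j=1..m. A i j *\<^sub>R c) = c"
    using stochastic_rows(2)[OF i] by (simp only: scaleR_left.sum[symmetric] scaleR_one)
  then show ?thesis by (simp add: scaleR_diff_right sum_subtractf)
qed

lemma consensus_perturbation:
  assumes i: "i \<in> {1..m}"
  shows "norm (x' i - (\<Sum>j=1..m. A i j *\<^sub>R x j)) \<le> \<alpha> * (G + R)"
proof -
  have "norm (x' i - (\<Sum>j=1..m. A i j *\<^sub>R x j)) \<le> norm (\<alpha> *\<^sub>R (g i - \<xi> i))"
    using norm_closest_point_diff_le[OF X(1,2) mixed_point_in[OF i], of "(\<Sum>j=1..m. A i j *\<^sub>R x j) - \<alpha> *\<^sub>R (g i - \<xi> i)"]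
    unfolding step[OF i, symmetric] by simp
  also have "\<dots> \<le> \<alpha> * (G + R)"
    using \<alpha> g(2)[OF i] \<xi>[OF i] norm_triangle_ineq4[of "g i" "\<xi> i"] by simp
  finally show ?thesis .
qed

text \<open>The projection does not increase the distance to \<open>p\<close>, and the mixing does not increase the sum of
squared distances because the columns of \<open>A\<close> sum to one. The subgradient of \<open>f i\<close> is taken at
\<open>x i\<close>, while the gradient step starts from the mixed point and the gap is measured at \<open>x l\<close>;
both discrepancies are paid for by the spread.\<close>

lemma descent_step:
  assumes l: "l \<in> {1..m}"
    and lip: "\<And>i. i \<in> {1..m} \<Longrightarrow> f i (x l) - G * norm (x i - x l) \<le> f i (x i)"
  shows "(\<Sum>i=1..m. (norm (x' i - p))\<^sup>2) + 2 * \<alpha> * ((\<Sum>i=1..m. f i (x l)) - (\<Sum>i=1..m. f i p))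
    \<le> (\<Sum>i=1..m. (norm (x i - p))\<^sup>2) + 4 * m * G * (\<alpha> * spread m x)
      + 2 * (\<Sum>i=1..m. \<xi> i \<bullet> (\<alpha> *\<^sub>R ((\<Sum>j=1..m. A i j *\<^sub>R x j) - p))) + 2 * m * (G\<^sup>2 + R\<^sup>2) * \<alpha>\<^sup>2"
proof -
  let ?y = "\<lambda>i. \<Sum>j=1..m. A i j *\<^sub>R x j"
  let ?E = "spread m x"
  have G0: "0 \<le> G" using g(2)[OF l] norm_ge_zero order_trans by blast
  have each: "(norm (x' i - p))\<^sup>2 + 2 * \<alpha> * (f i (x l) - f i p)
      \<le> (norm (?y i - p))\<^sup>2 + 4 * G * (\<alpha> * ?E) + 2 * (\<xi> i \<bullet> (\<alpha> *\<^sub>R (?y i - p))) + 2 * (G\<^sup>2 + R\<^sup>2) * \<alpha>\<^sup>2"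
    if i: "i \<in> {1..m}" for i
  proof -
    define v where "v = ?y i - p"
    define d where "d = g i - \<xi> i"
    have "norm (x' i - p) \<le> norm (?y i - \<alpha> *\<^sub>R d - p)"
      unfolding step[OF i] d_def by (rule norm_closest_point_diff_le[OF X(1,2) pX])
    also have "?y i - \<alpha> *\<^sub>R d - p = v - \<alpha> *\<^sub>R d" by (simp add: v_def)
    finally have "(norm (x' i - p))\<^sup>2 \<le> (norm (v - \<alpha> *\<^sub>R d))\<^sup>2" by (rule power_mono) simp
    also have "\<dots> = (norm v)\<^sup>2 - 2 * \<alpha> * (d \<bullet> v) + \<alpha>\<^sup>2 * (norm d)\<^sup>2"
      unfolding power2_norm_eq_inner
      by (simp add: inner_diff inner_commute power2_eq_square algebra_simps)
    finally have expand: "(norm (x' i - p))\<^sup>2 \<le> (norm v)\<^sup>2 - 2 * \<alpha> * (d \<bullet> v) + \<alpha>\<^sup>2 * (norm d)\<^sup>2" .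
    have "(norm d)\<^sup>2 \<le> (G + R)\<^sup>2"
      unfolding d_def using g(2)[OF i] \<xi>[OF i] norm_triangle_ineq4[of "g i" "\<xi> i"]
      by (intro power_mono) auto
    also have "\<dots> \<le> 2 * (G\<^sup>2 + R\<^sup>2)"
      using zero_le_power2[of "G - R"] by (simp add: power2_sum power2_diff)
    finally have "\<alpha>\<^sup>2 * (norm d)\<^sup>2 \<le> \<alpha>\<^sup>2 * (2 * (G\<^sup>2 + R\<^sup>2))" by (rule mult_left_mono) simp
    then have noise: "\<alpha>\<^sup>2 * (norm d)\<^sup>2 \<le> 2 * (G\<^sup>2 + R\<^sup>2) * \<alpha>\<^sup>2" by (simp add: mult_ac)
    have yx: "norm (?y i - x i) \<le> ?E"
    proof -
      have "norm (?y i - x i) \<le> (\<Sum>j=1..m. A i j * ?E)"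
        unfolding mixed_point_diff[OF i]
      proof (rule sum_norm_le)
        fix j assume j: "j \<in> {1..m}"
        show "norm (A i j *\<^sub>R (x j - x i)) \<le> A i j * ?E"
          using mult_left_mono[OF spread_ge[OF j i, of x] stochastic_rows(1)[OF i j]] stochastic_rows(1)[OF i j] by simp
      qed
      then show ?thesis using stochastic_rows(2)[OF i] by (simp add: sum_distrib_right[symmetric])
    qed
    have "f i (x i) - f i p \<le> g i \<bullet> (x i - p)"
      using g(1)[OF i] pX X(3) unfolding subdifferential_def by (fastforce simp: inner_diff_right)
    moreover have "- (G * ?E) \<le> g i \<bullet> (?y i - x i)"
      using Cauchy_Schwarz_ineq2[of "g i" "?y i - x i"] mult_mono[OF g(2)[OF i] yx G0] by simp
    moreover have "G * norm (x i - x l) \<le> G * ?E"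
      using spread_ge[OF i l, of x] G0 by (rule mult_left_mono)
    moreover have "g i \<bullet> v = g i \<bullet> (x i - p) + g i \<bullet> (?y i - x i)"
      by (simp add: v_def inner_diff_right)
    ultimately have "f i (x l) - f i p - 2 * (G * ?E) \<le> g i \<bullet> v" using lip[OF i] by linarith
    then have "2 * \<alpha> * (f i (x l) - f i p - 2 * (G * ?E)) \<le> 2 * \<alpha> * (g i \<bullet> v)"
      using \<alpha> by (intro mult_left_mono) auto
    moreover have "2 * \<alpha> * (d \<bullet> v) = 2 * \<alpha> * (g i \<bullet> v) - 2 * (\<xi> i \<bullet> (\<alpha> *\<^sub>R v))"
      by (simp add: d_def inner_diff_left algebra_simps)
    ultimately show ?thesis using expand noise unfolding v_def[symmetric] by (simp add: algebra_simps)
  qed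
  have "(\<Sum>i=1..m. (norm (?y i - p))\<^sup>2) \<le> (\<Sum>i=1..m. \<Sum>j=1..m. A i j * (norm (x j - p))\<^sup>2)"
  proof (rule sum_mono)
    fix i assume i: "i \<in> {1..m}"
    show "(norm (?y i - p))\<^sup>2 \<le> (\<Sum>j=1..m. A i j * (norm (x j - p))\<^sup>2)"
      unfolding mixed_point_diff[OF i] by (rule norm_weighted_mean_square_le) (use i stochastic_rows in auto)
  qed
  also have "\<dots> = (\<Sum>j=1..m. (\<Sum>i=1..m. A i j) * (norm (x j - p))\<^sup>2)"
    by (subst sum.swap) (simp add: sum_distrib_right)
  also have "\<dots> = (\<Sum>j=1..m. (norm (x j - p))\<^sup>2)"
    by (rule sum.cong) (simp_all add: stochastic_rows(3) del: One_nat_def)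
  finally have mean: "(\<Sum>i=1..m. (norm (?y i - p))\<^sup>2) \<le> (\<Sum>i=1..m. (norm (x i - p))\<^sup>2)" .
  have "(\<Sum>i=1..m. (norm (x' i - p))\<^sup>2 + 2 * \<alpha> * (f i (x l) - f i p))
      \<le> (\<Sum>i=1..m. (norm (?y i - p))\<^sup>2 + 4 * G * (\<alpha> * ?E) + 2 * (\<xi> i \<bullet> (\<alpha> *\<^sub>R (?y i - p))) + 2 * (G\<^sup>2 + R\<^sup>2) * \<alpha>\<^sup>2)"
    by (rule sum_mono) (rule each)
  moreover have "(\<Sum>i=1..m. (norm (x' i - p))\<^sup>2 + 2 * \<alpha> * (f i (x l) - f i p))
      = (\<Sum>i=1..m. (norm (x' i - p))\<^sup>2) + 2 * \<alpha> * ((\<Sum>i=1..m. f i (x l)) - (\<Sum>i=1..m. f i p))"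
    by (simp add: sum.distrib sum_distrib_left[symmetric] sum_subtractf)
  moreover have "(\<Sum>i=1..m. (norm (?y i - p))\<^sup>2 + 4 * G * (\<alpha> * ?E) + 2 * (\<xi> i \<bullet> (\<alpha> *\<^sub>R (?y i - p))) + 2 * (G\<^sup>2 + R\<^sup>2) * \<alpha>\<^sup>2)
      = (\<Sum>i=1..m. (norm (?y i - p))\<^sup>2) + m * (4 * G * (\<alpha> * ?E))
        + 2 * (\<Sum>i=1..m. \<xi> i \<bullet> (\<alpha> *\<^sub>R (?y i - p))) + m * (2 * (G\<^sup>2 + R\<^sup>2) * \<alpha>\<^sup>2)"
    by (simp add: sum.distrib sum_distrib_left[symmetric])
  ultimately show ?thesis using mean by (simp add: mult_ac)
qed

end

definition sq_dist_sum :: "nat \<Rightarrow> 'a::real_normed_vector \<Rightarrow> (nat \<Rightarrow> 'a) \<Rightarrow> real" where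
  "sq_dist_sum m p y = (\<Sum>i=1..m. (norm (y i - p))\<^sup>2)"

text \<open>The direction multiplying the noise, rescaled to have norm at most \<open>s\<close> and switched off once the
energy exceeds the level \<open>d\<close>. Switching off is decided before the noise is drawn, so
the conditional mean stays zero, and the rescaled direction is bounded although \<open>X\<close> may be
unbounded.\<close>

definition stopped_direction ::
  "nat \<Rightarrow> (nat \<Rightarrow> nat \<Rightarrow> real) \<Rightarrow> real \<Rightarrow> 'a::real_normed_vector \<Rightarrow> real \<Rightarrow> (nat \<Rightarrow> 'a) \<Rightarrow> nat \<Rightarrow> 'a" where
  "stopped_direction m A s p d y i =
     (if sq_dist_sum m p y \<le> d then (s / sqrt d) *\<^sub>R ((\<Sum>j=1..m. A i j *\<^sub>R y j) - p) else 0)"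

lemma norm_stopped_direction_le:
  fixes y :: "nat \<Rightarrow> 'a::real_inner"
  assumes A: "doubly_stochastic m A" and s: "0 \<le> s" and d: "0 < d" and i: "i \<in> {1..m}"
  shows "norm (stopped_direction m A s p d y i) \<le> s"
proof (cases "sq_dist_sum m p y \<le> d")
  case True
  have Aij: "0 \<le> A i j" "A i j \<le> 1" if "j \<in> {1..m}" for j
  proof -
    show "0 \<le> A i j" using A i that unfolding doubly_stochastic_def by blast
    have "A i j \<le> (\<Sum>j=1..m. A i j)"
      by (rule member_le_sum) (use A i that in \<open>auto simp: doubly_stochastic_def\<close>)
    also have "\<dots> = 1" using A i unfolding doubly_stochastic_def by blast
    finally show "A i j \<le> 1" .
  qed
  have one: "(\<Sum>j=1..m. A i j) = 1" using A i unfolding doubly_stochastic_def by blast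
  have "(\<Sum>j=1..m. A i j *\<^sub>R p) = p"
    using one by (simp only: scaleR_left.sum[symmetric] scaleR_one)
  then have diff: "(\<Sum>j=1..m. A i j *\<^sub>R y j) - p = (\<Sum>j=1..m. A i j *\<^sub>R (y j - p))"
    by (simp add: scaleR_diff_right sum_subtractf)
  have "(norm ((\<Sum>j=1..m. A i j *\<^sub>R y j) - p))\<^sup>2 \<le> (\<Sum>j=1..m. A i j * (norm (y j - p))\<^sup>2)"
    unfolding diff by (rule norm_weighted_mean_square_le) (use Aij one in auto)
  also have "\<dots> \<le> sq_dist_sum m p y"
    unfolding sq_dist_sum_def by (rule sum_mono) (use Aij in \<open>auto intro!: mult_left_le_one_le\<close>)
  finally have "norm ((\<Sum>j=1..m. A i j *\<^sub>R y j) - p) \<le> sqrt d"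
    using True by (intro real_le_rsqrt) simp
  then have "s / sqrt d * norm ((\<Sum>j=1..m. A i j *\<^sub>R y j) - p) \<le> s / sqrt d * sqrt d"
    using s d by (intro mult_left_mono) auto
  then show ?thesis using True s d by (simp add: stopped_direction_def)
next
  case False
  then show ?thesis using s by (simp add: stopped_direction_def)
qed

text \<open>The level \<open>d\<close> solves the quadratic inequality \<open>V 1 + A + 2 m \<surd>d u \<le> d\<close>, in which \<open>A\<close> bounds the
accumulated consensus error and squared step lengths, and \<open>u\<close> bounds the rescaled noise sum of
each agent. As long as the energy has stayed below \<open>d\<close>, the stopped direction is the true one, so
the summed descent inequality keeps the energy below \<open>d\<close> for one more step. By induction the
stopping never happens, and the same inequality bounds the weighted sum of gaps.\<close>

lemma pathwise_descent:
  fixes m :: nat and D X :: "'a::euclidean_space set" and f :: "nat \<Rightarrow> 'a \<Rightarrow> real"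
    and W :: "nat \<Rightarrow> nat \<Rightarrow> nat \<Rightarrow> real" and \<alpha> :: "nat \<Rightarrow> real" and G R u d :: real and p :: 'a
    and x g \<xi> :: "nat \<Rightarrow> nat \<Rightarrow> 'a"
  assumes m: "1 \<le> m" and net: "network_assumption m W B \<eta>"
    and X: "closed X" "convex X" "X \<subseteq> D" and pX: "p \<in> X"
    and opt: "\<And>z. z \<in> X \<Longrightarrow> (\<Sum>i=1..m. f i p) \<le> (\<Sum>i=1..m. f i z)"
    and T: "1 \<le> T" and \<alpha>: "\<And>t. t \<in> {1..T} \<Longrightarrow> 0 < \<alpha> t"
    and dec: "\<And>s t. 1 \<le> s \<Longrightarrow> s \<le> t \<Longrightarrow> t \<le> T \<Longrightarrow> \<alpha> t \<le> \<alpha> s"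
    and xX: "\<And>i t. i \<in> {1..m} \<Longrightarrow> t \<in> {1..T} \<Longrightarrow> x i t \<in> X"
    and g: "\<And>i t. i \<in> {1..m} \<Longrightarrow> t \<in> {1..T} \<Longrightarrow> g i t \<in> subdifferential D (f i) (x i t)"
      "\<And>i t. i \<in> {1..m} \<Longrightarrow> t \<in> {1..T} \<Longrightarrow> norm (g i t) \<le> G"
    and \<xi>: "\<And>i t. i \<in> {1..m} \<Longrightarrow> t \<in> {1..T} \<Longrightarrow> norm (\<xi> i t) \<le> R"
    and step: "\<And>i t. i \<in> {1..m} \<Longrightarrow> t \<in> {1..T} \<Longrightarrow>
      x i (t + 1) = closest_point X ((\<Sum>j=1..m. W t i j *\<^sub>R x j t) - \<alpha> t *\<^sub>R (g i t - \<xi> i t))"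
    and lip: "\<And>i l t. i \<in> {1..m} \<Longrightarrow> l \<in> {1..m} \<Longrightarrow> t \<in> {1..T} \<Longrightarrow>
      f i (x l t) - G * norm (x i t - x l t) \<le> f i (x i t)"
    and noise: "\<And>i n. i \<in> {1..m} \<Longrightarrow> n \<in> {1..T} \<Longrightarrow>
      (\<Sum>t=1..n. \<xi> i t \<bullet> stopped_direction m (W t) (\<alpha> t) p d (\<lambda>j. x j t) i) \<le> u"
    and u: "0 \<le> u"
    and K: "K = (m + 1) * B"
    and A: "A = 4 * m * G * (K / \<eta> ^ K * (\<alpha> 1 * spread m (\<lambda>i. x i 1) + 4 * (G + R) * (\<Sum>t=1..T. (\<alpha> t)\<^sup>2)))
      + 2 * m * (G\<^sup>2 + R\<^sup>2) * (\<Sum>t=1..T. (\<alpha> t)\<^sup>2)"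
    and d: "d = 2 * (sq_dist_sum m p (\<lambda>i. x i 1) + A) + 4 * (real m)\<^sup>2 * u\<^sup>2 + 1"
    and l: "l \<in> {1..m}"
  shows "(\<Sum>t=1..T. 2 * \<alpha> t * ((\<Sum>i=1..m. f i (x l t)) - (\<Sum>i=1..m. f i p))) \<le> d"
proof -
  let ?V = "\<lambda>t. sq_dist_sum m p (\<lambda>i. x i t)"
  let ?E = "\<lambda>t. spread m (\<lambda>i. x i t)"
  let ?y = "\<lambda>i t. \<Sum>j=1..m. W t i j *\<^sub>R x j t"
  let ?\<Phi> = "\<lambda>t. (\<Sum>i=1..m. f i (x l t)) - (\<Sum>i=1..m. f i p)"
  let ?w = "\<lambda>i t. stopped_direction m (W t) (\<alpha> t) p d (\<lambda>j. x j t) i"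
  let ?c = "\<lambda>t. 4 * m * G * (\<alpha> t * ?E t) + 2 * m * (G\<^sup>2 + R\<^sup>2) * (\<alpha> t)\<^sup>2"
  have eta: "0 < \<eta>" using net unfolding network_assumption_def by simp
  have one: "1 \<in> {1..T}" using T by simp
  have G0: "0 \<le> G" using g(2)[OF l one] norm_ge_zero order_trans by blast
  have R0: "0 \<le> R" using \<xi>[OF l one] norm_ge_zero order_trans by blast
  have ds: "doubly_stochastic m (W t)" if "t \<in> {1..T}" for t
    using net that unfolding network_assumption_def by simp
  have \<Phi>0: "0 \<le> ?\<Phi> t" if "t \<in> {1..T}" for t using opt[OF xX[OF l that]] by simp
  have V0: "0 \<le> ?V t" for t unfolding sq_dist_sum_def by (intro sum_nonneg) auto
  have c0: "0 \<le> ?c t" if t: "t \<in> {1..T}" for t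
  proof -
    have "0 \<le> \<alpha> t * ?E t" using \<alpha>[OF t] spread_nonneg[OF m] by (intro mult_nonneg_nonneg) auto
    then show ?thesis using G0 by simp
  qed
  have "\<eta> ^ K * (\<Sum>t=1..T. \<alpha> t * ?E t)
      \<le> K * (\<alpha> 1 * ?E 1 + 4 * (\<Sum>t=1..T. \<alpha> t * (\<alpha> t * (G + R))))"
  proof (rule weighted_spread_sum_le[OF m net _ dec _ _ T K])
    fix t i assume t: "1 \<le> t" "t \<le> T" and i: "i \<in> {1..m}"
    then have tT: "t \<in> {1..T}" by simp
    show "norm (x i (t + 1) - ?y i t) \<le> \<alpha> t * (G + R)"
      by (rule consensus_perturbation[OF m X pX ds[OF tT] \<alpha>[OF tT] xX[OF _ tT] g(1)[OF _ tT] g(2)[OF _ tT] \<xi>[OF _ tT] step[OF _ tT] i])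
  next
    fix t assume t: "1 \<le> t" "t \<le> T"
    then have "0 < \<alpha> t" using \<alpha>[of t] by simp
    then show "0 \<le> \<alpha> t" "0 \<le> \<alpha> t * (G + R)" using G0 R0 by auto
  qed
  also have "(\<Sum>t=1..T. \<alpha> t * (\<alpha> t * (G + R))) = (G + R) * (\<Sum>t=1..T. (\<alpha> t)\<^sup>2)"
    by (simp add: sum_distrib_left power2_eq_square mult_ac)
  finally have cons: "(\<Sum>t=1..T. \<alpha> t * ?E t)
      \<le> K / \<eta> ^ K * (\<alpha> 1 * ?E 1 + 4 * (G + R) * (\<Sum>t=1..T. (\<alpha> t)\<^sup>2))"
    using eta by (simp add: field_simps)
  have "(\<Sum>t=1..T. ?c t) = 4 * m * G * (\<Sum>t=1..T. \<alpha> t * ?E t) + 2 * m * (G\<^sup>2 + R\<^sup>2) * (\<Sum>t=1..T. (\<alpha> t)\<^sup>2)"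
    by (simp only: sum.distrib sum_distrib_left)
  also have "\<dots> \<le> A" unfolding A using cons G0 by (intro add_right_mono mult_left_mono) auto
  finally have cA: "(\<Sum>t=1..T. ?c t) \<le> A" .
  have "0 \<le> (\<Sum>t=1..T. ?c t)" by (rule sum_nonneg) (rule c0)
  then have A0: "0 \<le> A" using cA by linarith
  have d0: "0 < d" unfolding d using V0[of 1] A0 by (intro add_nonneg_pos) auto
  have budget: "?V 1 + A + 2 * real m * (sqrt d * u) \<le> d"
  proof -
    have "0 \<le> (sqrt d - 2 * real m * u)\<^sup>2" by simp
    also have "\<dots> = d - 4 * real m * (sqrt d * u) + 4 * (real m)\<^sup>2 * u\<^sup>2"
      using d0 by (simp add: power2_diff power_mult_distrib)
    finally have "0 \<le> d - 4 * (real m * (sqrt d * u)) + 4 * ((real m)\<^sup>2 * u\<^sup>2)"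
      by (simp only: mult.assoc)
    moreover have "d = 2 * ?V 1 + 2 * A + 4 * ((real m)\<^sup>2 * u\<^sup>2) + 1"
      unfolding d by (simp only: mult.assoc distrib_left)
    moreover have "2 * real m * (sqrt d * u) = 2 * (real m * (sqrt d * u))" by (simp only: mult.assoc)
    ultimately show ?thesis by linarith
  qed
  have one_step: "?V (t + 1) - ?V t + 2 * \<alpha> t * ?\<Phi> t \<le> ?c t + 2 * sqrt d * (\<Sum>i=1..m. \<xi> i t \<bullet> ?w i t)"
    if t: "t \<in> {1..T}" and V: "?V t \<le> d" for t
  proof -
    have "?V (t + 1) + 2 * \<alpha> t * ?\<Phi> t \<le> ?V t + 4 * m * G * (\<alpha> t * ?E t)
        + 2 * (\<Sum>i=1..m. \<xi> i t \<bullet> (\<alpha> t *\<^sub>R (?y i t - p))) + 2 * m * (G\<^sup>2 + R\<^sup>2) * (\<alpha> t)\<^sup>2"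
      unfolding sq_dist_sum_def
      by (rule descent_step[OF m X pX ds[OF t] \<alpha>[OF t] xX[OF _ t] g(1)[OF _ t] g(2)[OF _ t] \<xi>[OF _ t] step[OF _ t] l lip[OF _ l t]])
    moreover have "(\<Sum>i=1..m. \<xi> i t \<bullet> (\<alpha> t *\<^sub>R (?y i t - p))) = sqrt d * (\<Sum>i=1..m. \<xi> i t \<bullet> ?w i t)"
      unfolding sum_distrib_left
      by (rule sum.cong) (use V d0 in \<open>simp_all add: stopped_direction_def\<close>)
    ultimately show ?thesis by linarith
  qed
  have accum: "?V (n + 1) + (\<Sum>t=1..n. 2 * \<alpha> t * ?\<Phi> t) \<le> d"
    if n: "n \<le> T" and V: "\<And>t. t \<in> {1..n} \<Longrightarrow> ?V t \<le> d" for n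
  proof -
    have "(\<Sum>t=1..n. ?V (t + 1) - ?V t + 2 * \<alpha> t * ?\<Phi> t)
        \<le> (\<Sum>t=1..n. ?c t + 2 * sqrt d * (\<Sum>i=1..m. \<xi> i t \<bullet> ?w i t))"
      by (rule sum_mono) (use one_step V n in auto)
    moreover have "(\<Sum>t=1..n. ?V (t + 1) - ?V t + 2 * \<alpha> t * ?\<Phi> t)
        = ?V (n + 1) - ?V 1 + (\<Sum>t=1..n. 2 * \<alpha> t * ?\<Phi> t)"
      using sum_Suc_diff[of 1 n ?V] by (simp add: sum.distrib)
    moreover have "(\<Sum>t=1..n. ?c t) \<le> A"
      using sum_mono2[of "{1..T}" "{1..n}" ?c] c0 n cA by (simp add: subset_iff)
    moreover have "(\<Sum>t=1..n. 2 * sqrt d * (\<Sum>i=1..m. \<xi> i t \<bullet> ?w i t)) \<le> 2 * real m * (sqrt d * u)"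
    proof -
      have "(\<Sum>t=1..n. \<xi> i t \<bullet> ?w i t) \<le> u" if i: "i \<in> {1..m}" for i
        using noise[OF i, of n] n u by (cases "n = 0") auto
      then have "(\<Sum>i=1..m. \<Sum>t=1..n. \<xi> i t \<bullet> ?w i t) \<le> (\<Sum>i=1..m. u)" by (rule sum_mono)
      then have "(\<Sum>t=1..n. \<Sum>i=1..m. \<xi> i t \<bullet> ?w i t) \<le> m * u" by (subst sum.swap) simp
      then have "2 * sqrt d * (\<Sum>t=1..n. \<Sum>i=1..m. \<xi> i t \<bullet> ?w i t) \<le> 2 * sqrt d * (m * u)"
        using d0 by (intro mult_left_mono) auto
      then show ?thesis by (simp add: sum_distrib_left mult_ac)
    qed
    ultimately show ?thesis using budget by (simp add: sum.distrib)
  qed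
  have Vd: "?V (n + 1) \<le> d" if "n \<le> T" for n
    using that
  proof (induction n rule: less_induct)
    case (less n)
    have "?V t \<le> d" if t: "t \<in> {1..n}" for t
      using less.IH[of "t - 1"] t less.prems by auto
    then have "?V (n + 1) + (\<Sum>t=1..n. 2 * \<alpha> t * ?\<Phi> t) \<le> d" by (rule accum[OF less.prems])
    moreover have "0 \<le> (\<Sum>t=1..n. 2 * \<alpha> t * ?\<Phi> t)"
    proof (rule sum_nonneg)
      fix t assume "t \<in> {1..n}"
      then have t: "t \<in> {1..T}" using less.prems by simp
      show "0 \<le> 2 * \<alpha> t * ?\<Phi> t" using \<alpha>[OF t] \<Phi>0[OF t] by simp
    qed
    ultimately show ?case by linarith
  qed
  have "?V t \<le> d" if "t \<in> {1..T}" for t using Vd[of "t - 1"] that by auto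
  then show ?thesis using accum[of T] V0[of "T + 1"] by simp
qed

section \<open>High probability bounds for a run\<close>

context
  fixes m :: nat and N :: "real^'n \<Rightarrow> real" and c :: real and D X :: "(real^'n) set"
    and f :: "nat \<Rightarrow> real^'n \<Rightarrow> real" and p :: "real^'n"
    and W :: "nat \<Rightarrow> nat \<Rightarrow> nat \<Rightarrow> real" and B :: nat and \<eta> G \<theta> \<kappa> :: real and x1 :: "nat \<Rightarrow> real^'n"
    and M :: "'w measure" and F :: "nat \<Rightarrow> 'w measure" and \<alpha> :: "nat \<Rightarrow> real"
    and x g \<xi> :: "nat \<Rightarrow> nat \<Rightarrow> 'w \<Rightarrow> real^'n"
  assumes m: "1 \<le> m"
    and c: "0 < c" "\<And>z. norm z \<le> c * dual_norm N z" "continuous_on UNIV (dual_norm N)"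
    and X: "closed X" "convex X" "X \<subseteq> D"
    and cvx: "\<forall>i\<in>{1..m}. convex_on D (f i)"
    and pX: "p \<in> X" and opt: "\<And>z. z \<in> X \<Longrightarrow> (\<Sum>i=1..m. f i p) \<le> (\<Sum>i=1..m. f i z)"
    and x1: "\<forall>i\<in>{1..m}. x1 i \<in> X"
    and net: "network_assumption m W B \<eta>"
    and sb: "subgradients_bounded m N D X f G"
    and \<theta>: "0 < \<theta>" and \<kappa>: "0 < \<kappa>"
    and run: "dsgd_sw_run m D X f W x1 \<alpha> M F x g \<xi>"
    and noise: "noise_assumption m N \<theta> \<kappa> M F \<xi>"
begin

lemma run_iterate_in:
  assumes i: "i \<in> {1..m}" and t: "1 \<le> t" and \<omega>: "\<omega> \<in> space M"
  shows "x i t \<omega> \<in> X"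
  using t
proof (cases t rule: nat.exhaust)
  case zero
  then show ?thesis using t by simp
next
  case (Suc s)
  show ?thesis
  proof (cases "s = 0")
    case True
    then show ?thesis using Suc run i \<omega> x1 unfolding dsgd_sw_run_def by simp
  next
    case False
    then have "x i (s + 1) \<omega> = closest_point X ((\<Sum>j=1..m. W s i j *\<^sub>R x j s \<omega>) - \<alpha> s *\<^sub>R (g i s \<omega> - \<xi> i s \<omega>))"
      using run i \<omega> unfolding dsgd_sw_run_def by simp
    then show ?thesis using closest_point_in_set[OF X(1)] pX Suc by auto
  qed
qed

lemma run_subgradient:
  assumes "i \<in> {1..m}" "1 \<le> t" "\<omega> \<in> space M"
  shows "g i t \<omega> \<in> subdifferential D (f i) (x i t \<omega>)"
  using run assms unfolding dsgd_sw_run_def by simp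

lemma subgradient_norm_le:
  assumes "i \<in> {1..m}" "z \<in> X" "v \<in> subdifferential D (f i) z"
  shows "norm v \<le> c * G"
proof -
  have "dual_norm N v \<le> G" using sb assms unfolding subgradients_bounded_def by blast
  then have "c * dual_norm N v \<le> c * G" using c(1) by simp
  then show ?thesis using c(2)[of v] by linarith
qed

lemma run_iterate_interior:
  assumes i: "i \<in> {1..m}" and t: "1 \<le> t" and \<omega>: "\<omega> \<in> space M"
  shows "x i t \<omega> \<in> interior D"
proof (rule bounded_subdifferential_imp_interior[where h = "f i" and G = "c * G"])
  show "convex D" using cvx m unfolding convex_on_def by force
  show "x i t \<omega> \<in> D" using run_iterate_in[OF assms] X by blast
  show "g i t \<omega> \<in> subdifferential D (f i) (x i t \<omega>)" by (rule run_subgradient[OF assms])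
  show "norm v \<le> c * G" if "v \<in> subdifferential D (f i) (x i t \<omega>)" for v
    by (rule subgradient_norm_le[OF i run_iterate_in[OF assms] that])
qed

text \<open>Local functions are compared at iterates of different agents, so the subgradient needed here is
not one produced by the run; it exists because the iterate is interior.\<close>

lemma objective_lipschitz:
  assumes i: "i \<in> {1..m}" and z: "z \<in> X" "z \<in> interior D" and y: "y \<in> X"
  shows "f i z - c * G * norm (y - z) \<le> f i y"
proof -
  obtain v where v: "v \<in> subdifferential D (f i) z"
    using subdifferential_nonempty_interior[OF _ z(2)] cvx i by blast
  have "f i z + v \<bullet> (y - z) \<le> f i y" using v y X unfolding subdifferential_def by blast
  moreover have "- (c * G * norm (y - z)) \<le> v \<bullet> (y - z)"
    using Cauchy_Schwarz_ineq2[of v "y - z"]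
      mult_right_mono[OF subgradient_norm_le[OF i z(1) v] norm_ge_zero[of "y - z"]] by linarith
  ultimately show ?thesis by linarith
qed

text \<open>With \<open>r = 2 ln (4 m T / \<delta>)\<close>, each of the \<open>m T\<close> events that a noise vector exceeds the truncation
level has probability at most \<open>\<delta> / (2 m T)\<close>, and \<open>exp (- r / 2)\<close> is so small that the
truncation bias adds only a constant over the whole horizon. The threshold \<open>u\<close> is the one at which
the exponential Markov inequality with parameter \<open>\<beta>\<close> gives the same probability for each partial
noise sum. A union bound over agents and times then leaves an event of probability at least
\<open>1 - \<delta>\<close> on which the pathwise argument applies. The parameter \<open>\<beta>\<close> remains free, because
the two step size rules call for different choices.\<close>

lemma high_probability_descent:
  fixes T :: nat and \<delta> \<beta> :: real and b h r R S A u d :: real and K :: nat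
  assumes T: "1 \<le> T" and \<delta>: "0 < \<delta>" "\<delta> < 1"
    and dec: "\<And>s t. 1 \<le> s \<Longrightarrow> s \<le> t \<Longrightarrow> t \<le> T \<Longrightarrow> \<alpha> t \<le> \<alpha> s" and \<alpha>1: "\<alpha> 1 \<le> 1"
    and b: "b = c * \<kappa>" and h: "h = b * (4 * \<theta>) powr \<theta>" and r: "r = 2 * ln (4 * real m * real T / \<delta>)"
    and \<beta>: "0 < \<beta>" and small: "\<beta> * \<alpha> 1 * b * (1 + r) powr max 0 (\<theta> - 1) \<le> 1 / 2"
    and R: "R = b * r powr \<theta>" and S: "S = (\<Sum>t=1..T. (\<alpha> t)\<^sup>2)" and K: "K = (m + 1) * B"
    and A: "A = 4 * m * (c * G) * (K / \<eta> ^ K * (\<alpha> 1 * spread m x1 + 4 * (c * G + R) * S))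
      + 2 * m * ((c * G)\<^sup>2 + R\<^sup>2) * S"
    and u: "u = (ln (2 * real m * real T / \<delta>) + 4 * h\<^sup>2 * \<beta>\<^sup>2 * S + 2 * h * \<beta>) / \<beta>"
    and d: "d = 2 * (sq_dist_sum m p x1 + A) + 4 * (real m)\<^sup>2 * u\<^sup>2 + 1"
  obtains E where "E \<in> sets M" "1 - \<delta> \<le> measure M E"
    "\<And>\<omega> l. \<omega> \<in> E \<Longrightarrow> l \<in> {1..m} \<Longrightarrow>
      (\<Sum>t=1..T. 2 * \<alpha> t * ((\<Sum>i=1..m. f i (x l t \<omega>)) - (\<Sum>i=1..m. f i p))) \<le> d"
proof -
  have M: "prob_space M" and filt: "filtration (space M) F" and F: "\<And>t. subalgebra M (F t)"
    and \<alpha>: "\<And>t. 1 \<le> t \<Longrightarrow> 0 < \<alpha> t"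
    using run unfolding dsgd_sw_run_def by auto
  interpret prob_space M by (rule M)
  define a where "a = (\<lambda>i t \<omega>. (dual_norm N (\<xi> i t \<omega>) / \<kappa>) powr (1 / \<theta>))"
  define w where "w = (\<lambda>i t \<omega>. \<beta> *\<^sub>R stopped_direction m (W t) (\<alpha> t) p d (\<lambda>j. x j t \<omega>) i)"
  define q where "q = \<delta> / (4 * real m * real T)"
  have mT: "1 \<le> real m * real T" using mult_mono[of 1 "real m" 1 "real T"] m T by simp
  have q: "0 < q" "q \<le> 1 / 4" using \<delta> mT m T by (auto simp: q_def field_simps)
  have r_q: "r = - 2 * ln q" using \<delta> m T by (simp add: r q_def ln_div)
  have r0: "0 \<le> r" using q r_q by (simp add: ln_le_zero_iff)
  have b0: "0 < b" using b c \<kappa> by simp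
  have h0: "0 \<le> h" using h b0 by simp
  have G0: "0 < G" using sb unfolding subgradients_bounded_def by simp
  have eta: "0 < \<eta>" using net unfolding network_assumption_def by simp
  have S0: "0 \<le> S" unfolding S by (rule sum_nonneg) simp
  have R0: "0 \<le> R" unfolding R using b0 by simp
  have ln0: "0 \<le> ln (2 * real m * real T / \<delta>)"
    using \<delta> mT by (intro ln_ge_zero) (simp add: field_simps)
  have u0: "0 \<le> u" unfolding u using ln0 h0 \<beta> S0 by simp
  have \<alpha>_le1: "\<alpha> t \<le> 1" if "t \<in> {1..T}" for t using dec[of 1 t] that \<alpha>1 by simp
  have A0: "0 \<le> A"
    unfolding A using G0 c(1) eta S0 R0 \<alpha>[of 1] spread_nonneg[OF m, of x1]
    by (intro add_nonneg_nonneg mult_nonneg_nonneg) auto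
  have d0: "0 < d"
  proof -
    have "0 \<le> sq_dist_sum m p x1" unfolding sq_dist_sum_def by (intro sum_nonneg) simp
    then show ?thesis unfolding d using A0 by (intro add_nonneg_pos add_nonneg_nonneg) auto
  qed
  have ds: "doubly_stochastic m (W t)" if "1 \<le> t" for t
    using net that unfolding network_assumption_def by simp
  have dual0: "0 \<le> dual_norm N z" for z
    using c(1,2) norm_ge_zero[of z] by (metis mult_pos_neg not_less order_trans)
  have a0: "0 \<le> a i t \<omega>" for i t \<omega> unfolding a_def by simp
  have xi_a: "norm (\<xi> i t \<omega>) \<le> b * a i t \<omega> powr \<theta>" for i t \<omega>
  proof -
    have "a i t \<omega> powr \<theta> = dual_norm N (\<xi> i t \<omega>) / \<kappa>"
      unfolding a_def using \<theta> dual0 \<kappa> by (simp add: powr_powr)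
    then show ?thesis using c(2)[of "\<xi> i t \<omega>"] \<kappa> by (simp add: b)
  qed
  have dn: "dual_norm N \<in> borel_measurable borel" by (rule borel_measurable_continuous_onI[OF c(3)])
  have xi_meas: "\<xi> i t \<in> borel_measurable (F t)" and x_meas: "x i t \<in> borel_measurable (F (t - 1))"
    and xi_int: "integrable M (\<xi> i t)"
    and xi_mean: "AE \<omega> in M. real_cond_exp M (F (t - 1)) (\<lambda>\<omega>. \<xi> i t \<omega> $ k) \<omega> = 0"
    if "i \<in> {1..m}" "t \<in> {1..T}" for i t k
    using run that unfolding dsgd_sw_run_def by auto
  have a_meas: "a i t \<in> borel_measurable (F t)" if "i \<in> {1..m}" "t \<in> {1..T}" for i t
  proof -
    have [measurable]: "(\<lambda>\<omega>. dual_norm N (\<xi> i t \<omega>)) \<in> borel_measurable (F t)"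
      by (rule measurable_compose[OF xi_meas[OF that] dn])
    show ?thesis unfolding a_def by measurable
  qed
  have tail: "AE \<omega> in M. nn_cond_exp M (F (t - 1)) (\<lambda>\<omega>. ennreal (exp (a i t \<omega>))) \<omega> \<le> 2"
    if "i \<in> {1..m}" "t \<in> {1..T}" for i t
    using noise that unfolding noise_assumption_def a_def by simp
  have w_meas: "w i t \<in> borel_measurable (F (t - 1))" if i: "i \<in> {1..m}" and t: "t \<in> {1..T}" for i t
  proof -
    have xj: "x j t \<in> borel_measurable (F (t - 1))" if "j \<in> {1..m}" for j by (rule x_meas[OF that t])
    have [measurable]: "(\<lambda>\<omega>. sq_dist_sum m p (\<lambda>j. x j t \<omega>)) \<in> borel_measurable (F (t - 1))"
      unfolding sq_dist_sum_def
    proof (rule borel_measurable_sum)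
      fix j assume "j \<in> {1..m}"
      note [measurable] = xj[OF this]
      show "(\<lambda>\<omega>. (norm (x j t \<omega> - p))\<^sup>2) \<in> borel_measurable (F (t - 1))" by measurable
    qed
    have [measurable]: "(\<lambda>\<omega>. \<Sum>j=1..m. W t i j *\<^sub>R x j t \<omega>) \<in> borel_measurable (F (t - 1))"
    proof (rule borel_measurable_sum)
      fix j assume "j \<in> {1..m}"
      note [measurable] = xj[OF this]
      show "(\<lambda>\<omega>. W t i j *\<^sub>R x j t \<omega>) \<in> borel_measurable (F (t - 1))" by measurable
    qed
    show ?thesis unfolding w_def stopped_direction_def by measurable
  qed
  have w_norm: "norm (w i t \<omega>) \<le> \<beta> * \<alpha> t" if i: "i \<in> {1..m}" and t: "t \<in> {1..T}" for i t \<omega>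
    using norm_stopped_direction_le[OF ds _ d0 i, of t "\<alpha> t" p "\<lambda>j. x j t \<omega>"] \<alpha>[of t] t \<beta>
    by (simp add: w_def)
  have small_t: "\<beta> * \<alpha> t * b * (1 + r) powr max 0 (\<theta> - 1) \<le> 1 / 2" if t: "t \<in> {1..T}" for t
  proof -
    have "\<beta> * \<alpha> t * b * (1 + r) powr max 0 (\<theta> - 1) \<le> \<beta> * \<alpha> 1 * b * (1 + r) powr max 0 (\<theta> - 1)"
      using dec[of 1 t] t \<beta> b0 by (intro mult_right_mono mult_left_mono) auto
    then show ?thesis using small by linarith
  qed
  have mu0: "0 \<le> \<beta> * \<alpha> t" if "t \<in> {1..T}" for t using \<alpha>[of t] \<beta> that by simp
  define bad where "bad = (\<lambda>(i, n). {\<omega> \<in> space M. r \<le> a i n \<omega>}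
      \<union> {\<omega> \<in> space M. \<beta> * u \<le> truncated_sum r (a i) (\<xi> i) (w i) n \<omega>})"
  let ?I = "{1..m} \<times> {1..T}"
  have two_q: "2 * q = \<delta> / (2 * real m * real T)" by (simp add: q_def)
  have bad1: "prob {\<omega> \<in> space M. r \<le> a i n \<omega>} \<le> 2 * q" if i: "i \<in> {1..m}" and n: "n \<in> {1..T}" for i n
  proof -
    have "prob {\<omega> \<in> space M. r \<le> a i n \<omega>} \<le> 2 * exp (- r)"
      by (rule noise_tail[OF M filt F xi_int[OF i] xi_mean[OF i] xi_meas[OF i] a_meas[OF i] a0 tail[OF i] xi_a
            w_meas[OF i] w_norm[OF i] \<theta> less_imp_le[OF b0] r0 mu0 small_t h n])
    also have "exp (- r) = q * q" using q by (simp add: r_q mult_exp_exp[symmetric] exp_double power2_eq_square)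
    also have "2 * (q * q) \<le> 2 * q" using q by (simp add: mult_left_le)
    finally show ?thesis .
  qed
  have bad2: "prob {\<omega> \<in> space M. \<beta> * u \<le> truncated_sum r (a i) (\<xi> i) (w i) n \<omega>} \<le> 2 * q"
    if i: "i \<in> {1..m}" and n: "n \<in> {1..T}" for i n
  proof -
    have nT: "n \<le> T" using n by simp
    let ?s = "\<Sum>t=1..n. 4 * h\<^sup>2 * (\<beta> * \<alpha> t)\<^sup>2 + 2 * h * (\<beta> * \<alpha> t) * exp (- r / 2)"
    have "prob {\<omega> \<in> space M. \<beta> * u \<le> truncated_sum r (a i) (\<xi> i) (w i) n \<omega>} \<le> exp (?s - \<beta> * u)"
      by (rule truncated_sum_tail[OF M filt F xi_int[OF i] xi_mean[OF i] xi_meas[OF i] a_meas[OF i] a0 tail[OF i] xi_a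
            w_meas[OF i] w_norm[OF i] \<theta> less_imp_le[OF b0] r0 mu0 small_t h nT])
    also have "\<dots> \<le> exp (ln (2 * q))"
    proof -
      have "?s = 4 * h\<^sup>2 * \<beta>\<^sup>2 * (\<Sum>t=1..n. (\<alpha> t)\<^sup>2) + 2 * h * \<beta> * (q * (\<Sum>t=1..n. \<alpha> t))"
      proof -
        have "exp (- r / 2) = q" using q by (simp add: r_q)
        then show ?thesis by (simp add: sum.distrib sum_distrib_left power_mult_distrib mult_ac)
      qed
      also have "\<dots> \<le> 4 * h\<^sup>2 * \<beta>\<^sup>2 * S + 2 * h * \<beta> * 1"
      proof (intro add_mono mult_left_mono)
        show "(\<Sum>t=1..n. (\<alpha> t)\<^sup>2) \<le> S" unfolding S by (rule sum_mono2) (use n in auto)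
        have "(\<Sum>t=1..n. \<alpha> t) \<le> (\<Sum>t=1..n. 1)" by (rule sum_mono) (use \<alpha>_le1 n in auto)
        also have "\<dots> \<le> real T" using n by simp
        finally have "q * (\<Sum>t=1..n. \<alpha> t) \<le> q * real T" using q by (intro mult_left_mono) auto
        also have "\<dots> = \<delta> / (4 * real m)" using T by (simp add: q_def)
        also have "\<dots> \<le> 1" using \<delta> m by (simp add: field_simps)
        finally show "q * (\<Sum>t=1..n. \<alpha> t) \<le> 1" .
      qed (use h0 \<beta> in auto)
      moreover have "\<beta> * u = ln (2 * real m * real T / \<delta>) + 4 * h\<^sup>2 * \<beta>\<^sup>2 * S + 2 * h * \<beta>"
        using \<beta> by (simp add: u)
      moreover have "ln (2 * q) = - ln (2 * real m * real T / \<delta>)"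
        unfolding two_q using \<delta> m T by (simp add: ln_div)
      ultimately show ?thesis by simp
    qed
    finally show ?thesis using q by simp
  qed
  have meas1: "{\<omega> \<in> space M. r \<le> a i n \<omega>} \<in> sets M" if "i \<in> {1..m}" "n \<in> {1..T}" for i n
  proof -
    note [measurable] = measurable_from_subalg[OF F a_meas[OF that]]
    show ?thesis by measurable
  qed
  have meas2: "{\<omega> \<in> space M. \<beta> * u \<le> truncated_sum r (a i) (\<xi> i) (w i) n \<omega>} \<in> sets M"
    if i: "i \<in> {1..m}" and n: "n \<in> {1..T}" for i n
  proof -
    have nT: "n \<le> T" using n by simp
    have "truncated_sum r (a i) (\<xi> i) (w i) n \<in> borel_measurable (F n)"
      by (rule truncated_sum_measurable[OF M filt F xi_int[OF i] xi_mean[OF i] xi_meas[OF i] a_meas[OF i] a0 tail[OF i] xi_a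
            w_meas[OF i] w_norm[OF i] \<theta> less_imp_le[OF b0] r0 mu0 small_t h nT])
    note [measurable] = measurable_from_subalg[OF F this]
    show ?thesis by measurable
  qed
  have bad_sets: "bad z \<in> sets M" if "z \<in> ?I" for z
    using that meas1 meas2 unfolding bad_def by auto
  have bad_prob: "prob (bad z) \<le> 4 * q" if z: "z \<in> ?I" for z
  proof -
    obtain i n where in_: "z = (i, n)" "i \<in> {1..m}" "n \<in> {1..T}" using z by auto
    have "prob (bad z) \<le> prob {\<omega> \<in> space M. r \<le> a i n \<omega>}
        + prob {\<omega> \<in> space M. \<beta> * u \<le> truncated_sum r (a i) (\<xi> i) (w i) n \<omega>}"
      unfolding in_(1) bad_def prod.case
      by (rule measure_Un_le[OF meas1[OF in_(2,3)] meas2[OF in_(2,3)]])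
    then show ?thesis using bad1[OF in_(2,3)] bad2[OF in_(2,3)] by linarith
  qed
  define E where "E = space M - (\<Union>z\<in>?I. bad z)"
  have Bad: "(\<Union>z\<in>?I. bad z) \<in> sets M" using bad_sets by (intro sets.finite_UN) auto
  have "prob (\<Union>z\<in>?I. bad z) \<le> (\<Sum>z\<in>?I. prob (bad z))"
    by (rule finite_measure_subadditive_finite) (use bad_sets in auto)
  also have "\<dots> \<le> (\<Sum>z\<in>?I. 4 * q)" by (rule sum_mono) (rule bad_prob)
  also have "\<dots> = \<delta>" using m T by (simp add: q_def)
  finally have "1 - \<delta> \<le> prob E" unfolding E_def using prob_compl[OF Bad] by simp
  moreover have "E \<in> sets M" unfolding E_def using Bad by blast
  moreover have "(\<Sum>t=1..T. 2 * \<alpha> t * ((\<Sum>i=1..m. f i (x l t \<omega>)) - (\<Sum>i=1..m. f i p))) \<le> d"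
    if \<omega>E: "\<omega> \<in> E" and l: "l \<in> {1..m}" for \<omega> l
  proof -
    have \<omega>: "\<omega> \<in> space M" using \<omega>E unfolding E_def by blast
    have good: "a i n \<omega> < r" "truncated_sum r (a i) (\<xi> i) (w i) n \<omega> < \<beta> * u"
      if "i \<in> {1..m}" "n \<in> {1..T}" for i n
    proof -
      have "\<omega> \<notin> bad (i, n)" using \<omega>E that unfolding E_def by blast
      then show "a i n \<omega> < r" "truncated_sum r (a i) (\<xi> i) (w i) n \<omega> < \<beta> * u"
        using \<omega> unfolding bad_def by auto
    qed
    have x_1: "x i 1 \<omega> = x1 i" if "i \<in> {1..m}" for i using run that \<omega> unfolding dsgd_sw_run_def by simp
    have sp: "spread m (\<lambda>i. x i 1 \<omega>) = spread m x1"
      unfolding spread_def by (rule arg_cong[where f = Max], rule image_cong) (auto simp: x_1 simp del: One_nat_def)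
    have sq: "sq_dist_sum m p (\<lambda>i. x i 1 \<omega>) = sq_dist_sum m p x1"
      unfolding sq_dist_sum_def by (rule sum.cong) (simp_all add: x_1 del: One_nat_def)
    show ?thesis
    proof (rule pathwise_descent[where G = "c * G" and R = R and \<alpha> = \<alpha> and u = u and K = K and A = A and f = f
          and x = "\<lambda>i t. x i t \<omega>" and g = "\<lambda>i t. g i t \<omega>" and \<xi> = "\<lambda>i t. \<xi> i t \<omega>",
          OF m net X pX opt T])
      fix i t assume i: "i \<in> {1..m}" and t: "t \<in> {1..T}"
      then have t1: "1 \<le> t" by simp
      show "x i t \<omega> \<in> X" by (rule run_iterate_in[OF i t1 \<omega>])
      show "g i t \<omega> \<in> subdifferential D (f i) (x i t \<omega>)" by (rule run_subgradient[OF i t1 \<omega>])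
      show "norm (g i t \<omega>) \<le> c * G"
        by (rule subgradient_norm_le[OF i run_iterate_in[OF i t1 \<omega>] run_subgradient[OF i t1 \<omega>]])
      have "b * a i t \<omega> powr \<theta> \<le> R"
        unfolding R using good(1)[OF i t] a0 \<theta> b0 by (intro mult_left_mono powr_mono2) auto
      then show "norm (\<xi> i t \<omega>) \<le> R" using xi_a[of i t \<omega>] by linarith
      show "x i (t + 1) \<omega> = closest_point X ((\<Sum>j=1..m. W t i j *\<^sub>R x j t \<omega>) - \<alpha> t *\<^sub>R (g i t \<omega> - \<xi> i t \<omega>))"
        using run i t1 \<omega> unfolding dsgd_sw_run_def by blast
      show "f i (x l t \<omega>) - c * G * norm (x i t \<omega> - x l t \<omega>) \<le> f i (x i t \<omega>)" if "l \<in> {1..m}" for l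
        by (rule objective_lipschitz[OF i run_iterate_in[OF that t1 \<omega>] run_iterate_interior[OF that t1 \<omega>] run_iterate_in[OF i t1 \<omega>]])
    next
      fix i n assume i: "i \<in> {1..m}" and n: "n \<in> {1..T}"
      let ?v = "\<lambda>t. stopped_direction m (W t) (\<alpha> t) p d (\<lambda>j. x j t \<omega>) i"
      have "truncated_sum r (a i) (\<xi> i) (w i) n \<omega> = (\<Sum>t=1..n. \<beta> * (\<xi> i t \<omega> \<bullet> ?v t))"
        unfolding truncated_sum_def
      proof (rule sum.cong[OF refl])
        fix t assume "t \<in> {1..n}"
        then have "a i t \<omega> \<le> r" using good(1)[OF i, of t] n by simp
        then show "(if a i t \<omega> \<le> r then \<xi> i t \<omega> else 0) \<bullet> w i t \<omega> = \<beta> * (\<xi> i t \<omega> \<bullet> ?v t)"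
          by (simp add: w_def)
      qed
      then have "\<beta> * (\<Sum>t=1..n. \<xi> i t \<omega> \<bullet> ?v t) \<le> \<beta> * u"
        using good(2)[OF i n] by (simp add: sum_distrib_left)
      then show "(\<Sum>t=1..n. \<xi> i t \<omega> \<bullet> ?v t) \<le> u" using \<beta> by simp
    qed (use \<alpha> dec u0 K A d l sp sq S in auto)
  qed
  ultimately show ?thesis using that by blast
qed

lemma average_in:
  assumes "convex S" "\<And>t. t \<in> {1..T} \<Longrightarrow> y t \<omega> \<in> S" "1 \<le> T"
  shows "time_average y T \<omega> \<in> (S :: (real^'n) set)"
proof -
  have "(\<Sum>t=1..T. (1 / real T) *\<^sub>R y t \<omega>) \<in> S"
    by (rule convex_sum) (use assms in auto)
  then show ?thesis by (simp add: time_average_def scaleR_right.sum)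
qed

text \<open>A convex function need not be measurable on the boundary of its domain, but it is continuous on the
interior, where all averages of iterates lie.\<close>

lemma objective_average_measurable:
  assumes l: "l \<in> {1..m}" and T: "1 \<le> T"
  shows "(\<lambda>\<omega>. \<Sum>i=1..m. f i (time_average (x l) T \<omega>)) \<in> borel_measurable M"
proof (rule borel_measurable_sum)
  fix i assume i: "i \<in> {1..m}"
  have conv: "convex_on D (f i)" using cvx i by blast
  then have convD: "convex (interior D)" unfolding convex_on_def by (simp add: convex_interior)
  have F: "\<And>t. subalgebra M (F t)" using run unfolding dsgd_sw_run_def by auto
  have x_meas: "x l t \<in> borel_measurable M" if "t \<in> {1..T}" for t
    by (rule measurable_from_subalg[OF F[of "t - 1"]]) (use run l that in \<open>auto simp: dsgd_sw_run_def\<close>)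
  have avg: "time_average (x l) T \<in> borel_measurable M"
    unfolding time_average_def[abs_def] by (intro borel_measurable_scaleR borel_measurable_sum x_meas) auto
  have "continuous_on (interior D) (f i)"
    by (rule convex_on_continuous[OF open_interior convex_on_subset[OF conv interior_subset convD]])
  then have "(\<lambda>z. indicator (interior D) z *\<^sub>R f i z) \<in> borel_measurable borel"
    by (intro borel_measurable_continuous_on_indicator) auto
  then have ind: "(\<lambda>\<omega>. indicator (interior D) (time_average (x l) T \<omega>) *\<^sub>R f i (time_average (x l) T \<omega>)) \<in> borel_measurable M"
    by (rule measurable_compose[OF avg])
  have eq: "indicator (interior D) (time_average (x l) T \<omega>) *\<^sub>R f i (time_average (x l) T \<omega>)
      = f i (time_average (x l) T \<omega>)" if "\<omega> \<in> space M" for \<omega>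
    using average_in[OF convD _ T, of "x l" \<omega>] run_iterate_interior[OF l _ that] by simp
  show "(\<lambda>\<omega>. f i (time_average (x l) T \<omega>)) \<in> borel_measurable M"
    by (rule measurable_cong[THEN iffD1, OF eq ind])
qed

text \<open>Optimality of \<open>p\<close> makes every summand of the weighted sum nonnegative, so the weights can be
replaced by their lower bound \<open>s\<close> before the uniform average is formed.\<close>

lemma objective_average_gap:
  assumes \<omega>: "\<omega> \<in> space M" and l: "l \<in> {1..m}" and T: "1 \<le> T" and s: "0 < s"
    and step: "\<And>t. t \<in> {1..T} \<Longrightarrow> s \<le> \<alpha> t"
    and gap: "(\<Sum>t=1..T. 2 * \<alpha> t * ((\<Sum>i=1..m. f i (x l t \<omega>)) - (\<Sum>i=1..m. f i p))) \<le> d"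
  shows "(\<Sum>i=1..m. f i (time_average (x l) T \<omega>)) - (\<Sum>i=1..m. f i p) \<le> d / (2 * real T * s)"
proof -
  let ?\<Phi> = "\<lambda>t. (\<Sum>i=1..m. f i (x l t \<omega>)) - (\<Sum>i=1..m. f i p)"
  have xX: "x l t \<omega> \<in> X" if "t \<in> {1..T}" for t using run_iterate_in[OF l _ \<omega>, of t] that by simp
  have jensen: "f i (time_average (x l) T \<omega>) \<le> (\<Sum>t=1..T. (1 / real T) * f i (x l t \<omega>))"
    if i: "i \<in> {1..m}" for i
  proof -
    have "f i (\<Sum>t=1..T. (1 / real T) *\<^sub>R x l t \<omega>) \<le> (\<Sum>t=1..T. (1 / real T) * f i (x l t \<omega>))"
      by (rule convex_on_sum[where C = D]) (use cvx i T xX X(3) in auto)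
    then show ?thesis by (simp add: time_average_def scaleR_right.sum)
  qed
  have "(\<Sum>i=1..m. f i (time_average (x l) T \<omega>)) \<le> (\<Sum>i=1..m. \<Sum>t=1..T. (1 / real T) * f i (x l t \<omega>))"
    by (rule sum_mono) (rule jensen)
  also have "\<dots> = (1 / real T) * (\<Sum>t=1..T. \<Sum>i=1..m. f i (x l t \<omega>))"
    by (subst sum.swap) (simp only: sum_distrib_left)
  also have "(\<Sum>t=1..T. \<Sum>i=1..m. f i (x l t \<omega>)) = (\<Sum>t=1..T. ?\<Phi> t) + real T * (\<Sum>i=1..m. f i p)"
    by (simp add: sum_subtractf)
  finally have avg: "(\<Sum>i=1..m. f i (time_average (x l) T \<omega>)) - (\<Sum>i=1..m. f i p) \<le> (\<Sum>t=1..T. ?\<Phi> t) / real T"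
    using T by (simp add: field_simps)
  have "2 * s * (\<Sum>t=1..T. ?\<Phi> t) = (\<Sum>t=1..T. 2 * s * ?\<Phi> t)" by (simp only: sum_distrib_left)
  also have "\<dots> \<le> (\<Sum>t=1..T. 2 * \<alpha> t * ?\<Phi> t)"
  proof (rule sum_mono)
    fix t assume t: "t \<in> {1..T}"
    show "2 * s * ?\<Phi> t \<le> 2 * \<alpha> t * ?\<Phi> t"
      using step[OF t] opt[OF xX[OF t]] by (intro mult_right_mono) auto
  qed
  finally have "2 * s * (\<Sum>t=1..T. ?\<Phi> t) \<le> d" using gap by linarith
  then have "(\<Sum>t=1..T. ?\<Phi> t) / real T \<le> d / (2 * real T * s)"
    using s T by (simp add: field_simps)
  then show ?thesis using avg by linarith
qed

lemma high_probability_average_gap: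
  assumes E: "E \<in> sets M" "1 - \<delta> \<le> measure M E"
    "\<And>\<omega>. \<omega> \<in> E \<Longrightarrow> (\<Sum>t=1..T. 2 * \<alpha> t * ((\<Sum>i=1..m. f i (x l t \<omega>)) - (\<Sum>i=1..m. f i p))) \<le> d"
    and l: "l \<in> {1..m}" and T: "1 \<le> T" and s: "0 < s"
    and step: "\<And>t. t \<in> {1..T} \<Longrightarrow> s \<le> \<alpha> t" and bound: "d / (2 * real T * s) \<le> C"
  shows "1 - \<delta> \<le> measure M {\<omega> \<in> space M.
    (\<Sum>i=1..m. f i (time_average (x l) T \<omega>)) - (\<Sum>i=1..m. f i p) \<le> C}"
proof -
  have M: "prob_space M" using run unfolding dsgd_sw_run_def by auto
  interpret prob_space M by (rule M)
  note [measurable] = objective_average_measurable[OF l T]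
  have "measure M E \<le> measure M {\<omega> \<in> space M.
      (\<Sum>i=1..m. f i (time_average (x l) T \<omega>)) - (\<Sum>i=1..m. f i p) \<le> C}"
  proof (rule finite_measure_mono)
    show "E \<subseteq> {\<omega> \<in> space M. (\<Sum>i=1..m. f i (time_average (x l) T \<omega>)) - (\<Sum>i=1..m. f i p) \<le> C}"
    proof
      fix \<omega> assume o: "\<omega> \<in> E"
      then have \<omega>: "\<omega> \<in> space M" using E(1) sets.sets_into_space by blast
      show "\<omega> \<in> {\<omega> \<in> space M. (\<Sum>i=1..m. f i (time_average (x l) T \<omega>)) - (\<Sum>i=1..m. f i p) \<le> C}"
        using objective_average_gap[OF \<omega> l T s step E(3)[OF o]] bound \<omega> by simp
    qed
  qed measurable
  then show ?thesis using E(2) by linarith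
qed

end

section \<open>Rates\<close>

lemma power2_sum3_le:
  fixes a b c :: real
  shows "(a + b + c)\<^sup>2 \<le> 3 * (a\<^sup>2 + b\<^sup>2 + c\<^sup>2)"
proof -
  have "0 \<le> (a - b)\<^sup>2 + (b - c)\<^sup>2 + (a - c)\<^sup>2" by simp
  then show ?thesis by (simp add: power2_eq_square algebra_simps)
qed

text \<open>The largest admissible \<open>\<beta>\<close> is of order \<open>\<Lambda> powr (- \<rho>)\<close> divided by the first step size, where
\<open>\<Lambda> = ln (T / \<delta>)\<close>. The factor \<open>\<tau>\<close> is the part of that slack that is used: \<open>u\<close> consists of a
term decreasing in \<open>\<tau>\<close> and one increasing in it. Here \<open>e\<close> and \<open>v\<close> are the initial spread and
energy, \<open>s\<close> the first step size and \<open>S\<close> the sum of squared step sizes.\<close>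

lemma descent_budget_bound:
  fixes m K :: nat and G b h \<theta> \<eta> e v :: real
  defines "\<rho> \<equiv> max 0 (\<theta> - 1)"
  assumes m: "1 \<le> m" and G: "0 \<le> G" and b: "0 < b" and h: "0 \<le> h" and \<theta>: "0 < \<theta>" and \<eta>: "0 < \<eta>"
    and e: "0 \<le> e" and v: "0 \<le> v"
  obtains \<beta>\<^sub>0 C where "0 < \<beta>\<^sub>0" "0 < C"
    "\<And>(T::nat) \<delta> \<tau> s S r R A \<beta> u.
       10 \<le> T \<Longrightarrow> 0 < \<delta> \<Longrightarrow> \<delta> < 1 \<Longrightarrow> 1 \<le> \<tau> \<Longrightarrow> 0 < s \<Longrightarrow> s * \<tau> \<le> 1 \<Longrightarrow> 0 \<le> S \<Longrightarrow>
       r = 2 * ln (4 * real m * real T / \<delta>) \<Longrightarrow> R = b * r powr \<theta> \<Longrightarrow>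
       A = 4 * m * G * (K / \<eta> ^ K * (s * e + 4 * (G + R) * S)) + 2 * m * (G\<^sup>2 + R\<^sup>2) * S \<Longrightarrow>
       \<beta> = \<beta>\<^sub>0 * \<tau> / ln (real T / \<delta>) powr \<rho> \<Longrightarrow>
       u = (ln (2 * real m * real T / \<delta>) + 4 * h\<^sup>2 * \<beta>\<^sup>2 * S + 2 * h * \<beta>) / \<beta> \<Longrightarrow>
       \<beta> * s * b * (1 + r) powr \<rho> \<le> 1 / 2 \<and>
       2 * (v + A) + 4 * (real m)\<^sup>2 * u\<^sup>2 + 1
         \<le> C * (ln (real T / \<delta>) powr (2 * \<theta>) * (1 + S)
              + ln (real T / \<delta>) powr (2 + 2 * \<rho>) / \<tau>\<^sup>2 + \<tau>\<^sup>2 * S\<^sup>2)"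
proof -
  \<comment> \<open>\<open>c1 * \<Lambda>\<close> dominates the truncation level \<open>r\<close>, and \<open>\<beta>\<^sub>0\<close> is the largest constant that keeps \<open>\<beta>\<close> admissible for it.\<close>
  define c1 where "c1 = 2 * (ln (4 * real m) + 1)"
  define \<beta>\<^sub>0 where "\<beta>\<^sub>0 = 1 / (2 * b * (1 + c1) powr \<rho>)"
  define R1 where "R1 = b * c1 powr \<theta>"
  define CA where "CA = 4 * m * G * (K / \<eta> ^ K * (e + 4 * (G + R1))) + 2 * m * (G\<^sup>2 + R1\<^sup>2)"
  define CU where "CU = c1 / \<beta>\<^sub>0 + 4 * h\<^sup>2 * \<beta>\<^sub>0 + 2 * h"
  define C where "C = 2 * (v + CA) + 1 + 12 * (real m)\<^sup>2 * CU\<^sup>2"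
  have c1: "2 \<le> c1" unfolding c1_def using m by simp
  have \<beta>0: "0 < \<beta>\<^sub>0" unfolding \<beta>\<^sub>0_def using b c1 by simp
  have R1: "0 \<le> R1" unfolding R1_def using b by simp
  have CA: "0 \<le> CA" unfolding CA_def using G R1 e \<eta> by (intro add_nonneg_nonneg mult_nonneg_nonneg) auto
  have CU: "0 \<le> CU" unfolding CU_def using c1 \<beta>0 h by (intro add_nonneg_nonneg mult_nonneg_nonneg) auto
  have "0 < 2 * (v + CA) + 1" using v CA by simp
  then have C: "0 < C" unfolding C_def by (rule add_pos_nonneg) simp
  have \<rho>: "0 \<le> \<rho>" unfolding \<rho>_def by simp
  have main: "\<beta> * s * b * (1 + r) powr \<rho> \<le> 1 / 2 \<and>
       2 * (v + A) + 4 * (real m)\<^sup>2 * u\<^sup>2 + 1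
         \<le> C * (ln (real T / \<delta>) powr (2 * \<theta>) * (1 + S)
              + ln (real T / \<delta>) powr (2 + 2 * \<rho>) / \<tau>\<^sup>2 + \<tau>\<^sup>2 * S\<^sup>2)"
    if T: "10 \<le> T" and \<delta>: "0 < \<delta>" "\<delta> < 1" and \<tau>: "1 \<le> \<tau>" and s: "0 < s" "s * \<tau> \<le> 1" and S: "0 \<le> S"
      and r: "r = 2 * ln (4 * real m * real T / \<delta>)" and R: "R = b * r powr \<theta>"
      and A: "A = 4 * m * G * (K / \<eta> ^ K * (s * e + 4 * (G + R) * S)) + 2 * m * (G\<^sup>2 + R\<^sup>2) * S"
      and \<beta>: "\<beta> = \<beta>\<^sub>0 * \<tau> / ln (real T / \<delta>) powr \<rho>"
      and u: "u = (ln (2 * real m * real T / \<delta>) + 4 * h\<^sup>2 * \<beta>\<^sup>2 * S + 2 * h * \<beta>) / \<beta>"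
    for T :: nat and \<delta> \<tau> s S r R A \<beta> u :: real
  proof -
    define \<Lambda> where "\<Lambda> = ln (real T / \<delta>)"
    define Q where "Q = \<Lambda> powr (2 * \<theta>)"
    define P where "P = \<Lambda> powr \<rho>"
    have \<Lambda>: "1 \<le> \<Lambda>"
    proof -
      have "exp 1 \<le> real T / \<delta>"
      proof -
        have "exp 1 \<le> (3::real)" by (rule exp_le)
        also have "3 \<le> real T / 1" using T by simp
        also have "\<dots> \<le> real T / \<delta>" using \<delta> T by (intro divide_left_mono) auto
        finally show ?thesis .
      qed
      then show ?thesis unfolding \<Lambda>_def using \<delta> T by (simp add: ln_ge_iff)
    qed
    have square_powr: "(\<Lambda> powr a)\<^sup>2 = \<Lambda> powr (2 * a)" for a
      by (simp add: power2_eq_square powr_add[symmetric])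
    have "s * 1 \<le> s * \<tau>" using \<tau> s by (intro mult_left_mono) auto
    then have s1: "s \<le> 1" using s by linarith
    have Q1: "1 \<le> Q" unfolding Q_def using \<Lambda> \<theta> by (simp add: ge_one_powr_ge_zero)
    have P1: "1 \<le> P" unfolding P_def using \<Lambda> \<rho> by (simp add: ge_one_powr_ge_zero)
    have r_eq: "r = 2 * (ln (4 * real m) + \<Lambda>)"
      unfolding r \<Lambda>_def using m T \<delta> by (simp add: ln_mult ln_div)
    have "0 \<le> ln (4 * real m)" using m by simp
    then have r_le: "r \<le> c1 * \<Lambda>" and r0: "0 \<le> r"
      unfolding r_eq c1_def using \<Lambda> mult_left_mono[OF \<Lambda>, of "ln (4 * real m)"] by (auto simp: algebra_simps)
    have R_le: "R \<le> R1 * \<Lambda> powr \<theta>"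
    proof -
      have "r powr \<theta> \<le> (c1 * \<Lambda>) powr \<theta>" using r0 r_le \<theta> by (intro powr_mono2) auto
      also have "\<dots> = c1 powr \<theta> * \<Lambda> powr \<theta>" using c1 \<Lambda> by (simp add: powr_mult)
      finally show ?thesis unfolding R R1_def using b by simp
    qed
    have R0: "0 \<le> R" unfolding R using b by simp
    have "\<Lambda> powr \<theta> \<le> Q" unfolding Q_def using \<Lambda> \<theta> by (intro powr_mono) auto
    then have R_Q: "R \<le> R1 * Q" using R_le mult_left_mono[of "\<Lambda> powr \<theta>" Q R1] R1 by linarith
    have R2_Q: "R\<^sup>2 \<le> R1\<^sup>2 * Q"
    proof -
      have "R\<^sup>2 \<le> (R1 * \<Lambda> powr \<theta>)\<^sup>2" by (rule power_mono[OF R_le R0])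
      also have "\<dots> = R1\<^sup>2 * Q" unfolding Q_def power_mult_distrib square_powr ..
      finally show ?thesis .
    qed
    have QS: "1 \<le> Q * (1 + S)" using mult_mono[OF Q1, of 1 "1 + S"] S Q1 by simp
    have G_Q: "G \<le> G * Q" "G\<^sup>2 \<le> G\<^sup>2 * Q" "e \<le> e * Q" "s * e \<le> e"
      using mult_left_mono[OF Q1 G] mult_left_mono[OF Q1, of "G\<^sup>2"] mult_left_mono[OF Q1 e]
        mult_right_mono[OF s1 e] by simp_all
    have "A \<le> CA * (Q * (1 + S))"
    proof -
      have i1: "s * e + 4 * (G + R) * S \<le> (e + 4 * (G + R1)) * (Q * (1 + S))"
      proof -
        have "s * e \<le> e * (Q * (1 + S))"
          using G_Q(4) mult_left_mono[OF QS, of e] e by linarith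
        moreover have "(G + R) * S \<le> (G + R1) * Q * (1 + S)"
          using G_Q(1) R_Q S G R1 R0 Q1 by (intro mult_mono) (auto simp: distrib_right)
        ultimately show ?thesis by (simp add: algebra_simps)
      qed
      have i2: "(G\<^sup>2 + R\<^sup>2) * S \<le> (G\<^sup>2 + R1\<^sup>2) * Q * (1 + S)"
        using G_Q(2) R2_Q S Q1 by (intro mult_mono) (auto simp: distrib_right)
      have "4 * m * G * (K / \<eta> ^ K * (s * e + 4 * (G + R) * S))
          \<le> 4 * m * G * (K / \<eta> ^ K * ((e + 4 * (G + R1)) * (Q * (1 + S))))"
        using i1 G \<eta> by (intro mult_left_mono) auto
      moreover have "2 * m * ((G\<^sup>2 + R\<^sup>2) * S) \<le> 2 * m * ((G\<^sup>2 + R1\<^sup>2) * Q * (1 + S))"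
        using i2 by (intro mult_left_mono) auto
      ultimately have "A \<le> 4 * m * G * (K / \<eta> ^ K * ((e + 4 * (G + R1)) * (Q * (1 + S))))
          + 2 * m * ((G\<^sup>2 + R1\<^sup>2) * Q * (1 + S))"
        unfolding A by (simp only: mult.assoc)
      also have "\<dots> = CA * (Q * (1 + S))" unfolding CA_def by (simp only: distrib_right mult.assoc)
      finally show ?thesis .
    qed
    moreover have "v \<le> v * (Q * (1 + S))" using mult_left_mono[OF QS v] by simp
    ultimately have first: "2 * (v + A) + 1 \<le> (2 * (v + CA) + 1) * (Q * (1 + S))"
      using QS by (simp add: algebra_simps)
    have \<beta>_P: "\<beta> = \<beta>\<^sub>0 * \<tau> / P" unfolding \<beta> P_def \<Lambda>_def ..
    have \<beta>_pos: "0 < \<beta>" unfolding \<beta>_P using \<beta>0 \<tau> P1 by simp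
    have \<beta>_le: "\<beta> \<le> \<beta>\<^sub>0 * \<tau>"
      unfolding \<beta>_P using \<beta>0 \<tau> P1 divide_left_mono[OF P1, of "\<beta>\<^sub>0 * \<tau>"] by simp
    have small: "\<beta> * s * b * (1 + r) powr \<rho> \<le> 1 / 2"
    proof -
      have "1 + r \<le> (1 + c1) * \<Lambda>" using r_le \<Lambda> by (simp add: distrib_right)
      then have "(1 + r) powr \<rho> \<le> ((1 + c1) * \<Lambda>) powr \<rho>" using r0 \<rho> by (intro powr_mono2) auto
      also have "\<dots> = (1 + c1) powr \<rho> * P" unfolding P_def using c1 \<Lambda> by (simp add: powr_mult)
      finally have "\<beta> * s * b * (1 + r) powr \<rho> \<le> \<beta> * s * b * ((1 + c1) powr \<rho> * P)"
        using \<beta>_pos s b by (intro mult_left_mono) auto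
      also have "\<dots> = s * \<tau> / 2"
        unfolding \<beta>_P \<beta>\<^sub>0_def using b c1 P1 by (simp add: field_simps)
      also have "\<dots> \<le> 1 / 2" using s(2) by simp
      finally show ?thesis .
    qed
    have u_eq: "u = ln (2 * real m * real T / \<delta>) / \<beta> + 4 * h\<^sup>2 * S * \<beta> + 2 * h"
      unfolding u using \<beta>_pos by (simp add: field_simps power2_eq_square)
    have ln_le: "ln (2 * real m * real T / \<delta>) \<le> c1 * \<Lambda>"
    proof -
      have "ln (2 * real m * real T / \<delta>) \<le> ln (4 * real m * real T / \<delta>)"
        using m T \<delta> by (subst ln_le_cancel_iff) (auto intro!: divide_right_mono)
      also have "\<dots> \<le> r" using r0 r by simp
      finally show ?thesis using r_le by simp
    qed
    have ln_nn: "0 \<le> ln (2 * real m * real T / \<delta>)"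
    proof (rule ln_ge_zero)
      have "1 * 1 \<le> (2 * real m) * real T" using m T by (intro mult_mono) auto
      then show "1 \<le> 2 * real m * real T / \<delta>" using \<delta> by (simp add: pos_le_divide_eq)
    qed
    have "u \<le> CU * (\<Lambda> * P / \<tau>) + CU * (\<tau> * S) + CU * 1"
    proof -
      have "ln (2 * real m * real T / \<delta>) / \<beta> \<le> c1 * \<Lambda> / \<beta>" using ln_le \<beta>_pos by (intro divide_right_mono) auto
      also have "\<dots> = c1 / \<beta>\<^sub>0 * (\<Lambda> * P / \<tau>)" unfolding \<beta>_P using \<beta>0 \<tau> P1 by (simp add: field_simps)
      also have "\<dots> \<le> CU * (\<Lambda> * P / \<tau>)"
        unfolding CU_def using \<Lambda> P1 \<tau> \<beta>0 h by (intro mult_right_mono) auto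
      finally have 1: "ln (2 * real m * real T / \<delta>) / \<beta> \<le> CU * (\<Lambda> * P / \<tau>)" .
      have "4 * h\<^sup>2 * S * \<beta> \<le> 4 * h\<^sup>2 * S * (\<beta>\<^sub>0 * \<tau>)" using \<beta>_le S by (intro mult_left_mono) auto
      also have "\<dots> = 4 * h\<^sup>2 * \<beta>\<^sub>0 * (\<tau> * S)" by simp
      also have "\<dots> \<le> CU * (\<tau> * S)"
        unfolding CU_def using \<tau> S c1 \<beta>0 h by (intro mult_right_mono) auto
      finally have 2: "4 * h\<^sup>2 * S * \<beta> \<le> CU * (\<tau> * S)" .
      have 3: "2 * h \<le> CU * 1" unfolding CU_def using c1 \<beta>0 by simp
      show ?thesis unfolding u_eq using 1 2 3 by linarith
    qed
    moreover have "0 \<le> u" unfolding u_eq using ln_nn \<beta>_pos h S by simp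
    ultimately have "u\<^sup>2 \<le> (CU * (\<Lambda> * P / \<tau>) + CU * (\<tau> * S) + CU * 1)\<^sup>2" by (rule power_mono)
    also have "\<dots> \<le> 3 * ((CU * (\<Lambda> * P / \<tau>))\<^sup>2 + (CU * (\<tau> * S))\<^sup>2 + (CU * 1)\<^sup>2)" by (rule power2_sum3_le)
    also have "\<dots> = 3 * CU\<^sup>2 * ((\<Lambda> * P / \<tau>)\<^sup>2 + (\<tau> * S)\<^sup>2 + 1)"
      by (simp only: power_mult_distrib[of CU] distrib_left mult.assoc power_one mult_1_right)
    also have "(\<Lambda> * P / \<tau>)\<^sup>2 = \<Lambda> powr (2 + 2 * \<rho>) / \<tau>\<^sup>2"
      unfolding P_def power_divide power_mult_distrib square_powr using \<Lambda> by (simp add: powr_add)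
    also have "(\<tau> * S)\<^sup>2 = \<tau>\<^sup>2 * S\<^sup>2" by (rule power_mult_distrib)
    finally have u2: "u\<^sup>2 \<le> 3 * CU\<^sup>2 * (\<Lambda> powr (2 + 2 * \<rho>) / \<tau>\<^sup>2 + \<tau>\<^sup>2 * S\<^sup>2 + 1)" .
    let ?Z = "\<Lambda> powr (2 + 2 * \<rho>) / \<tau>\<^sup>2 + \<tau>\<^sup>2 * S\<^sup>2"
    have Z0: "0 \<le> ?Z" by simp
    have "4 * (real m)\<^sup>2 * u\<^sup>2 \<le> 4 * (real m)\<^sup>2 * (3 * CU\<^sup>2 * (?Z + Q * (1 + S)))"
    proof (rule mult_left_mono)
      have "3 * CU\<^sup>2 * (?Z + 1) \<le> 3 * CU\<^sup>2 * (?Z + Q * (1 + S))" using QS by (intro mult_left_mono) auto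
      then show "u\<^sup>2 \<le> 3 * CU\<^sup>2 * (?Z + Q * (1 + S))" using u2 by linarith
    qed simp
    also have "\<dots> = 12 * (real m)\<^sup>2 * CU\<^sup>2 * (Q * (1 + S) + ?Z)" by simp
    finally have second: "4 * (real m)\<^sup>2 * u\<^sup>2 \<le> 12 * (real m)\<^sup>2 * CU\<^sup>2 * (Q * (1 + S) + ?Z)" .
    have "(2 * (v + CA) + 1) * (Q * (1 + S)) \<le> (2 * (v + CA) + 1) * (Q * (1 + S) + ?Z)"
      using Z0 v CA by (intro mult_left_mono) auto
    then have "(2 * (v + A) + 1) + 4 * (real m)\<^sup>2 * u\<^sup>2
        \<le> (2 * (v + CA) + 1) * (Q * (1 + S) + ?Z) + 12 * (real m)\<^sup>2 * CU\<^sup>2 * (Q * (1 + S) + ?Z)"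
      using first by (intro add_mono[OF _ second]) (rule order_trans)
    also have "\<dots> = C * (Q * (1 + S) + ?Z)" unfolding C_def by (simp only: distrib_right)
    finally have "2 * (v + A) + 4 * (real m)\<^sup>2 * u\<^sup>2 + 1 \<le> C * (Q * (1 + S) + ?Z)"
      by (simp only: add.assoc add.commute[of 1])
    then show ?thesis using small unfolding Q_def \<Lambda>_def by (simp add: add.assoc)
  qed
  show ?thesis by (rule that[OF \<beta>0 C]) (rule main)
qed

lemma sum_inverse_Suc_le_ln: "(\<Sum>t=1..T. 1 / (real t + 1)) \<le> ln (real T + 1)"
proof (induction T)
  case 0
  then show ?case by simp
next
  case (Suc T)
  have "1 / (real (Suc T) + 1) \<le> ln ((real T + 2) / (real T + 1))"
  proof -
    have "ln ((real T + 1) / (real T + 2)) \<le> (real T + 1) / (real T + 2) - 1"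
      by (rule ln_le_minus_one) simp
    also have "\<dots> = - (1 / (real (Suc T) + 1))" by (simp add: field_simps)
    finally show ?thesis by (simp add: ln_div)
  qed
  also have "\<dots> = ln (real (Suc T) + 1) - ln (real T + 1)" by (simp add: ln_div)
  finally show ?case using Suc.IH by simp
qed

lemma log_decomposition:
  fixes T :: nat and \<delta> :: real
  assumes "10 \<le> T" "0 < \<delta>" "\<delta> < 1"
  shows "1 \<le> ln (real T)" "0 \<le> ln (1 / \<delta>)" "ln (real T / \<delta>) = ln (real T) + ln (1 / \<delta>)"
proof -
  have "exp 1 \<le> (3::real)" by (rule exp_le)
  then have "exp 1 \<le> real T" using assms by simp
  then show "1 \<le> ln (real T)" using assms by (simp add: ln_ge_iff)
  show "0 \<le> ln (1 / \<delta>)" using assms by (intro ln_ge_zero) simp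
  show "ln (real T / \<delta>) = ln (real T) + ln (1 / \<delta>)" using assms by (simp add: ln_div)
qed

text \<open>The union bound over time produced \<open>ln (T / \<delta>)\<close> where the rate asks for \<open>ln (1 / \<delta>)\<close>. Since
\<open>ln (T / \<delta>)\<close> is the sum of \<open>ln T\<close> and \<open>ln (1 / \<delta>)\<close>, its square splits into the second
term of the rate and a multiple of \<open>(ln T)\<^sup>2\<close>, which the first term absorbs.\<close>

lemma decreasing_step_rate:
  fixes T :: nat and \<delta> \<theta> S :: real
  defines "\<Lambda> \<equiv> ln (real T / \<delta>)" and "\<rho> \<equiv> max 0 (\<theta> - 1)"
  assumes T: "10 \<le> T" and \<delta>: "0 < \<delta>" "\<delta> < 1" and \<theta>: "1 / 2 \<le> \<theta>" and S: "0 \<le> S" "S \<le> 2 * ln (real T)"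
  shows "\<Lambda> powr (2 * \<theta>) * (1 + S) + \<Lambda> powr (2 + 2 * \<rho>) + S\<^sup>2
    \<le> 9 * (\<Lambda> powr (2 * \<theta>) * (ln (real T))\<^sup>2 + (ln (1 / \<delta>))\<^sup>2 * \<Lambda> powr (2 * \<rho>))"
proof -
  define L l where "L = ln (real T)" and "l = ln (1 / \<delta>)"
  have L: "1 \<le> L" and l: "0 \<le> l" and \<Lambda>: "\<Lambda> = L + l"
    unfolding L_def l_def \<Lambda>_def using log_decomposition[OF T \<delta>] by auto
  have \<Lambda>1: "1 \<le> \<Lambda>" using L l \<Lambda> by simp
  define Q P where "Q = \<Lambda> powr (2 * \<theta>)" and "P = \<Lambda> powr (2 * \<rho>)"
  have Q1: "1 \<le> Q" unfolding Q_def using \<Lambda>1 \<theta> by (simp add: ge_one_powr_ge_zero)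
  have P0: "0 \<le> P" unfolding P_def by simp
  have PQ: "P \<le> Q" unfolding P_def Q_def using \<Lambda>1 \<theta> by (intro powr_mono) (auto simp: \<rho>_def)
  have "L * 1 \<le> L * L" using L by (intro mult_left_mono) auto
  then have LL: "L \<le> L\<^sup>2" "1 \<le> L\<^sup>2" using L unfolding power2_eq_square by linarith+
  have 1: "Q * (1 + S) \<le> Q * (3 * L\<^sup>2)"
    using S LL Q1 by (intro mult_left_mono) (auto simp: L_def)
  have "(L + l)\<^sup>2 \<le> 2 * L\<^sup>2 + 2 * l\<^sup>2"
    using zero_le_power2[of "L - l"] by (simp add: power2_sum power2_diff)
  then have "\<Lambda>\<^sup>2 * P \<le> (2 * L\<^sup>2 + 2 * l\<^sup>2) * P" unfolding \<Lambda> using P0 by (rule mult_right_mono)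
  moreover have "2 * L\<^sup>2 * P \<le> 2 * L\<^sup>2 * Q" using PQ by (intro mult_left_mono) auto
  moreover have "\<Lambda> powr (2 + 2 * \<rho>) = \<Lambda>\<^sup>2 * P" unfolding P_def using \<Lambda>1 by (simp add: powr_add)
  ultimately have 2: "\<Lambda> powr (2 + 2 * \<rho>) \<le> 2 * (Q * L\<^sup>2) + 2 * (l\<^sup>2 * P)" by (simp add: algebra_simps)
  have "S\<^sup>2 \<le> (2 * L)\<^sup>2" using S by (intro power_mono) (auto simp: L_def)
  also have "\<dots> = 4 * (1 * L\<^sup>2)" by (simp add: power_mult_distrib)
  also have "\<dots> \<le> 4 * (Q * L\<^sup>2)" using Q1 by (intro mult_left_mono mult_right_mono) auto
  finally have 3: "S\<^sup>2 \<le> 4 * (Q * L\<^sup>2)" .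
  have "0 \<le> l\<^sup>2 * P" using P0 by simp
  then show ?thesis
    using 1 2 3 unfolding Q_def[symmetric] P_def[symmetric] L_def[symmetric] l_def[symmetric] by simp
qed

text \<open>The division by \<open>ln T\<close>, obtained from the choice \<open>\<tau> = \<surd>(ln T)\<close>, is what makes \<open>\<theta> < 1\<close> work:
without it a summand \<open>(ln T)\<^sup>2\<close> would remain, which exceeds \<open>ln (T / \<delta>) powr (2 * \<theta>)\<close> when
\<open>\<delta>\<close> is fixed and \<open>T\<close> is large.\<close>

lemma constant_step_rate:
  fixes T :: nat and \<delta> \<theta> :: real
  defines "\<Lambda> \<equiv> ln (real T / \<delta>)" and "\<rho> \<equiv> max 0 (\<theta> - 1)"
  assumes T: "10 \<le> T" and \<delta>: "0 < \<delta>" "\<delta> < 1" and \<theta>: "1 / 2 \<le> \<theta>"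
  shows "\<Lambda> powr (2 * \<theta>) * 2 + \<Lambda> powr (2 + 2 * \<rho>) / ln (real T) + ln (real T)
    \<le> 5 * (if \<theta> < 1 then \<Lambda> powr (2 * \<theta>) + (ln (1 / \<delta>))\<^sup>2 else \<Lambda> powr (2 * \<theta>))"
proof -
  define L l where "L = ln (real T)" and "l = ln (1 / \<delta>)"
  have L: "1 \<le> L" and l: "0 \<le> l" and \<Lambda>: "\<Lambda> = L + l"
    unfolding L_def l_def \<Lambda>_def using log_decomposition[OF T \<delta>] by auto
  have \<Lambda>1: "1 \<le> \<Lambda>" using L l \<Lambda> by simp
  define Q where "Q = \<Lambda> powr (2 * \<theta>)"
  have "\<Lambda> powr 1 \<le> Q" unfolding Q_def using \<Lambda>1 \<theta> by (intro powr_mono) auto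
  then have LQ: "L \<le> Q" using \<Lambda>1 \<Lambda> l by simp
  show ?thesis
  proof (cases "\<theta> < 1")
    case True
    have "(L + l)\<^sup>2 \<le> 2 * L\<^sup>2 + 2 * l\<^sup>2"
      using zero_le_power2[of "L - l"] by (simp add: power2_sum power2_diff)
    also have "2 * L\<^sup>2 + 2 * l\<^sup>2 \<le> (2 * L + 2 * l\<^sup>2) * L"
      using mult_left_mono[OF L, of "2 * l\<^sup>2"] by (simp add: power2_eq_square algebra_simps)
    finally have "\<Lambda>\<^sup>2 / L \<le> 2 * L + 2 * l\<^sup>2" unfolding \<Lambda> using L by (simp add: pos_divide_le_eq)
    moreover have "\<Lambda> powr (2 + 2 * \<rho>) = \<Lambda>\<^sup>2" using True \<Lambda>1 by (simp add: \<rho>_def)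
    ultimately have "\<Lambda> powr (2 + 2 * \<rho>) / L \<le> 2 * L + 2 * l\<^sup>2" by (simp only:)
    moreover have "0 \<le> l\<^sup>2" by simp
    ultimately have "Q * 2 + \<Lambda> powr (2 + 2 * \<rho>) / L + L \<le> 5 * Q + 5 * l\<^sup>2" using LQ by linarith
    then have "Q * 2 + \<Lambda> powr (2 + 2 * \<rho>) / L + L \<le> 5 * (Q + l\<^sup>2)" by (simp only: distrib_left)
    then show ?thesis using True unfolding Q_def[symmetric] L_def[symmetric] l_def[symmetric] by simp
  next
    case False
    have "\<Lambda> powr (2 + 2 * \<rho>) = Q" using False unfolding Q_def \<rho>_def by (simp add: max_def)
    moreover have "Q / L \<le> Q / 1" using L by (intro divide_left_mono) (auto simp: Q_def)
    moreover have "0 \<le> Q" by (simp add: Q_def)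
    ultimately have "Q * 2 + \<Lambda> powr (2 + 2 * \<rho>) / L + L \<le> 5 * Q" using LQ by simp
    then show ?thesis using False unfolding Q_def[symmetric] L_def[symmetric] l_def[symmetric] by simp
  qed
qed

theorem corollary1:
  fixes m :: nat
    and N :: "real^'n \<Rightarrow> real"
    and D X :: "(real^'n) set"
    and f :: "nat \<Rightarrow> real^'n \<Rightarrow> real"
    and xs :: "real^'n"
    and W :: "nat \<Rightarrow> nat \<Rightarrow> nat \<Rightarrow> real"
    and B :: nat
    and \<eta> G \<theta> \<kappa> :: real
    and x1 :: "nat \<Rightarrow> real^'n"
  defines "ftot \<equiv> \<lambda>x. \<Sum>i=1..m. f i x"
  assumes "1 \<le> m"
    and "is_norm N"
    and "closed X" and "convex X" and "X \<subseteq> D"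
    and "\<forall>i\<in>{1..m}. convex_on D (f i)"
    and "xs \<in> X" and "\<forall>x\<in>X. ftot xs \<le> ftot x"
    and "\<forall>i\<in>{1..m}. x1 i \<in> X"
    and "network_assumption m W B \<eta>"
    and "subgradients_bounded m N D X f G"
    and "1 / 2 \<le> \<theta>" and "0 < \<kappa>"
  shows
    "(\<exists>C>0. \<forall>(M :: 'w measure) F \<alpha> x g \<xi>.
        dsgd_sw_run m D X f W x1 \<alpha> M F x g \<xi> \<longrightarrow>
        noise_assumption m N \<theta> \<kappa> M F \<xi> \<longrightarrow>
        (\<forall>t\<ge>1. \<alpha> t = 1 / sqrt (real t + 1)) \<longrightarrow>
        (\<forall>T\<ge>10. \<forall>l\<in>{1..m}. \<forall>\<delta>. 0 < \<delta> \<and> \<delta> < 1 \<longrightarrow>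
           measure M {\<omega> \<in> space M. ftot (time_average (x l) T \<omega>) - ftot xs \<le>
             C * (ln (real T / \<delta>) powr (2 * \<theta>) * (ln (real T))\<^sup>2 / sqrt (real T)
                + (ln (1 / \<delta>))\<^sup>2 * ln (real T / \<delta>) powr (2 * max 0 (\<theta> - 1)) / sqrt (real T))}
           \<ge> 1 - \<delta>))
   \<and>
     (\<exists>C>0. \<forall>T\<ge>10. \<forall>(M :: 'w measure) F \<alpha> x g \<xi>.
        dsgd_sw_run m D X f W x1 \<alpha> M F x g \<xi> \<longrightarrow>
        noise_assumption m N \<theta> \<kappa> M F \<xi> \<longrightarrow>
        (\<forall>t\<in>{1..T}. \<alpha> t = 1 / sqrt (real T)) \<longrightarrow>
        (\<forall>l\<in>{1..m}. \<forall>\<delta>. 0 < \<delta> \<and> \<delta> < 1 \<longrightarrow>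
           measure M {\<omega> \<in> space M. ftot (time_average (x l) T \<omega>) - ftot xs \<le>
             C * (if \<theta> < 1
                  then (ln (real T / \<delta>) powr (2 * \<theta>) + (ln (1 / \<delta>))\<^sup>2) / sqrt (real T)
                  else ln (real T / \<delta>) powr (2 * \<theta>) / sqrt (real T))}
           \<ge> 1 - \<delta>))"
proof -
  obtain c where c: "0 < c" "\<And>z. norm z \<le> c * dual_norm N z" "continuous_on UNIV (dual_norm N)"
    using dual_norm_equiv[OF \<open>is_norm N\<close>] by metis
  have opt: "(\<Sum>i=1..m. f i xs) \<le> (\<Sum>i=1..m. f i z)" if "z \<in> X" for z
    using \<open>\<forall>x\<in>X. ftot xs \<le> ftot x\<close> that unfolding ftot_def by blast
  have \<theta>: "0 < \<theta>" using \<open>1 / 2 \<le> \<theta>\<close> by simp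
  define K where "K = (m + 1) * B"
  define b where "b = c * \<kappa>"
  define h where "h = b * (4 * \<theta>) powr \<theta>"
  define \<rho> where "\<rho> = max 0 (\<theta> - 1)"
  let ?e = "spread m x1" and ?v = "sq_dist_sum m xs x1"
  have b: "0 < b" and h: "0 \<le> h" using c \<open>0 < \<kappa>\<close> by (auto simp: b_def h_def)
  have cG: "0 \<le> c * G" using \<open>subgradients_bounded m N D X f G\<close> c(1) unfolding subgradients_bounded_def by simp
  have \<eta>: "0 < \<eta>" using \<open>network_assumption m W B \<eta>\<close> unfolding network_assumption_def by simp
  have e: "0 \<le> ?e" by (rule spread_nonneg[OF \<open>1 \<le> m\<close>])
  have v: "0 \<le> ?v" unfolding sq_dist_sum_def by (intro sum_nonneg) simp
  obtain \<beta>\<^sub>0 C where \<beta>0: "0 < \<beta>\<^sub>0" and C: "0 < C" and budget: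
    "\<And>(T::nat) \<delta> \<tau> s S r R A \<beta> u.
       10 \<le> T \<Longrightarrow> 0 < \<delta> \<Longrightarrow> \<delta> < 1 \<Longrightarrow> 1 \<le> \<tau> \<Longrightarrow> 0 < s \<Longrightarrow> s * \<tau> \<le> 1 \<Longrightarrow> 0 \<le> S \<Longrightarrow>
       r = 2 * ln (4 * real m * real T / \<delta>) \<Longrightarrow> R = b * r powr \<theta> \<Longrightarrow>
       A = 4 * m * (c * G) * (K / \<eta> ^ K * (s * ?e + 4 * (c * G + R) * S)) + 2 * m * ((c * G)\<^sup>2 + R\<^sup>2) * S \<Longrightarrow>
       \<beta> = \<beta>\<^sub>0 * \<tau> / ln (real T / \<delta>) powr \<rho> \<Longrightarrow>
       u = (ln (2 * real m * real T / \<delta>) + 4 * h\<^sup>2 * \<beta>\<^sup>2 * S + 2 * h * \<beta>) / \<beta> \<Longrightarrow>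
       \<beta> * s * b * (1 + r) powr \<rho> \<le> 1 / 2 \<and>
       2 * (?v + A) + 4 * (real m)\<^sup>2 * u\<^sup>2 + 1
         \<le> C * (ln (real T / \<delta>) powr (2 * \<theta>) * (1 + S)
              + ln (real T / \<delta>) powr (2 + 2 * \<rho>) / \<tau>\<^sup>2 + \<tau>\<^sup>2 * S\<^sup>2)"
    using descent_budget_bound[OF \<open>1 \<le> m\<close> cG b h \<theta> \<eta> e v, of K, folded \<rho>_def] by blast
  \<comment> \<open>Both step size rules are instances of one estimate, differing in \<open>\<tau>\<close>, in \<open>S\<close> and in the last step size.\<close>
  have gap: "1 - \<delta> \<le> measure M {\<omega> \<in> space M. ftot (time_average (x l) T \<omega>) - ftot xs \<le> Z}"
    if run: "dsgd_sw_run m D X f W x1 \<alpha> M F x g \<xi>" and noise: "noise_assumption m N \<theta> \<kappa> M F \<xi>"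
      and T: "10 \<le> T" and l: "l \<in> {1..m}" and \<delta>: "0 < \<delta>" "\<delta> < 1"
      and dec: "\<And>s t. 1 \<le> s \<Longrightarrow> s \<le> t \<Longrightarrow> t \<le> T \<Longrightarrow> \<alpha> t \<le> \<alpha> s"
      and \<tau>: "1 \<le> \<tau>" "\<alpha> 1 * \<tau> \<le> 1" and S: "S = (\<Sum>t=1..T. (\<alpha> t)\<^sup>2)" and Z:
      "C * (ln (real T / \<delta>) powr (2 * \<theta>) * (1 + S)
         + ln (real T / \<delta>) powr (2 + 2 * \<rho>) / \<tau>\<^sup>2 + \<tau>\<^sup>2 * S\<^sup>2) / (2 * real T * \<alpha> T) \<le> Z"
    for M :: "'w measure" and F \<alpha> x g \<xi> and T l :: nat and \<delta> \<tau> S Z :: real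
  proof -
    have T1: "1 \<le> T" using T by simp
    have \<alpha>: "0 < \<alpha> t" if "1 \<le> t" for t using run that unfolding dsgd_sw_run_def by blast
    have S0: "0 \<le> S" unfolding S by (rule sum_nonneg) simp
    have "\<alpha> 1 * 1 \<le> \<alpha> 1 * \<tau>" using \<tau> \<alpha>[of 1] by (intro mult_left_mono) auto
    then have \<alpha>1: "\<alpha> 1 \<le> 1" using \<tau> by linarith
    define r where "r = 2 * ln (4 * real m * real T / \<delta>)"
    define R where "R = b * r powr \<theta>"
    define A where "A = 4 * m * (c * G) * (K / \<eta> ^ K * (\<alpha> 1 * ?e + 4 * (c * G + R) * S)) + 2 * m * ((c * G)\<^sup>2 + R\<^sup>2) * S"
    define \<beta> where "\<beta> = \<beta>\<^sub>0 * \<tau> / ln (real T / \<delta>) powr \<rho>"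
    define u where "u = (ln (2 * real m * real T / \<delta>) + 4 * h\<^sup>2 * \<beta>\<^sup>2 * S + 2 * h * \<beta>) / \<beta>"
    define d where "d = 2 * (?v + A) + 4 * (real m)\<^sup>2 * u\<^sup>2 + 1"
    have bounds: "\<beta> * \<alpha> 1 * b * (1 + r) powr \<rho> \<le> 1 / 2"
      "d \<le> C * (ln (real T / \<delta>) powr (2 * \<theta>) * (1 + S)
              + ln (real T / \<delta>) powr (2 + 2 * \<rho>) / \<tau>\<^sup>2 + \<tau>\<^sup>2 * S\<^sup>2)"
      using budget[OF T \<delta> \<tau>(1) \<alpha>[OF order_refl] \<tau>(2) S0 r_def R_def A_def \<beta>_def u_def] unfolding d_def by auto
    have "0 < ln (real T / \<delta>)" using log_decomposition[OF T \<delta>] by linarith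
    then have \<beta>: "0 < \<beta>" unfolding \<beta>_def using \<beta>0 \<tau> by simp
    obtain E where E: "E \<in> sets M" "1 - \<delta> \<le> measure M E"
      "\<And>\<omega> l. \<omega> \<in> E \<Longrightarrow> l \<in> {1..m} \<Longrightarrow>
        (\<Sum>t=1..T. 2 * \<alpha> t * ((\<Sum>i=1..m. f i (x l t \<omega>)) - (\<Sum>i=1..m. f i xs))) \<le> d"
      using high_probability_descent[OF \<open>1 \<le> m\<close> c \<open>closed X\<close> \<open>convex X\<close> \<open>X \<subseteq> D\<close>
          \<open>\<forall>i\<in>{1..m}. convex_on D (f i)\<close> \<open>xs \<in> X\<close> opt \<open>\<forall>i\<in>{1..m}. x1 i \<in> X\<close>
          \<open>network_assumption m W B \<eta>\<close> \<open>subgradients_bounded m N D X f G\<close> \<theta> \<open>0 < \<kappa>\<close> run noise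
          T1 \<delta> dec \<alpha>1 b_def h_def r_def \<beta> bounds(1)[unfolded \<rho>_def] R_def S K_def A_def u_def d_def]
      by blast
    show ?thesis
      unfolding ftot_def
    proof (rule high_probability_average_gap[OF \<open>1 \<le> m\<close> c \<open>closed X\<close> \<open>convex X\<close> \<open>X \<subseteq> D\<close>
          \<open>\<forall>i\<in>{1..m}. convex_on D (f i)\<close> \<open>xs \<in> X\<close> opt \<open>\<forall>i\<in>{1..m}. x1 i \<in> X\<close>
          \<open>network_assumption m W B \<eta>\<close> \<open>subgradients_bounded m N D X f G\<close> \<theta> \<open>0 < \<kappa>\<close> run noise
          E(1,2) E(3)[OF _ l] l T1 \<alpha>[OF T1]])
      show "\<alpha> T \<le> \<alpha> t" if "t \<in> {1..T}" for t using dec[of t T] that by simp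
      have "d / (2 * real T * \<alpha> T) \<le> C * (ln (real T / \<delta>) powr (2 * \<theta>) * (1 + S)
         + ln (real T / \<delta>) powr (2 + 2 * \<rho>) / \<tau>\<^sup>2 + \<tau>\<^sup>2 * S\<^sup>2) / (2 * real T * \<alpha> T)"
        using bounds(2) \<alpha>[OF T1] by (intro divide_right_mono) auto
      then show "d / (2 * real T * \<alpha> T) \<le> Z" using Z by linarith
    qed
  qed
  show ?thesis
  proof (rule conjI[OF exI[of _ "9 * C"] exI[of _ "5 * C"]]; intro conjI allI impI ballI)
    fix M :: "'w measure" and F \<alpha> x g \<xi> and T l :: nat and \<delta> :: real
    assume run: "dsgd_sw_run m D X f W x1 \<alpha> M F x g \<xi>" and noise: "noise_assumption m N \<theta> \<kappa> M F \<xi>"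
      and \<alpha>: "\<forall>t\<ge>1. \<alpha> t = 1 / sqrt (real t + 1)" and T: "10 \<le> T" and l: "l \<in> {1..m}" and d: "0 < \<delta> \<and> \<delta> < 1"
    let ?\<Lambda> = "ln (real T / \<delta>)"
    let ?Z = "?\<Lambda> powr (2 * \<theta>) * (ln (real T))\<^sup>2 + (ln (1 / \<delta>))\<^sup>2 * ?\<Lambda> powr (2 * \<rho>)"
    define S where "S = (\<Sum>t=1..T. (\<alpha> t)\<^sup>2)"
    have "S = (\<Sum>t=1..T. 1 / (real t + 1))"
      unfolding S_def by (rule sum.cong) (use \<alpha> in \<open>simp_all add: power_divide\<close>)
    also have "\<dots> \<le> ln (real T + 1)" by (rule sum_inverse_Suc_le_ln)
    also have "\<dots> \<le> ln ((real T)\<^sup>2)"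
    proof -
      have "10 * real T \<le> real T * real T" using T by (intro mult_right_mono) auto
      moreover have "10 \<le> real T" using T by simp
      ultimately have "real T + 1 \<le> (real T)\<^sup>2" unfolding power2_eq_square by linarith
      then show ?thesis using T by (subst ln_le_cancel_iff) auto
    qed
    also have "\<dots> = 2 * ln (real T)" using T by (simp add: ln_realpow)
    finally have S2: "S \<le> 2 * ln (real T)" .
    have S0: "0 \<le> S" unfolding S_def by (rule sum_nonneg) simp
    show "1 - \<delta> \<le> measure M {\<omega> \<in> space M. ftot (time_average (x l) T \<omega>) - ftot xs \<le>
             9 * C * (ln (real T / \<delta>) powr (2 * \<theta>) * (ln (real T))\<^sup>2 / sqrt (real T)
                + (ln (1 / \<delta>))\<^sup>2 * ln (real T / \<delta>) powr (2 * max 0 (\<theta> - 1)) / sqrt (real T))}"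
    proof (rule gap[OF run noise T l _ _ _ order_refl _ S_def])
      show "\<alpha> t \<le> \<alpha> s" if "1 \<le> s" "s \<le> t" for s t
        using \<alpha> that by (auto intro!: divide_left_mono)
      show "\<alpha> 1 * 1 \<le> 1" using \<alpha> by simp
      \<comment> \<open>With \<open>\<tau> = 1\<close> the surplus \<open>S\<^sup>2\<close>, at most \<open>4 (ln T)\<^sup>2\<close>, is within the rate.\<close>
      have "C * (?\<Lambda> powr (2 * \<theta>) * (1 + S) + ?\<Lambda> powr (2 + 2 * \<rho>) / 1\<^sup>2 + 1\<^sup>2 * S\<^sup>2) \<le> C * (9 * ?Z)"
        using decreasing_step_rate[OF T _ _ \<open>1 / 2 \<le> \<theta>\<close> S0 S2, of \<delta>] d C
        by (intro mult_left_mono) (auto simp: \<rho>_def)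
      moreover have "1 / (2 * real T * \<alpha> T) \<le> 1 / sqrt (real T)"
      proof -
        have "sqrt (real T + 1) \<le> sqrt (4 * real T)" using T by (intro real_sqrt_le_mono) simp
        also have "\<dots> = 2 * sqrt (real T)" by (simp add: real_sqrt_mult)
        finally have "sqrt (real T + 1) * sqrt (real T) \<le> 2 * sqrt (real T) * sqrt (real T)"
          by (rule mult_right_mono) simp
        also have "\<dots> = 2 * real T" by (simp only: mult.assoc real_sqrt_mult_self abs_of_nat)
        finally have "sqrt (real T + 1) * sqrt (real T) \<le> 2 * real T" .
        then have "sqrt (real T + 1) / (2 * real T) \<le> 1 / sqrt (real T)"
          using T by (simp add: field_simps)
        moreover have "\<alpha> T = 1 / sqrt (real T + 1)" using \<alpha> T by simp
        ultimately show ?thesis by simp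
      qed
      ultimately have "C * (?\<Lambda> powr (2 * \<theta>) * (1 + S) + ?\<Lambda> powr (2 + 2 * \<rho>) / 1\<^sup>2 + 1\<^sup>2 * S\<^sup>2) * (1 / (2 * real T * \<alpha> T))
          \<le> C * (9 * ?Z) * (1 / sqrt (real T))"
        by (rule mult_mono) (use C \<alpha> T in auto)
      also have "C * (9 * ?Z) * (1 / sqrt (real T))
          = 9 * C * (?\<Lambda> powr (2 * \<theta>) * (ln (real T))\<^sup>2 / sqrt (real T)
                + (ln (1 / \<delta>))\<^sup>2 * ?\<Lambda> powr (2 * max 0 (\<theta> - 1)) / sqrt (real T))"
        unfolding \<rho>_def by (simp add: add_divide_distrib distrib_left mult_ac)
      finally show "C * (?\<Lambda> powr (2 * \<theta>) * (1 + S) + ?\<Lambda> powr (2 + 2 * \<rho>) / 1\<^sup>2 + 1\<^sup>2 * S\<^sup>2) / (2 * real T * \<alpha> T)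
          \<le> 9 * C * (?\<Lambda> powr (2 * \<theta>) * (ln (real T))\<^sup>2 / sqrt (real T)
                + (ln (1 / \<delta>))\<^sup>2 * ?\<Lambda> powr (2 * max 0 (\<theta> - 1)) / sqrt (real T))"
        by (simp only: times_divide_eq_right mult_1_right)
    qed (use d in auto)
  next
    fix T :: nat and M :: "'w measure" and F \<alpha> x g \<xi> and l :: nat and \<delta> :: real
    assume T: "10 \<le> T" and run: "dsgd_sw_run m D X f W x1 \<alpha> M F x g \<xi>" and noise: "noise_assumption m N \<theta> \<kappa> M F \<xi>"
      and \<alpha>: "\<forall>t\<in>{1..T}. \<alpha> t = 1 / sqrt (real T)" and l: "l \<in> {1..m}" and d: "0 < \<delta> \<and> \<delta> < 1"
    let ?\<Lambda> = "ln (real T / \<delta>)" and ?L = "ln (real T)"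
    let ?Z = "if \<theta> < 1 then ?\<Lambda> powr (2 * \<theta>) + (ln (1 / \<delta>))\<^sup>2 else ?\<Lambda> powr (2 * \<theta>)"
    have L1: "1 \<le> ?L" using log_decomposition[OF T] d by blast
    have S: "1 = (\<Sum>t=1..T. (\<alpha> t)\<^sup>2)"
    proof -
      have "(\<Sum>t=1..T. (\<alpha> t)\<^sup>2) = (\<Sum>t=1..T. 1 / real T)"
        by (rule sum.cong) (use \<alpha> in \<open>simp_all add: power_divide\<close>)
      then show ?thesis using T by simp
    qed
    show "1 - \<delta> \<le> measure M {\<omega> \<in> space M. ftot (time_average (x l) T \<omega>) - ftot xs \<le>
             5 * C * (if \<theta> < 1
                  then (ln (real T / \<delta>) powr (2 * \<theta>) + (ln (1 / \<delta>))\<^sup>2) / sqrt (real T)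
                  else ln (real T / \<delta>) powr (2 * \<theta>) / sqrt (real T))}"
    proof (rule gap[OF run noise T l _ _ _ _ _ S, where \<tau> = "sqrt ?L"])
      show "\<alpha> t \<le> \<alpha> s" if "1 \<le> s" "s \<le> t" "t \<le> T" for s t
        using \<alpha> that by simp
      show "1 \<le> sqrt ?L" using L1 by simp
      show "\<alpha> 1 * sqrt ?L \<le> 1"
      proof -
        have "?L \<le> real T" using ln_le_minus_one[of "real T"] T by simp
        then have "sqrt ?L \<le> sqrt (real T)" by simp
        moreover have "\<alpha> 1 = 1 / sqrt (real T)" using \<alpha> T by simp
        ultimately show ?thesis using T by simp
      qed
      have sq: "(sqrt ?L)\<^sup>2 = ?L" using L1 by simp
      have "C * (?\<Lambda> powr (2 * \<theta>) * (1 + 1) + ?\<Lambda> powr (2 + 2 * \<rho>) / (sqrt ?L)\<^sup>2 + (sqrt ?L)\<^sup>2 * 1\<^sup>2) \<le> C * (5 * ?Z)"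
        unfolding sq using constant_step_rate[OF T _ _ \<open>1 / 2 \<le> \<theta>\<close>, of \<delta>] d C
        by (intro mult_left_mono) (auto simp: \<rho>_def)
      moreover have "1 / (2 * real T * \<alpha> T) \<le> 1 / sqrt (real T)"
      proof -
        have "1 / (2 * real T * \<alpha> T) = sqrt (real T) / (2 * real T)" using \<alpha> T by simp
        also have "\<dots> \<le> 1 / sqrt (real T)" using T by (simp add: field_simps)
        finally show ?thesis .
      qed
      ultimately have "C * (?\<Lambda> powr (2 * \<theta>) * (1 + 1) + ?\<Lambda> powr (2 + 2 * \<rho>) / (sqrt ?L)\<^sup>2 + (sqrt ?L)\<^sup>2 * 1\<^sup>2)
          * (1 / (2 * real T * \<alpha> T)) \<le> C * (5 * ?Z) * (1 / sqrt (real T))"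
        by (rule mult_mono) (use C \<alpha> T in auto)
      also have "C * (5 * ?Z) * (1 / sqrt (real T))
          = 5 * C * (if \<theta> < 1 then (?\<Lambda> powr (2 * \<theta>) + (ln (1 / \<delta>))\<^sup>2) / sqrt (real T)
                  else ?\<Lambda> powr (2 * \<theta>) / sqrt (real T))"
        by simp
      finally show "C * (?\<Lambda> powr (2 * \<theta>) * (1 + 1) + ?\<Lambda> powr (2 + 2 * \<rho>) / (sqrt ?L)\<^sup>2 + (sqrt ?L)\<^sup>2 * 1\<^sup>2) / (2 * real T * \<alpha> T)
          \<le> 5 * C * (if \<theta> < 1 then (?\<Lambda> powr (2 * \<theta>) + (ln (1 / \<delta>))\<^sup>2) / sqrt (real T)
                  else ?\<Lambda> powr (2 * \<theta>) / sqrt (real T))"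
        by (simp only: times_divide_eq_right mult_1_right)
    qed (use d in auto)
  qed (use C in auto)
qed

end
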